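(* Let $n\ge4$ and $\frac1{\sqrt2}<t\le1$. Then for all $a\in S^{n-1}$, $$P(a,t)\le P(e_1,t)=\frac{\sqrt{n-1}}{(n-2)!}\,2^{n-1}(1-t)^{n-2}.$$ For $n=3$ the same holds for $\frac45<t\le1$.
   Context: $K=B(\ell_1^n)=\{x\in\mathbb{R}^n:\|x\|_1\le1\}$ is the cross-polytope with boundary $\partial K$. For $a\in S^{n-1}$, $t\in\mathbb{R}$, $H_t(a)=\{x\in\mathbb{R}^n:\langle a,x\rangle=t\}$ and the perimeter function is $P(a,t)=\mathrm{vol}_{n-2}(H_t(a)\cap\partial K)$. $e_1=(1,0,\dots,0)$. *)

theory Defs
  imports "HOL-Analysis.Analysis"
begin

text \<open>s-dimensional Hausdorff measure on a Euclidean space, normalised so that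
  for integer s = k it agrees with k-dimensional volume on k-dimensional flats
  (normalising constant omega_s / 2^s, omega_s = unit ball volume).\<close>

definition hausdorff_pre :: "real \<Rightarrow> real \<Rightarrow> 'a::euclidean_space set \<Rightarrow> ennreal" where
  "hausdorff_pre s \<delta> A =
     (INF C \<in> {C :: nat \<Rightarrow> 'a set. A \<subseteq> (\<Union>i. C i) \<and> (\<forall>i. bounded (C i) \<and> diameter (C i) \<le> \<delta>)}.
        (\<Sum>i. ennreal (unit_ball_vol s / 2 powr s * diameter (C i) powr s)))"

definition hausdorff_measure :: "real \<Rightarrow> 'a::euclidean_space set \<Rightarrow> ennreal" where
  "hausdorff_measure s A = (SUP \<delta> \<in> {0<..}. hausdorff_pre s \<delta> A)"

definition l1_norm :: "real^'n \<Rightarrow> real" where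
  "l1_norm x = (\<Sum>i\<in>UNIV. \<bar>x $ i\<bar>)"

definition cross_polytope :: "(real^'n) set" where
  "cross_polytope = {x. l1_norm x \<le> 1}"

definition perimeter :: "real^'n \<Rightarrow> real \<Rightarrow> ennreal" where
  "perimeter a t = hausdorff_measure (real CARD('n) - 2)
      ({x. a \<bullet> x = t} \<inter> frontier (cross_polytope :: (real^'n) set))"

end

theory Submission
  imports Defs
begin

text \<open>
  If all coordinates of a have modulus less than t, the section is empty. Otherwise exactly one
  coordinate p has \<open>\<alpha> = \<bar>a $ p\<bar> \<ge> t\<close>, because \<open>t > 1 / sqrt 2\<close>. The hyperplane then cuts off a single
  vertex of the cross-polytope, so its intersection with the boundary consists of one
  (n - 2)-dimensional simplex for every sign vector \<open>\<epsilon>\<close> on the other coordinates, of volume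
  \<open>(\<alpha> - t) ^ (n - 2) / fact (n - 2) * sqrt (n - X\<^sup>2) / (\<Prod>j\<noteq>p. \<alpha> - \<epsilon> j * a $ j)\<close> with
  \<open>X = \<alpha> + (\<Sum>j\<noteq>p. \<epsilon> j * a $ j)\<close>.

  Weighting \<open>\<epsilon>\<close> by the reciprocal of the product makes the signs independent, and X has mean
  \<open>1 / \<alpha> \<ge> 1\<close>. Bounding the concave function \<open>sqrt (n - X\<^sup>2)\<close> by its tangent at 1 therefore gives
  at most \<open>sqrt (n - 1)\<close> times the total weight, which is controlled by
  \<open>(\<Prod>j. 1 - x j) \<ge> 1 - (\<Sum>j. x j)\<close>; what remains is a polynomial inequality in \<open>\<alpha>\<close> and t.

  That Hausdorff measure agrees with volume on flats comes from two facts, both proved over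
  finite products of the real line since the dimension n - 2 is not that of an available type.
  Covering sets have at most the volume of a ball of the same diameter, because
  \<open>vol S \<le> vol ((S - S) / 2)\<close> by Prekopa--Leindler; and small cubes can be exhausted by balls.
\<close>

subsection \<open>The Prekopa--Leindler inequality for half differences\<close>

text \<open>The two directions need different tools. The upper bound is uniform in the mesh and
  rests on explicit covers, so subadditivity of \<open>hausdorff_pre\<close> is enough and overlaps
  of facets do no harm. Arbitrary covers have to be faced only in the lower bound, which is needed
  for coordinate axes alone, where all charts have the same Gram determinant. Hence additivity of
  Hausdorff measure never enters. The obstacle in the upper bound is the sharp constant: a cube has
  less volume than a ball of equal diameter, so covers by small cubes lose a fixed factor at every
  scale. Filling with balls and iterating on what is left removes that loss. The two ranges of t
  come from the last inequality. For n = 3 it is linear in \<alpha> - t, and near \<alpha> = 1 it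
  forces 4 * (1 - t) \<le> 1, which fails at 1 / sqrt 2. With exponent at least 2 it holds from 1 /
  sqrt 2 on.\<close>

lemma emeasure_lborel_Int_atMost_LIMSEQ:
  fixes A :: "real set"
  assumes A: "A \<in> sets borel" "A \<noteq> {}"
  obtains X where "\<And>n::nat. X n \<in> A" "(\<lambda>n. emeasure lborel (A \<inter> {..X n})) \<longlonglongrightarrow> emeasure lborel A"
proof -
  \<comment> \<open>A countable cofinal subset of \<open>A\<close>. The cut points must lie in
    \<open>A\<close> itself, because the half-difference argument pairs one set with an extreme
    point of the other, and the supremum need not be attained.\<close>
  obtain D where D: "countable D" "D \<noteq> {}" "D \<subseteq> A" "\<And>x. x \<in> A \<Longrightarrow> \<exists>d\<in>D. x \<le> d"
  proof (cases "\<exists>m\<in>A. \<forall>x\<in>A. x \<le> m")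
    case True
    then obtain m where "m \<in> A" "\<forall>x\<in>A. x \<le> m" by blast
    then show ?thesis using that[of "{m}"] by auto
  next
    case False
    let ?Q = "{q\<in>\<rat>. \<exists>a\<in>A. q \<le> a}"
    define f where "f q = (SOME a. a \<in> A \<and> q \<le> a)" for q
    have f: "f q \<in> A \<and> q \<le> f q" if "q \<in> ?Q" for q
      unfolding f_def by (rule someI_ex) (use that in auto)
    have *: "\<exists>d\<in>f ` ?Q. x \<le> d" if "x \<in> A" for x
    proof -
      obtain y where y: "y \<in> A" "x < y" using False \<open>x \<in> A\<close> by (meson not_le)
      obtain q where "q \<in> \<rat>" "x < q" "q < y" using Rats_dense_in_real[OF y(2)] by blast
      then have "q \<in> ?Q" using y(1) by (auto intro!: bexI[of _ y])
      then show ?thesis using f[of q] \<open>x < q\<close> by force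
    qed
    have "countable ?Q" by (rule countable_subset[OF _ countable_rat]) auto
    then have "countable (f ` ?Q)" by (rule countable_image)
    moreover have "f ` ?Q \<noteq> {}" using * A(2) by fast
    moreover have "f ` ?Q \<subseteq> A" using f by (simp add: image_subset_iff)
    ultimately show ?thesis using that * by presburger
  qed
  define g where "g = from_nat_into D"
  have g: "range g = D" unfolding g_def by (rule range_from_nat_into[OF D(2,1)])
  define X where "X n = Max (g ` {..n})" for n
  have "X n \<in> A" for n
  proof -
    have "X n \<in> g ` {..n}" unfolding X_def by (rule Max_in) auto
    then show ?thesis using g D by blast
  qed
  moreover have "(\<lambda>n. emeasure lborel (A \<inter> {..X n})) \<longlonglongrightarrow> emeasure lborel (\<Union>n. A \<inter> {..X n})"
  proof (rule Lim_emeasure_incseq)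
    show "range (\<lambda>n. A \<inter> {..X n}) \<subseteq> sets lborel" using A by auto
    have "X m \<le> X n" if "m \<le> n" for m n
      unfolding X_def using that by (intro Max_mono) auto
    then show "incseq (\<lambda>n. A \<inter> {..X n})" by (force simp: incseq_def)
  qed
  moreover have "(\<Union>n. A \<inter> {..X n}) = A"
  proof -
    have "\<exists>n. x \<le> X n" if "x \<in> A" for x
    proof -
      obtain n where "x \<le> g n" using D(4)[OF \<open>x \<in> A\<close>] g by blast
      then have "x \<le> X n" unfolding X_def by (meson Max_ge atMost_iff finite_atMost finite_imageI image_eqI order_refl order_trans)
      then show ?thesis ..
    qed
    then show ?thesis by auto
  qed
  ultimately show ?thesis using that by metis
qed

text \<open>Brunn-Minkowski on the line. If \<open>a\<close> and \<open>b\<close> were largest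
  points of \<open>A\<close> and \<open>B\<close>, the half differences with \<open>b\<close> fixed
  would lie to the left of \<open>(a - b) / 2\<close> and those with \<open>a\<close> fixed to the
  right, all inside \<open>C\<close>, so the lengths add. Truncation provides the largest
  points.\<close>

lemma emeasure_lborel_half_differences:
  fixes A B C :: "real set"
  assumes [measurable]: "A \<in> sets borel" "B \<in> sets borel" "C \<in> sets borel"
    and ne: "A \<noteq> {}" "B \<noteq> {}"
    and sub: "\<And>x y. x \<in> A \<Longrightarrow> y \<in> B \<Longrightarrow> (x - y) / 2 \<in> C"
  shows "emeasure lborel A + emeasure lborel B \<le> 2 * emeasure lborel C"
proof -
  have *: "emeasure lborel (A \<inter> {..a}) + emeasure lborel (B \<inter> {..b}) \<le> 2 * emeasure lborel C"
    if "a \<in> A" "b \<in> B" for a b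
  proof -
    define m where "m = (a - b) / 2"
    let ?C1 = "C \<inter> {..m}" and ?C2 = "C \<inter> {m<..}"
    have half: "ennreal (1/2) * (2 * x) = x" for x :: ennreal
    proof -
      have "ennreal (1/2) * ennreal 2 = 1" by (subst ennreal_mult[symmetric]) auto
      then show ?thesis by (simp add: mult.assoc[symmetric])
    qed
    have dbl: "emeasure lborel {x. u + c * x \<in> S} = 2 * emeasure lborel S"
      if "S \<in> sets borel" "\<bar>c\<bar> = 1/2" for u c :: real and S
    proof -
      note that(1)[measurable]
      have "emeasure lborel S = (\<integral>\<^sup>+x. indicator S x \<partial>lborel)" by simp
      also have "\<dots> = \<bar>c\<bar> * (\<integral>\<^sup>+x. indicator S (u + c * x) \<partial>lborel)"
        using that by (intro nn_integral_real_affine) auto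
      also have "(\<integral>\<^sup>+x. indicator S (u + c * x) \<partial>lborel) = (\<integral>\<^sup>+x. indicator {x. u + c * x \<in> S} x \<partial>lborel)"
        by (intro nn_integral_cong) (auto simp: indicator_def)
      also have "\<dots> = emeasure lborel {x. u + c * x \<in> S}" by (intro nn_integral_indicator) auto
      finally have "2 * emeasure lborel S = 2 * (ennreal (1/2) * emeasure lborel {x. u + c * x \<in> S})"
        using that by simp
      also have "\<dots> = emeasure lborel {x. u + c * x \<in> S}"
        using half by (metis mult.left_commute)
      finally show ?thesis by simp
    qed
    have "emeasure lborel (A \<inter> {..a}) \<le> emeasure lborel {x. - b / 2 + (1/2) * x \<in> ?C1}"
      using sub that by (intro emeasure_mono) (auto simp: m_def field_simps)
    also have "\<dots> = 2 * emeasure lborel ?C1" by (rule dbl) auto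
    finally have 1: "emeasure lborel (A \<inter> {..a}) \<le> 2 * emeasure lborel ?C1" .
    \<comment> \<open>The point \<open>b\<close> itself is sent to \<open>m\<close>, which is
      counted in \<open>?C1\<close>; being null, it is split off.\<close>
    have "emeasure lborel (B \<inter> {..b}) \<le> emeasure lborel ({x. a / 2 + (-1/2) * x \<in> ?C2} \<union> {b})"
      using sub[OF that(1)] that by (intro emeasure_mono) (auto simp: m_def field_simps)
    also have "\<dots> \<le> emeasure lborel {x. a / 2 + (-1/2) * x \<in> ?C2} + emeasure lborel {b}"
      by (intro emeasure_subadditive) auto
    also have "\<dots> = 2 * emeasure lborel ?C2" by (subst dbl) auto
    finally have 2: "emeasure lborel (B \<inter> {..b}) \<le> 2 * emeasure lborel ?C2" .
    have "emeasure lborel ?C1 + emeasure lborel ?C2 = emeasure lborel (?C1 \<union> ?C2)"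
      by (intro plus_emeasure) auto
    also have "?C1 \<union> ?C2 = C" by auto
    finally show ?thesis using add_mono[OF 1 2] by (simp add: distrib_left[symmetric])
  qed
  obtain X where X: "\<And>n::nat. X n \<in> A" "(\<lambda>n. emeasure lborel (A \<inter> {..X n})) \<longlonglongrightarrow> emeasure lborel A"
    using emeasure_lborel_Int_atMost_LIMSEQ[OF assms(1) ne(1)] by blast
  obtain Y where Y: "\<And>n::nat. Y n \<in> B" "(\<lambda>n. emeasure lborel (B \<inter> {..Y n})) \<longlonglongrightarrow> emeasure lborel B"
    using emeasure_lborel_Int_atMost_LIMSEQ[OF assms(2) ne(2)] by blast
  show ?thesis
    by (rule LIMSEQ_le_const2[OF tendsto_add[OF X(2) Y(2)]]) (use * X Y in auto)
qed

section \<open>From level sets to functions on the line\<close>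

lemma nn_integral_layer_cake:
  fixes f :: "real \<Rightarrow> ennreal"
  assumes [measurable]: "f \<in> borel_measurable borel"
  shows "(\<integral>\<^sup>+x. f x \<partial>lborel) = (\<integral>\<^sup>+s. indicator {0..} s * emeasure lborel {x. ennreal s < f x} \<partial>lborel)"
proof -
  have *: "f x = (\<integral>\<^sup>+s. indicator {s. 0 \<le> s \<and> ennreal s < f x} s \<partial>lborel)" for x
  proof -
    have "(\<integral>\<^sup>+s. indicator {s. 0 \<le> s \<and> ennreal s < f x} s \<partial>lborel) = emeasure lborel {s. 0 \<le> s \<and> ennreal s < f x}"
      by (intro nn_integral_indicator) auto
    also have "\<dots> = f x"
    proof (cases "f x")
      case (real r)
      then have "{s. 0 \<le> s \<and> ennreal s < f x} = {0..<r}" by (auto simp: ennreal_less_iff)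
      then show ?thesis using real by simp
    next
      case top
      then have "{s. 0 \<le> s \<and> ennreal s < f x} = {0..}" by (auto simp: ennreal_less_top)
      moreover have "emeasure lborel {(0::real)..} = top"
      proof -
        have "ennreal r \<le> emeasure lborel {(0::real)..}" if "0 \<le> r" for r
          using that emeasure_mono[of "{0..r}" "{(0::real)..}" lborel] by auto
        note * = this
        show ?thesis
        proof (cases "emeasure lborel {(0::real)..}")
          case (real r)
          then show ?thesis using *[of "r + 1"] by (simp add: ennreal_le_iff)
        qed
      qed
      ultimately show ?thesis using top by simp
    qed
    finally show ?thesis by simp
  qed
  have "(\<integral>\<^sup>+x. f x \<partial>lborel) = (\<integral>\<^sup>+x. \<integral>\<^sup>+s. indicator {s. 0 \<le> s \<and> ennreal s < f x} s \<partial>lborel \<partial>lborel)"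
    using * by simp
  also have "\<dots> = (\<integral>\<^sup>+s. \<integral>\<^sup>+x. indicator {s. 0 \<le> s \<and> ennreal s < f x} s \<partial>lborel \<partial>lborel)"
  proof (rule pair_sigma_finite.Fubini'[symmetric])
    have "{p \<in> space (borel \<Otimes>\<^sub>M borel). (0::real) \<le> snd p \<and> ennreal (snd p) < f (fst p)} \<in> sets (borel \<Otimes>\<^sub>M borel)"
      by measurable
    then have [measurable]: "{p::real \<times> real. 0 \<le> snd p \<and> ennreal (snd p) < f (fst p)} \<in> sets (borel \<Otimes>\<^sub>M borel)"
      by (simp add: space_pair_measure)
    have "(\<lambda>(x, s). indicator {s. 0 \<le> s \<and> ennreal s < f x} s :: ennreal)
        = indicator {p::real \<times> real. 0 \<le> snd p \<and> ennreal (snd p) < f (fst p)}"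
      by (auto simp: indicator_def)
    then show "(\<lambda>(x, s). indicator {s. 0 \<le> s \<and> ennreal s < f x} s :: ennreal) \<in> borel_measurable (lborel \<Otimes>\<^sub>M lborel)"
      by simp
  qed unfold_locales
  also have "\<dots> = (\<integral>\<^sup>+s. \<integral>\<^sup>+x. indicator {0..} s * indicator {x. ennreal s < f x} x \<partial>lborel \<partial>lborel)"
    by (intro nn_integral_cong) (auto simp: indicator_def)
  also have "\<dots> = (\<integral>\<^sup>+s. indicator {0..} s * emeasure lborel {x. ennreal s < f x} \<partial>lborel)"
    by (intro nn_integral_cong, subst nn_integral_cmult) auto
  finally show ?thesis .
qed


text \<open>With both suprema equal to 1, the level sets of \<open>f\<close> and \<open>g\<close>
  are nonempty for the same \<open>s\<close>. Two points at which both values exceed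
  \<open>s\<close> have a product above \<open>s\<^sup>2\<close>, so their half difference lies in
  the level set of \<open>h\<close>. Integrating the one-dimensional estimate over \<open>s\<close>
  gives a bound on the sum of the integrals; the product form follows by the arithmetic-geometric
  mean.\<close>

lemma nn_integral_half_differences_normalized:
  fixes f g h :: "real \<Rightarrow> ennreal"
  assumes [measurable]: "f \<in> borel_measurable borel" "g \<in> borel_measurable borel" "h \<in> borel_measurable borel"
    and f: "\<And>x. f x \<le> 1" "\<And>s. s < 1 \<Longrightarrow> \<exists>x. s < f x"
    and g: "\<And>x. g x \<le> 1" "\<And>s. s < 1 \<Longrightarrow> \<exists>x. s < g x"
    and h: "\<And>x y. f x * g y \<le> (h ((x - y) / 2))\<^sup>2"
  shows "(\<integral>\<^sup>+x. f x \<partial>lborel) + (\<integral>\<^sup>+x. g x \<partial>lborel) \<le> 2 * (\<integral>\<^sup>+x. h x \<partial>lborel)"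
proof -
  have cake: "(\<integral>\<^sup>+x. f x \<partial>lborel) = (\<integral>\<^sup>+s. indicator {0..<1} s * emeasure lborel {x. ennreal s < f x} \<partial>lborel)"
    if [measurable]: "f \<in> borel_measurable borel" and "\<And>x. f x \<le> 1" for f :: "real \<Rightarrow> ennreal"
  proof -
    have "{x. ennreal s < f x} = {}" if "1 \<le> s" for s
      using \<open>\<And>x. f x \<le> 1\<close> that by (auto simp: not_less intro: order_trans[of _ 1])
    then show ?thesis
      unfolding nn_integral_layer_cake[OF that(1)]
      by (intro nn_integral_cong) (auto simp: indicator_def)
  qed
  have "(\<integral>\<^sup>+x. f x \<partial>lborel) + (\<integral>\<^sup>+x. g x \<partial>lborel) =
      (\<integral>\<^sup>+s. indicator {0..<1} s * emeasure lborel {x. ennreal s < f x}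
        + indicator {0..<1} s * emeasure lborel {x. ennreal s < g x} \<partial>lborel)"
    by (subst nn_integral_add) (auto simp: cake f g)
  also have "\<dots> \<le> (\<integral>\<^sup>+s. 2 * (indicator {0..} s * emeasure lborel {x. ennreal s < h x}) \<partial>lborel)"
  proof (intro nn_integral_mono)
    fix s :: real
    have "emeasure lborel {x. ennreal s < f x} + emeasure lborel {x. ennreal s < g x}
        \<le> 2 * emeasure lborel {x. ennreal s < h x}" if s: "0 \<le> s" "s < 1"
    proof (rule emeasure_lborel_half_differences)
      show "{x. ennreal s < f x} \<noteq> {}" "{x. ennreal s < g x} \<noteq> {}"
        using f(2)[of "ennreal s"] g(2)[of "ennreal s"] s by (auto simp: ennreal_less_one_iff)
      fix x y assume xy: "x \<in> {x. ennreal s < f x}" "y \<in> {x. ennreal s < g x}"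
      have fin: "f x \<noteq> top" "g y \<noteq> top"
        using f(1)[of x] g(1)[of y] by (auto simp: top_unique)
      obtain u v where uv: "f x = ennreal u" "g y = ennreal v" "0 \<le> u" "0 \<le> v"
        using fin by (metis ennreal_cases)
      have "ennreal s < h ((x - y) / 2)"
      proof (rule ccontr)
        assume "\<not> ?thesis"
        then have "(h ((x - y) / 2))\<^sup>2 \<le> (ennreal s)\<^sup>2" by (intro power_mono) auto
        then have "f x * g y \<le> (ennreal s)\<^sup>2" using h order_trans by blast
        then have "u * v \<le> s\<^sup>2" using uv s
          by (simp add: ennreal_mult[symmetric] ennreal_power ennreal_le_iff)
        moreover have "s < u" "s < v" using xy uv s by (auto simp: ennreal_less_iff)
        then have "s * s < u * v" using s by (intro mult_strict_mono') auto
        ultimately show False by (simp add: power2_eq_square)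
      qed
      then show "(x - y) / 2 \<in> {x. ennreal s < h x}" by simp
    qed auto
    then show "indicator {0..<1} s * emeasure lborel {x. ennreal s < f x}
        + indicator {0..<1} s * emeasure lborel {x. ennreal s < g x}
        \<le> 2 * (indicator {0..} s * emeasure lborel {x. ennreal s < h x})"
      by (auto simp: indicator_def)
  qed
  also have "\<dots> = 2 * (\<integral>\<^sup>+x. h x \<partial>lborel)"
    by (subst nn_integral_cmult) (auto simp: nn_integral_layer_cake[of h, symmetric])
  finally show ?thesis .
qed

lemma ennreal_mult_le_square_mean:
  fixes a b c :: ennreal
  assumes "a + b \<le> 2 * c"
  shows "a * b \<le> c\<^sup>2"
proof (cases c)
  case (real z)
  then have "a + b < top"
    using le_less_trans[OF assms, of top] by (simp add: ennreal_mult_less_top)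
  then obtain x y where xy: "a = ennreal x" "b = ennreal y" "0 \<le> x" "0 \<le> y"
    by (cases a; cases b) auto
  have "ennreal (x + y) \<le> ennreal (2 * z)"
    using assms xy real by (simp add: ennreal_mult)
  then have "x + y \<le> 2 * z" using real by (simp add: ennreal_le_iff)
  then have "(x + y)\<^sup>2 \<le> (2 * z)\<^sup>2" using xy by (intro power_mono) auto
  moreover have "0 \<le> (x - y)\<^sup>2" by simp
  ultimately have "x * y \<le> z\<^sup>2" by (simp add: power2_eq_square algebra_simps)
  then show ?thesis using xy real by (simp add: ennreal_mult[symmetric] ennreal_power ennreal_le_iff)
qed (simp add: power2_eq_square ennreal_top_mult)

text \<open>Dividing \<open>f\<close> and \<open>g\<close> by their suprema \<open>a\<close> and
  \<open>b\<close> normalises them; \<open>h\<close> must then be divided by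
  \<open>sqrt (a * b)\<close> to keep the pointwise hypothesis. The product inequality is
  homogeneous, unlike the additive one, so the scaling can be undone afterwards.\<close>

lemma nn_integral_half_differences_bounded:
  fixes f g h :: "real \<Rightarrow> ennreal"
  assumes [measurable]: "f \<in> borel_measurable borel" "g \<in> borel_measurable borel" "h \<in> borel_measurable borel"
    and bd: "(SUP x. f x) \<noteq> top" "(SUP x. g x) \<noteq> top"
    and h: "\<And>x y. f x * g y \<le> (h ((x - y) / 2))\<^sup>2"
  shows "(\<integral>\<^sup>+x. f x \<partial>lborel) * (\<integral>\<^sup>+x. g x \<partial>lborel) \<le> (\<integral>\<^sup>+x. h x \<partial>lborel)\<^sup>2"
proof (cases "(SUP x. f x) = 0 \<or> (SUP x. g x) = 0")
  case True
  then have "(\<forall>x. f x = 0) \<or> (\<forall>x. g x = 0)"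
    by (auto simp: SUP_eq_iff bot_ennreal[symmetric] simp del: bot_ennreal)
  then show ?thesis by auto
next
  case False
  obtain a b where ab: "(SUP x. f x) = ennreal a" "(SUP x. g x) = ennreal b" "0 \<le> a" "0 \<le> b"
    using bd by (metis ennreal_cases)
  then have ab0: "0 < a" "0 < b" using False by (auto simp: less_le)
  define c where "c = sqrt (a * b)"
  have c: "0 < c" "c\<^sup>2 = a * b" using ab0 by (auto simp: c_def)
  have norm: "ennreal (1/a) * f x \<le> 1" "s < 1 \<Longrightarrow> \<exists>x. s < ennreal (1/a) * f x"
    if a: "(SUP x. f x) = ennreal a" "0 < a" for f :: "real \<Rightarrow> ennreal" and a s x
  proof -
    have one: "ennreal (1/a) * ennreal a = 1" using a by (subst ennreal_mult[symmetric]) auto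
    have "f x \<le> ennreal a" using a by (metis SUP_upper UNIV_I)
    then show "ennreal (1/a) * f x \<le> 1" using mult_left_mono[of "f x" "ennreal a" "ennreal (1/a)"] one by simp
    assume s: "s < 1"
    show "\<exists>x. s < ennreal (1/a) * f x"
    proof (rule ccontr)
      assume "\<not> ?thesis"
      then have "(SUP x. ennreal (1/a) * f x) \<le> s" by (intro SUP_least) (auto simp: not_less)
      then have "ennreal (1/a) * (SUP x. f x) \<le> s" by (simp add: SUP_mult_left_ennreal)
      then show False using a one s by simp
    qed
  qed
  have "(\<integral>\<^sup>+x. ennreal (1/a) * f x \<partial>lborel) + (\<integral>\<^sup>+x. ennreal (1/b) * g x \<partial>lborel)
      \<le> 2 * (\<integral>\<^sup>+x. ennreal (1/c) * h x \<partial>lborel)"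
  proof (rule nn_integral_half_differences_normalized)
    fix x y
    have "(ennreal (1/a) * f x) * (ennreal (1/b) * g y) = (ennreal (1/c))\<^sup>2 * (f x * g y)"
    proof -
      have "ennreal (1/a) * ennreal (1/b) = (ennreal (1/c))\<^sup>2"
        using ab0 c by (simp add: ennreal_mult[symmetric] ennreal_power power_divide)
      then show ?thesis by (metis mult.assoc mult.left_commute)
    qed
    also have "\<dots> \<le> (ennreal (1/c))\<^sup>2 * (h ((x - y) / 2))\<^sup>2" by (intro mult_left_mono h) auto
    finally show "(ennreal (1/a) * f x) * (ennreal (1/b) * g y) \<le> (ennreal (1/c) * h ((x - y) / 2))\<^sup>2"
      by (simp add: power_mult_distrib)
  qed (use norm ab ab0 in auto)
  then have "(\<integral>\<^sup>+x. ennreal (1/a) * f x \<partial>lborel) * (\<integral>\<^sup>+x. ennreal (1/b) * g x \<partial>lborel)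
      \<le> (\<integral>\<^sup>+x. ennreal (1/c) * h x \<partial>lborel)\<^sup>2"
    by (rule ennreal_mult_le_square_mean)
  then have *: "(ennreal (1/a) * (\<integral>\<^sup>+x. f x \<partial>lborel)) * (ennreal (1/b) * (\<integral>\<^sup>+x. g x \<partial>lborel))
      \<le> (ennreal (1/c) * (\<integral>\<^sup>+x. h x \<partial>lborel))\<^sup>2"
    by (simp add: nn_integral_cmult)
  have e: "(ennreal a * ennreal (1/a)) = 1" "(ennreal b * ennreal (1/b)) = 1" "(ennreal c * ennreal (1/c)) = 1"
    using ab0 c by (auto simp: ennreal_mult[symmetric])
  have "(\<integral>\<^sup>+x. f x \<partial>lborel) * (\<integral>\<^sup>+x. g x \<partial>lborel) = (ennreal a * ennreal (1/a)) * (\<integral>\<^sup>+x. f x \<partial>lborel) * ((ennreal b * ennreal (1/b)) * (\<integral>\<^sup>+x. g x \<partial>lborel))"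
    by (simp only: e mult_1)
  also have "\<dots> = (ennreal a * ennreal b) * ((ennreal (1/a) * (\<integral>\<^sup>+x. f x \<partial>lborel)) * (ennreal (1/b) * (\<integral>\<^sup>+x. g x \<partial>lborel)))"
    by (simp only: mult_ac)
  also have "\<dots> \<le> (ennreal c)\<^sup>2 * (ennreal (1/c) * (\<integral>\<^sup>+x. h x \<partial>lborel))\<^sup>2"
    using * ab0 c by (intro mult_mono) (auto simp: ennreal_mult[symmetric] ennreal_power)
  also have "\<dots> = ((ennreal c * ennreal (1/c)) * (\<integral>\<^sup>+x. h x \<partial>lborel))\<^sup>2"
    by (simp only: power_mult_distrib mult_ac)
  also have "\<dots> = (\<integral>\<^sup>+x. h x \<partial>lborel)\<^sup>2" by (simp only: e mult_1)
  finally show ?thesis .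
qed

text \<open>Truncating \<open>f\<close> and \<open>g\<close> at natural numbers makes their suprema
  finite and only weakens the hypothesis on \<open>h\<close>; monotone convergence removes the
  truncation.\<close>

lemma prekopa_leindler_half_differences_real:
  fixes f g h :: "real \<Rightarrow> ennreal"
  assumes [measurable]: "f \<in> borel_measurable borel" "g \<in> borel_measurable borel" "h \<in> borel_measurable borel"
    and h: "\<And>x y. f x * g y \<le> (h ((x - y) / 2))\<^sup>2"
  shows "(\<integral>\<^sup>+x. f x \<partial>lborel) * (\<integral>\<^sup>+x. g x \<partial>lborel) \<le> (\<integral>\<^sup>+x. h x \<partial>lborel)\<^sup>2"
proof -
  have trunc: "(\<integral>\<^sup>+x. f x \<partial>lborel) = (SUP n. \<integral>\<^sup>+x. min (f x) (of_nat n) \<partial>lborel)"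
    if [measurable]: "f \<in> borel_measurable borel" for f :: "real \<Rightarrow> ennreal"
  proof -
    have "f x = (SUP n. min (f x) (of_nat n))" for x
      by (simp add: inf_min[symmetric] inf_SUP[symmetric] ennreal_SUP_of_nat_eq_top)
    then have "(\<integral>\<^sup>+x. f x \<partial>lborel) = (\<integral>\<^sup>+x. (SUP n. min (f x) (of_nat n)) \<partial>lborel)" by simp
    also have "\<dots> = (SUP n. \<integral>\<^sup>+x. min (f x) (of_nat n) \<partial>lborel)"
      by (rule nn_integral_monotone_convergence_SUP)
        (auto simp: incseq_def le_fun_def intro!: min.coboundedI2 of_nat_mono)
    finally show ?thesis .
  qed
  have "(\<integral>\<^sup>+x. min (f x) (of_nat m) \<partial>lborel) * (\<integral>\<^sup>+x. min (g x) (of_nat n) \<partial>lborel) \<le> (\<integral>\<^sup>+x. h x \<partial>lborel)\<^sup>2" for m n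
  proof (rule nn_integral_half_differences_bounded)
    have "(SUP x. min (f x) (of_nat m)) \<noteq> top" for f :: "real \<Rightarrow> ennreal" and m
    proof -
      have "(SUP x. min (f x) (of_nat m)) \<le> of_nat m" by (intro SUP_least) auto
      also have "\<dots> < top" by (rule of_nat_less_top)
      finally show ?thesis by (rule less_imp_neq)
    qed
    then show "(SUP x. min (f x) (of_nat m)) \<noteq> top" "(SUP x. min (g x) (of_nat n)) \<noteq> top" by auto
    show "min (f x) (of_nat m) * min (g y) (of_nat n) \<le> (h ((x - y) / 2))\<^sup>2" for x y
      by (rule order_trans[OF mult_mono h]) auto
  qed auto
  then show ?thesis
    unfolding trunc[OF assms(1)] trunc[OF assms(2)] SUP_mult_left_ennreal SUP_mult_right_ennreal
    by (intro SUP_least)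
qed

text \<open>Induction on the dimension. With coordinate \<open>i\<close> frozen at \<open>s\<close>,
  \<open>t\<close> and \<open>(s - t) / 2\<close> in \<open>f\<close>, \<open>g\<close> and
  \<open>h\<close>, the induction hypothesis says that the fibre integrals satisfy the hypothesis of
  the one-dimensional case.\<close>

lemma prekopa_leindler_half_differences:
  fixes f g h :: "('i \<Rightarrow> real) \<Rightarrow> ennreal"
  assumes "finite I"
    and "f \<in> borel_measurable (Pi\<^sub>M I (\<lambda>_. lborel))" "g \<in> borel_measurable (Pi\<^sub>M I (\<lambda>_. lborel))"
      "h \<in> borel_measurable (Pi\<^sub>M I (\<lambda>_. lborel))"
    and "\<And>x y. x \<in> extensional I \<Longrightarrow> y \<in> extensional I \<Longrightarrow> f x * g y \<le> (h (\<lambda>i\<in>I. (x i - y i) / 2))\<^sup>2"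
  shows "(\<integral>\<^sup>+x. f x \<partial>Pi\<^sub>M I (\<lambda>_. lborel)) * (\<integral>\<^sup>+x. g x \<partial>Pi\<^sub>M I (\<lambda>_. lborel))
    \<le> (\<integral>\<^sup>+x. h x \<partial>Pi\<^sub>M I (\<lambda>_. lborel))\<^sup>2"
  using assms
proof (induction I arbitrary: f g h rule: finite_induct)
  case empty
  interpret product_sigma_finite "\<lambda>_. lborel :: real measure" by standard
  have "f (\<lambda>_. undefined) * g (\<lambda>_. undefined) \<le> (h (\<lambda>_. undefined))\<^sup>2"
    using empty.prems(4)[of "\<lambda>_. undefined" "\<lambda>_. undefined"] by simp
  then show ?case by (simp add: nn_integral_empty)
next
  case (insert i I)
  interpret product_sigma_finite "\<lambda>_. lborel :: real measure" by standard
  interpret sigma_finite_measure "Pi\<^sub>M I (\<lambda>_. lborel :: real measure)" by (rule sigma_finite) fact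
  note insert.prems(1-3)[measurable]
  have meas: "(\<lambda>x. f (x(i := y))) \<in> borel_measurable (Pi\<^sub>M I (\<lambda>_. lborel))"
    "(\<lambda>y. \<integral>\<^sup>+x. f (x(i := y)) \<partial>Pi\<^sub>M I (\<lambda>_. lborel)) \<in> borel_measurable borel"
    if [measurable]: "f \<in> borel_measurable (Pi\<^sub>M (insert i I) (\<lambda>_. lborel))"
    for f :: "('i \<Rightarrow> real) \<Rightarrow> ennreal" and y
    by measurable
  have split: "(\<integral>\<^sup>+x. f x \<partial>Pi\<^sub>M (insert i I) (\<lambda>_. lborel)) = (\<integral>\<^sup>+y. \<integral>\<^sup>+x. f (x(i := y)) \<partial>Pi\<^sub>M I (\<lambda>_. lborel) \<partial>lborel)"
    if "f \<in> borel_measurable (Pi\<^sub>M (insert i I) (\<lambda>_. lborel))" for f :: "('i \<Rightarrow> real) \<Rightarrow> ennreal"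
    by (rule product_nn_integral_insert_rev) (use insert.hyps that in auto)
  show ?case
    unfolding split[OF insert.prems(1)] split[OF insert.prems(2)] split[OF insert.prems(3)]
  proof (rule prekopa_leindler_half_differences_real)
    fix s t :: real
    show "(\<integral>\<^sup>+x. f (x(i := s)) \<partial>Pi\<^sub>M I (\<lambda>_. lborel)) * (\<integral>\<^sup>+x. g (x(i := t)) \<partial>Pi\<^sub>M I (\<lambda>_. lborel))
        \<le> (\<integral>\<^sup>+x. h (x(i := (s - t) / 2)) \<partial>Pi\<^sub>M I (\<lambda>_. lborel))\<^sup>2"
    proof (rule insert.IH)
      fix x y :: "'i \<Rightarrow> real"
      assume xy: "x \<in> extensional I" "y \<in> extensional I"
      have "f (x(i := s)) * g (y(i := t)) \<le> (h (\<lambda>j\<in>insert i I. ((x(i := s)) j - (y(i := t)) j) / 2))\<^sup>2"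
        by (rule insert.prems(4)) (use xy in \<open>auto simp: extensional_def\<close>)
      also have "(\<lambda>j\<in>insert i I. ((x(i := s)) j - (y(i := t)) j) / 2) = (\<lambda>j\<in>I. (x j - y j) / 2)(i := (s - t) / 2)"
        using insert.hyps by (auto simp: fun_eq_iff)
      finally show "f (x(i := s)) * g (y(i := t)) \<le> (h ((\<lambda>j\<in>I. (x j - y j) / 2)(i := (s - t) / 2)))\<^sup>2" .
    qed (intro meas insert.prems(1-3))+
  qed (intro meas insert.prems(1-3))+
qed

text \<open>With D a ball whose radius is half the diameter of S, this is the isodiametric inequality.\<close>
lemma emeasure_le_half_differences:
  fixes S D :: "('i \<Rightarrow> real) set"
  assumes "finite I" and [measurable]: "S \<in> sets (Pi\<^sub>M I (\<lambda>_. lborel))" "D \<in> sets (Pi\<^sub>M I (\<lambda>_. lborel))"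
    and D: "\<And>x y. x \<in> S \<Longrightarrow> y \<in> S \<Longrightarrow> (\<lambda>i\<in>I. (x i - y i) / 2) \<in> D"
  shows "emeasure (Pi\<^sub>M I (\<lambda>_. lborel)) S \<le> emeasure (Pi\<^sub>M I (\<lambda>_. lborel)) D"
proof (rule ccontr)
  let ?a = "emeasure (Pi\<^sub>M I (\<lambda>_. lborel)) S" and ?d = "emeasure (Pi\<^sub>M I (\<lambda>_. lborel)) D"
  have "(\<integral>\<^sup>+x. indicator S x \<partial>Pi\<^sub>M I (\<lambda>_. lborel)) * (\<integral>\<^sup>+x. indicator S x \<partial>Pi\<^sub>M I (\<lambda>_. lborel))
    \<le> (\<integral>\<^sup>+x. indicator D x \<partial>Pi\<^sub>M I (\<lambda>_. lborel))\<^sup>2"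
    using \<open>finite I\<close> by (rule prekopa_leindler_half_differences) (auto simp: indicator_def D)
  then have *: "?a * ?a \<le> ?d\<^sup>2" by simp
  assume "\<not> ?a \<le> ?d"
  then have "?d < ?a" by simp
  then have d: "?d < top" using less_top order_less_trans by (metis top.not_eq_extremum)
  then obtain r where r: "?d = ennreal r" "0 \<le> r" by (cases ?d) auto
  show False
  proof (cases ?a)
    case (real x)
    then have "r < x" using \<open>?d < ?a\<close> r by (simp add: ennreal_less_iff)
    then have "r\<^sup>2 < x\<^sup>2" using r by (intro power_strict_mono) auto
    moreover have "x * x \<le> r\<^sup>2" using * real r by (simp add: ennreal_mult[symmetric] ennreal_power ennreal_le_iff)
    ultimately show False by (simp add: power2_eq_square)
  next
    case top
    then show False using * r by (simp add: ennreal_power ennreal_top_mult top_unique)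
  qed
qed

subsection \<open>Volumes of ellipsoids and simplices\<close>

text \<open>The Gram determinant of the linear map sending y to (y, \<beta> \<cdot> y, \<gamma> \<cdot> y).\<close>
definition gram2 :: "'i set \<Rightarrow> ('i \<Rightarrow> real) \<Rightarrow> ('i \<Rightarrow> real) \<Rightarrow> real" where
  "gram2 I \<beta> \<gamma> = (1 + (\<Sum>i\<in>I. (\<beta> i)\<^sup>2)) * (1 + (\<Sum>i\<in>I. (\<gamma> i)\<^sup>2)) - (\<Sum>i\<in>I. \<beta> i * \<gamma> i)\<^sup>2"

lemma gram2_ge_1: "1 \<le> gram2 I \<beta> \<gamma>"
proof -
  have "(\<Sum>i\<in>I. \<beta> i * \<gamma> i)\<^sup>2 \<le> (\<Sum>i\<in>I. (\<beta> i)\<^sup>2) * (\<Sum>i\<in>I. (\<gamma> i)\<^sup>2)"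
    by (rule Cauchy_Schwarz_ineq_sum)
  moreover have "0 \<le> (\<Sum>i\<in>I. (\<beta> i)\<^sup>2)" "0 \<le> (\<Sum>i\<in>I. (\<gamma> i)\<^sup>2)" by (auto intro: sum_nonneg)
  ultimately show ?thesis unfolding gram2_def by (simp add: algebra_simps)
qed

text \<open>The minimum over y of |y|^2 + (\<sigma> + \<beta> \<cdot> y)^2 + (\<tau> + \<gamma> \<cdot> y)^2.\<close>
definition dual_form :: "'i set \<Rightarrow> ('i \<Rightarrow> real) \<Rightarrow> ('i \<Rightarrow> real) \<Rightarrow> real \<Rightarrow> real \<Rightarrow> real" where
  "dual_form I \<beta> \<gamma> \<sigma> \<tau> = ((1 + (\<Sum>i\<in>I. (\<gamma> i)\<^sup>2)) * \<sigma>\<^sup>2 - 2 * (\<Sum>i\<in>I. \<beta> i * \<gamma> i) * \<sigma> * \<tau>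
     + (1 + (\<Sum>i\<in>I. (\<beta> i)\<^sup>2)) * \<tau>\<^sup>2) / gram2 I \<beta> \<gamma>"

text \<open>A displacement \<open>u\<close> in the new coordinate shifts \<sigma> and \<tau>, and
  minimising over \<open>u\<close> must turn the form for \<open>I\<close> into the form for
  \<open>insert i I\<close>. This is completing the square: \<open>w\<close> is the minimiser, and
  the leading coefficient is the ratio of the Gram determinants.\<close>

lemma dual_form_insert:
  assumes "finite I" "i \<notin> I"
  obtains w where "\<And>u. u\<^sup>2 + dual_form I \<beta> \<gamma> (\<sigma> + \<beta> i * u) (\<tau> + \<gamma> i * u)
    = gram2 (insert i I) \<beta> \<gamma> / gram2 I \<beta> \<gamma> * (u - w)\<^sup>2 + dual_form (insert i I) \<beta> \<gamma> \<sigma> \<tau>"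
proof -
  define p q s where "p = 1 + (\<Sum>i\<in>I. (\<beta> i)\<^sup>2)" "q = 1 + (\<Sum>i\<in>I. (\<gamma> i)\<^sup>2)" "s = (\<Sum>i\<in>I. \<beta> i * \<gamma> i)"
  define b g where "b = \<beta> i" "g = \<gamma> i"
  define D where "D = gram2 I \<beta> \<gamma>"
  define D' where "D' = gram2 (insert i I) \<beta> \<gamma>"
  define N where "N = q * \<sigma> * b - s * (\<sigma> * g + \<tau> * b) + p * \<tau> * g"
  define M where "M = q * \<sigma>\<^sup>2 - 2 * s * \<sigma> * \<tau> + p * \<tau>\<^sup>2"
  define M' where "M' = (q + g\<^sup>2) * \<sigma>\<^sup>2 - 2 * (s + b * g) * \<sigma> * \<tau> + (p + b\<^sup>2) * \<tau>\<^sup>2"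
  have D: "D = p * q - s\<^sup>2" "0 < D" using gram2_ge_1[of I \<beta> \<gamma>] by (auto simp: D_def gram2_def p_q_s_def)
  have D': "D' = (p + b\<^sup>2) * (q + g\<^sup>2) - (s + b * g)\<^sup>2" "0 < D'"
    using gram2_ge_1[of "insert i I" \<beta> \<gamma>] assms
    by (auto simp: D'_def gram2_def p_q_s_def b_g_def add_ac)
  \<comment> \<open>The quadratic in \<open>u\<close> is
    \<open>(D' * u\<^sup>2 + 2 * u * N + M) / D\<close>; this identity says that its minimum is
    \<open>M' / D'\<close>.\<close>
  have key: "M * D' = N\<^sup>2 + D * M'"
    unfolding M_def D' N_def D M'_def by (simp add: power2_eq_square algebra_simps)
  have df': "dual_form (insert i I) \<beta> \<gamma> \<sigma> \<tau> = M' / D'"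
    unfolding dual_form_def D'_def[symmetric] M'_def using assms
    by (simp add: p_q_s_def b_g_def add_ac)
  have "u\<^sup>2 + dual_form I \<beta> \<gamma> (\<sigma> + \<beta> i * u) (\<tau> + \<gamma> i * u)
    = D' / D * (u - (- N / D'))\<^sup>2 + dual_form (insert i I) \<beta> \<gamma> \<sigma> \<tau>" for u
  proof -
    have "u\<^sup>2 + dual_form I \<beta> \<gamma> (\<sigma> + \<beta> i * u) (\<tau> + \<gamma> i * u) =
        (D * u\<^sup>2 + (q * (\<sigma> + b * u)\<^sup>2 - 2 * s * (\<sigma> + b * u) * (\<tau> + g * u) + p * (\<tau> + g * u)\<^sup>2)) / D"
      unfolding dual_form_def D_def[symmetric] p_q_s_def[symmetric] b_g_def[symmetric] using D(2)
      by (simp add: add_divide_distrib)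
    also have "D * u\<^sup>2 + (q * (\<sigma> + b * u)\<^sup>2 - 2 * s * (\<sigma> + b * u) * (\<tau> + g * u) + p * (\<tau> + g * u)\<^sup>2)
        = D' * u\<^sup>2 + 2 * u * N + M"
      unfolding D' D N_def M_def by (simp add: power2_eq_square algebra_simps)
    also have "\<dots> = D' * u\<^sup>2 + 2 * u * N + (N\<^sup>2 + D * M') / D'"
      unfolding key[symmetric] using D'(2) by simp
    also have "\<dots> / D = D' / D * (u - (- N / D'))\<^sup>2 + M' / D'"
      using D(2) D'(2) by (simp add: field_simps power2_eq_square)
    finally show ?thesis unfolding df' .
  qed
  then show ?thesis using that unfolding D_def D'_def by blast
qed

text \<open>Integrates the fibre volumes of an ellipsoid along one coordinate; an affine
  substitution reduces this to the Beta integral that occurs for the ball.\<close>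

lemma nn_integral_sqrt_power:
  assumes "0 < \<kappa>" "0 \<le> R"
  shows "(\<integral>\<^sup>+y. ennreal (if \<kappa> * (y - w)\<^sup>2 \<le> R then sqrt (R - \<kappa> * (y - w)\<^sup>2) ^ n else 0) \<partial>lborel)
    = ennreal (Beta (1/2) (real n / 2 + 1) * sqrt R ^ Suc n / sqrt \<kappa>)"
proof (cases "R = 0")
  \<comment> \<open>The substitution would have scale 0 here. For \<open>n = 0\<close> the integrand
    equals 1 at \<open>w\<close>, so it vanishes only almost everywhere.\<close>
  case True
  have "(\<integral>\<^sup>+y. ennreal (if \<kappa> * (y - w)\<^sup>2 \<le> R then sqrt (R - \<kappa> * (y - w)\<^sup>2) ^ n else 0) \<partial>lborel) = (\<integral>\<^sup>+(y::real). 0 \<partial>lborel)"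
  proof (rule nn_integral_cong_AE)
    have "AE y in lborel. y \<noteq> w" by (rule AE_lborel_singleton)
    then show "AE y in lborel. ennreal (if \<kappa> * (y - w)\<^sup>2 \<le> R then sqrt (R - \<kappa> * (y - w)\<^sup>2) ^ n else 0) = 0"
    proof eventually_elim
      case (elim y)
      then have "0 < \<kappa> * (y - w)\<^sup>2" using assms by simp
      then show ?case using True by auto
    qed
  qed
  then show ?thesis using True by simp
next
  case False
  define c where "c = sqrt (R / \<kappa>)"
  have c: "0 < c" "\<kappa> * c\<^sup>2 = R" using assms False by (auto simp: c_def)
  have "(\<integral>\<^sup>+y. ennreal (if \<kappa> * (y - w)\<^sup>2 \<le> R then sqrt (R - \<kappa> * (y - w)\<^sup>2) ^ n else 0) \<partial>lborel)
    = \<bar>c\<bar> * (\<integral>\<^sup>+x. ennreal (if \<kappa> * ((w + c * x) - w)\<^sup>2 \<le> R then sqrt (R - \<kappa> * ((w + c * x) - w)\<^sup>2) ^ n else 0) \<partial>lborel)"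
    using c by (intro nn_integral_real_affine) auto
  also have "(\<integral>\<^sup>+x. ennreal (if \<kappa> * ((w + c * x) - w)\<^sup>2 \<le> R then sqrt (R - \<kappa> * ((w + c * x) - w)\<^sup>2) ^ n else 0) \<partial>lborel)
    = (\<integral>\<^sup>+x. ennreal (sqrt R ^ n) * ennreal (indicator {-1..1} x * sqrt (1 - x\<^sup>2) ^ n) \<partial>lborel)"
  proof (intro nn_integral_cong)
    fix x :: real
    have e: "\<kappa> * ((w + c * x) - w)\<^sup>2 = R * x\<^sup>2" using c by (simp add: power_mult_distrib mult.assoc[symmetric])
    have "R * x\<^sup>2 \<le> R \<longleftrightarrow> x \<in> {-1..1}" using False assms
      by (auto simp: mult_le_cancel_left1 abs_square_le_1 abs_le_iff)
    moreover have "sqrt (R - R * x\<^sup>2) = sqrt R * sqrt (1 - x\<^sup>2)"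
      by (simp add: real_sqrt_mult[symmetric] algebra_simps)
    ultimately show "ennreal (if \<kappa> * ((w + c * x) - w)\<^sup>2 \<le> R then sqrt (R - \<kappa> * ((w + c * x) - w)\<^sup>2) ^ n else 0)
      = ennreal (sqrt R ^ n) * ennreal (indicator {-1..1} x * sqrt (1 - x\<^sup>2) ^ n)"
      unfolding e using assms by (auto simp: power_mult_distrib ennreal_mult' indicator_def)
  qed
  also have "\<dots> = ennreal (sqrt R ^ n) * (\<integral>\<^sup>+x. ennreal (indicator {-1..1} x * sqrt (1 - x\<^sup>2) ^ n) \<partial>lborel)"
    by (rule nn_integral_cmult) auto
  also have "(\<integral>\<^sup>+x. ennreal (indicator {-1..1} x * sqrt (1 - x\<^sup>2) ^ n) \<partial>lborel) = ennreal (Beta (1/2) (real n / 2 + 1))"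
    using emeasure_cball_aux_integral[of n] by simp
  also have "ennreal \<bar>c\<bar> * (ennreal (sqrt R ^ n) * ennreal (Beta (1/2) (real n / 2 + 1)))
     = ennreal (c * sqrt R ^ n * Beta (1/2) (real n / 2 + 1))"
    using c assms by (simp add: ennreal_mult'[symmetric] mult.assoc)
  also have "c * sqrt R ^ n * Beta (1/2) (real n / 2 + 1) = Beta (1/2) (real n / 2 + 1) * sqrt R ^ Suc n / sqrt \<kappa>"
    by (simp add: c_def real_sqrt_divide)
  finally show ?thesis .
qed

text \<open>Absorbs the Beta factor produced by each slicing step.\<close>

lemma unit_ball_vol_Suc: "unit_ball_vol (real (Suc n)) = unit_ball_vol (real n) * Beta (1/2) (real n / 2 + 1)"
  by (auto simp: unit_ball_vol_def Beta_def Gamma_eq_zero_iff field_simps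
        Gamma_one_half_real powr_half_sqrt [symmetric] powr_add [symmetric])

text \<open>The shifts \<sigma> and \<tau> are there for the induction: fixing the coordinate
  \<open>i\<close> at displacement \<open>u\<close> adds \<open>\<beta> i * u\<close> and
  \<open>\<gamma> i * u\<close> to them and takes \<open>u\<^sup>2\<close> off \<rho>. The fibre is
  thus again a set of this kind.\<close>

lemma emeasure_ellipsoid_shifted:
  assumes "finite I"
  shows "emeasure (Pi\<^sub>M I (\<lambda>_. lborel)) {y \<in> extensional I. (\<Sum>i\<in>I. (y i - z i)\<^sup>2)
        + (\<sigma> + (\<Sum>i\<in>I. \<beta> i * (y i - z i)))\<^sup>2 + (\<tau> + (\<Sum>i\<in>I. \<gamma> i * (y i - z i)))\<^sup>2 \<le> \<rho>}
    = ennreal (if dual_form I \<beta> \<gamma> \<sigma> \<tau> \<le> \<rho> then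
        unit_ball_vol (real (card I)) * sqrt (\<rho> - dual_form I \<beta> \<gamma> \<sigma> \<tau>) ^ card I / sqrt (gram2 I \<beta> \<gamma>) else 0)"
  using assms
proof (induction I arbitrary: \<sigma> \<tau> \<rho> rule: finite_induct)
  case empty
  have "{y \<in> extensional {}. \<sigma>\<^sup>2 + \<tau>\<^sup>2 \<le> \<rho>} = (if \<sigma>\<^sup>2 + \<tau>\<^sup>2 \<le> \<rho> then {\<lambda>_. undefined} else {})" by auto
  then show ?case by (simp add: PiM_empty dual_form_def gram2_def unit_ball_vol_def)
next
  case (insert i I)
  interpret product_sigma_finite "\<lambda>_. lborel :: real measure" by standard
  define E where "E I \<sigma> \<tau> \<rho> = {y \<in> extensional I. (\<Sum>i\<in>I. (y i - z i)\<^sup>2)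
        + (\<sigma> + (\<Sum>i\<in>I. \<beta> i * (y i - z i)))\<^sup>2 + (\<tau> + (\<Sum>i\<in>I. \<gamma> i * (y i - z i)))\<^sup>2 \<le> \<rho>}" for I \<sigma> \<tau> \<rho>
  have meas[measurable]: "E I \<sigma> \<tau> \<rho> \<in> sets (Pi\<^sub>M I (\<lambda>_. lborel))" if [simp]: "finite I" for I \<sigma> \<tau> \<rho>
  proof -
    have "{y \<in> space (Pi\<^sub>M I (\<lambda>_. lborel)). (\<Sum>i\<in>I. (y i - z i)\<^sup>2)
        + (\<sigma> + (\<Sum>i\<in>I. \<beta> i * (y i - z i)))\<^sup>2 + (\<tau> + (\<Sum>i\<in>I. \<gamma> i * (y i - z i)))\<^sup>2 \<le> \<rho>} \<in> sets (Pi\<^sub>M I (\<lambda>_. lborel))"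
      by measurable
    then show ?thesis unfolding E_def by (simp add: space_PiM PiE_def)
  qed
  define G where "G = gram2 I \<beta> \<gamma>"
  define G' where "G' = gram2 (insert i I) \<beta> \<gamma>"
  have G: "0 < G" "0 < G'" using gram2_ge_1[of I \<beta> \<gamma>] gram2_ge_1[of "insert i I" \<beta> \<gamma>] by (auto simp: G_def G'_def)
  define d where "d = dual_form (insert i I) \<beta> \<gamma> \<sigma> \<tau>"
  define \<omega> where "\<omega> = unit_ball_vol (real (card I))"
  obtain w where w: "\<And>u. u\<^sup>2 + dual_form I \<beta> \<gamma> (\<sigma> + \<beta> i * u) (\<tau> + \<gamma> i * u) = G' / G * (u - w)\<^sup>2 + d"
    using dual_form_insert[OF insert.hyps] unfolding G_def G'_def d_def by blast
  have "emeasure (Pi\<^sub>M (insert i I) (\<lambda>_. lborel)) (E (insert i I) \<sigma> \<tau> \<rho>)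
     = (\<integral>\<^sup>+y. indicator (E (insert i I) \<sigma> \<tau> \<rho>) y \<partial>Pi\<^sub>M (insert i I) (\<lambda>_. lborel))"
    using insert.hyps by (subst nn_integral_indicator) auto
  also have "\<dots> = (\<integral>\<^sup>+y. \<integral>\<^sup>+x. indicator (E (insert i I) \<sigma> \<tau> \<rho>) (x(i := y)) \<partial>Pi\<^sub>M I (\<lambda>_. lborel) \<partial>lborel)"
    using insert.hyps by (intro product_nn_integral_insert_rev) auto
  also have "\<dots> = (\<integral>\<^sup>+y. \<integral>\<^sup>+x. indicator (E I (\<sigma> + \<beta> i * (y - z i)) (\<tau> + \<gamma> i * (y - z i)) (\<rho> - (y - z i)\<^sup>2)) x \<partial>Pi\<^sub>M I (\<lambda>_. lborel) \<partial>lborel)"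
  proof (intro nn_integral_cong)
    fix y :: real and x :: "'a \<Rightarrow> real" assume x: "x \<in> space (Pi\<^sub>M I (\<lambda>_. lborel))"
    then have x: "x \<in> extensional I" by (simp add: space_PiM PiE_def)
    then have x': "x(i := y) \<in> extensional (insert i I)" by (auto simp: extensional_def)
    have "(\<Sum>j\<in>I. F j ((x(i := y)) j)) = (\<Sum>j\<in>I. F j (x j))" for F :: "'a \<Rightarrow> real \<Rightarrow> real"
      using insert.hyps by (intro sum.cong) auto
    from this[of "\<lambda>j v. (v - z j)\<^sup>2"] this[of "\<lambda>j v. \<beta> j * (v - z j)"] this[of "\<lambda>j v. \<gamma> j * (v - z j)"]
    have "x(i := y) \<in> E (insert i I) \<sigma> \<tau> \<rho> \<longleftrightarrow> x \<in> E I (\<sigma> + \<beta> i * (y - z i)) (\<tau> + \<gamma> i * (y - z i)) (\<rho> - (y - z i)\<^sup>2)"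
      using insert.hyps x x' unfolding E_def by (simp add: algebra_simps del: fun_upd_apply) (simp add: algebra_simps)
    then show "(indicator (E (insert i I) \<sigma> \<tau> \<rho>) (x(i := y)) :: ennreal)
        = indicator (E I (\<sigma> + \<beta> i * (y - z i)) (\<tau> + \<gamma> i * (y - z i)) (\<rho> - (y - z i)\<^sup>2)) x"
      by (simp add: indicator_def)
  qed
  also have "\<dots> = (\<integral>\<^sup>+y. emeasure (Pi\<^sub>M I (\<lambda>_. lborel)) (E I (\<sigma> + \<beta> i * (y - z i)) (\<tau> + \<gamma> i * (y - z i)) (\<rho> - (y - z i)\<^sup>2)) \<partial>lborel)"
    using insert.hyps by (intro nn_integral_cong nn_integral_indicator) auto
  also have "\<dots> = (\<integral>\<^sup>+y. ennreal (\<omega> / sqrt G) * ennreal (if G' / G * (y - (z i + w))\<^sup>2 \<le> \<rho> - d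
      then sqrt (\<rho> - d - G' / G * (y - (z i + w))\<^sup>2) ^ card I else 0) \<partial>lborel)"
  proof (intro nn_integral_cong)
    fix y :: real
    have e: "dual_form I \<beta> \<gamma> (\<sigma> + \<beta> i * (y - z i)) (\<tau> + \<gamma> i * (y - z i)) = G' / G * (y - (z i + w))\<^sup>2 + d - (y - z i)\<^sup>2"
      using w[of "y - z i"] by (simp add: algebra_simps)
    show "emeasure (Pi\<^sub>M I (\<lambda>_. lborel)) (E I (\<sigma> + \<beta> i * (y - z i)) (\<tau> + \<gamma> i * (y - z i)) (\<rho> - (y - z i)\<^sup>2))
      = ennreal (\<omega> / sqrt G) * ennreal (if G' / G * (y - (z i + w))\<^sup>2 \<le> \<rho> - d
      then sqrt (\<rho> - d - G' / G * (y - (z i + w))\<^sup>2) ^ card I else 0)"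
      unfolding E_def insert.IH e G_def[symmetric] \<omega>_def[symmetric] using G
      by (auto simp: ennreal_mult'[symmetric] algebra_simps \<omega>_def)
  qed
  also have "\<dots> = ennreal (\<omega> / sqrt G) * (\<integral>\<^sup>+y. ennreal (if G' / G * (y - (z i + w))\<^sup>2 \<le> \<rho> - d
      then sqrt (\<rho> - d - G' / G * (y - (z i + w))\<^sup>2) ^ card I else 0) \<partial>lborel)"
    by (rule nn_integral_cmult) auto
  also have "(\<integral>\<^sup>+y. ennreal (if G' / G * (y - (z i + w))\<^sup>2 \<le> \<rho> - d
      then sqrt (\<rho> - d - G' / G * (y - (z i + w))\<^sup>2) ^ card I else 0) \<partial>lborel)
    = ennreal (if d \<le> \<rho> then Beta (1/2) (real (card I) / 2 + 1) * sqrt (\<rho> - d) ^ Suc (card I) / sqrt (G' / G) else 0)"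
  proof (cases "d \<le> \<rho>")
    case True
    then show ?thesis using G by (subst nn_integral_sqrt_power) auto
  next
    case False
    have "\<not> G' / G * (y - (z i + w))\<^sup>2 \<le> \<rho> - d" for y
    proof -
      have "0 \<le> G' / G * (y - (z i + w))\<^sup>2" using G by simp
      then show ?thesis using False by linarith
    qed
    then show ?thesis using False by simp
  qed
  also have "ennreal (\<omega> / sqrt G) * \<dots> = ennreal (if d \<le> \<rho> then
        unit_ball_vol (real (card (insert i I))) * sqrt (\<rho> - d) ^ card (insert i I) / sqrt G' else 0)"
    using G insert.hyps
    by (simp add: ennreal_mult'[symmetric] \<omega>_def unit_ball_vol_Suc real_sqrt_divide mult.assoc del: of_nat_Suc)
  finally show ?case unfolding E_def d_def G'_def .
qed

lemma emeasure_ellipsoid: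
  assumes "finite I" "0 \<le> r"
  shows "emeasure (Pi\<^sub>M I (\<lambda>_. lborel)) {y \<in> extensional I. (\<Sum>i\<in>I. (y i - z i)\<^sup>2)
        + (\<Sum>i\<in>I. \<beta> i * (y i - z i))\<^sup>2 + (\<Sum>i\<in>I. \<gamma> i * (y i - z i))\<^sup>2 \<le> r\<^sup>2}
    = ennreal (unit_ball_vol (real (card I)) * r ^ card I / sqrt (gram2 I \<beta> \<gamma>))"
  using emeasure_ellipsoid_shifted[OF assms(1), of z 0 \<beta> 0 \<gamma> "r\<^sup>2"] assms(2)
  by (simp add: dual_form_def)

section \<open>Weighted simplices\<close>

lemma sets_PiM_simplex:
  fixes b :: "'i \<Rightarrow> real"
  assumes [simp]: "finite I"
  shows "{y \<in> extensional I. (\<forall>i\<in>I. l \<le> y i) \<and> (\<Sum>i\<in>I. b i * y i) \<le> c} \<in> sets (Pi\<^sub>M I (\<lambda>_. lborel))"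
proof -
  have "{y \<in> space (Pi\<^sub>M I (\<lambda>_. lborel)). (\<forall>i\<in>I. l \<le> y i) \<and> (\<Sum>i\<in>I. b i * y i) \<le> c} \<in> sets (Pi\<^sub>M I (\<lambda>_. lborel))"
    by measurable
  then show ?thesis by (simp add: space_PiM PiE_def)
qed

text \<open>The common lower bound \<open>l\<close> is kept general because the upper estimate uses
  a slightly enlarged simplex (\<open>l = - \<eta>\<close>) and the lower estimate a slightly
  shrunken one (\<open>l = \<eta>\<close>).\<close>

lemma emeasure_weighted_simplex:
  fixes b :: "'i \<Rightarrow> real"
  assumes "finite I" "\<And>i. i \<in> I \<Longrightarrow> 0 < b i"
  shows "emeasure (Pi\<^sub>M I (\<lambda>_. lborel)) {y \<in> extensional I. (\<forall>i\<in>I. l \<le> y i) \<and> (\<Sum>i\<in>I. b i * y i) \<le> c}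
    = ennreal (if l * sum b I \<le> c then (c - l * sum b I) ^ card I / (fact (card I) * prod b I) else 0)"
  using assms
proof (induction I arbitrary: c rule: finite_induct)
  case empty
  have "{y \<in> extensional {}. 0 \<le> c} = (if 0 \<le> c then {\<lambda>_. undefined} else {})" by auto
  then show ?case by (simp add: PiM_empty)
next
  case (insert i I)
  interpret product_sigma_finite "\<lambda>_. lborel :: real measure" by standard
  define E where "E I c = {y \<in> extensional I. (\<forall>i\<in>I. l \<le> y i) \<and> (\<Sum>i\<in>I. b i * y i) \<le> c}" for I c
  have meas[measurable]: "E I c \<in> sets (Pi\<^sub>M I (\<lambda>_. lborel))" if "finite I" for I c
    unfolding E_def using that by (rule sets_PiM_simplex)
  have bi: "0 < b i" and bI: "\<And>j. j \<in> I \<Longrightarrow> 0 < b j" using insert.prems by auto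
  have IH: "emeasure (Pi\<^sub>M I (\<lambda>_. lborel)) (E I c)
      = ennreal (if l * sum b I \<le> c then (c - l * sum b I) ^ card I / (fact (card I) * prod b I) else 0)" for c
    unfolding E_def by (rule insert.IH) (rule bI)
  define P where "P = prod b I"
  have P: "0 < P" unfolding P_def using bI by (rule prod_pos)
  define k where "k = card I"
  \<comment> \<open>The largest value of coordinate \<open>i\<close> for which the fibre is
    nonempty.\<close>
  define u where "u = (c - l * sum b I) / b i"
  have u: "c - b i * y - l * sum b I = b i * (u - y)" for y
    using bi by (simp add: u_def field_simps)
  have "emeasure (Pi\<^sub>M (insert i I) (\<lambda>_. lborel)) (E (insert i I) c)
     = (\<integral>\<^sup>+y. indicator (E (insert i I) c) y \<partial>Pi\<^sub>M (insert i I) (\<lambda>_. lborel))"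
    using insert.hyps by (subst nn_integral_indicator) auto
  also have "\<dots> = (\<integral>\<^sup>+y. \<integral>\<^sup>+x. indicator (E (insert i I) c) (x(i := y)) \<partial>Pi\<^sub>M I (\<lambda>_. lborel) \<partial>lborel)"
    using insert.hyps by (intro product_nn_integral_insert_rev) auto
  also have "\<dots> = (\<integral>\<^sup>+y. \<integral>\<^sup>+x. indicator {l..} y * indicator (E I (c - b i * y)) x \<partial>Pi\<^sub>M I (\<lambda>_. lborel) \<partial>lborel)"
  proof (intro nn_integral_cong)
    fix y :: real and x :: "'i \<Rightarrow> real" assume "x \<in> space (Pi\<^sub>M I (\<lambda>_. lborel))"
    then have x: "x \<in> extensional I" by (simp add: space_PiM PiE_def)
    then have x': "x(i := y) \<in> extensional (insert i I)" by (auto simp: extensional_def)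
    have "(\<Sum>j\<in>I. b j * (x(i := y)) j) = (\<Sum>j\<in>I. b j * x j)"
      using insert.hyps by (intro sum.cong) auto
    moreover have "(\<forall>j\<in>I. l \<le> (x(i := y)) j) \<longleftrightarrow> (\<forall>j\<in>I. l \<le> x j)"
      using insert.hyps by (intro ball_cong) auto
    ultimately have "x(i := y) \<in> E (insert i I) c \<longleftrightarrow> l \<le> y \<and> x \<in> E I (c - b i * y)"
      using insert.hyps x x' unfolding E_def by (auto simp: algebra_simps simp del: fun_upd_apply) (auto simp: mult.commute)
    then show "(indicator (E (insert i I) c) (x(i := y)) :: ennreal) = indicator {l..} y * indicator (E I (c - b i * y)) x"
      by (simp add: indicator_def)
  qed
  also have "\<dots> = (\<integral>\<^sup>+y. indicator {l..} y * emeasure (Pi\<^sub>M I (\<lambda>_. lborel)) (E I (c - b i * y)) \<partial>lborel)"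
    using insert.hyps by (intro nn_integral_cong, subst nn_integral_cmult) auto
  also have "\<dots> = (\<integral>\<^sup>+y. ennreal (b i ^ k * (u - y) ^ k / (fact k * P)) * indicator {l..u} y \<partial>lborel)"
  proof (intro nn_integral_cong)
    fix y
    have "l * sum b I \<le> c - b i * y \<longleftrightarrow> y \<le> u"
      using u[of y] bi by (smt (verit) mult_nonneg_nonneg mult_pos_neg)
    then show "indicator {l..} y * emeasure (Pi\<^sub>M I (\<lambda>_. lborel)) (E I (c - b i * y))
        = ennreal (b i ^ k * (u - y) ^ k / (fact k * P)) * indicator {l..u} y"
      unfolding IH u P_def[symmetric] k_def[symmetric]
      by (auto simp: indicator_def power_mult_distrib)
  qed
  also have "\<dots> = ennreal (if l * sum b (insert i I) \<le> c then
      (c - l * sum b (insert i I)) ^ card (insert i I) / (fact (card (insert i I)) * prod b (insert i I)) else 0)"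
  proof (cases "l \<le> u")
    case True
    define F where "F y = - (b i ^ k * (u - y) ^ Suc k / (fact (Suc k) * P))" for y
    have "(\<integral>\<^sup>+y. ennreal (b i ^ k * (u - y) ^ k / (fact k * P)) * indicator {l..u} y \<partial>lborel) = F u - F l"
    proof (rule nn_integral_FTC_Icc)
      show "(\<lambda>y. b i ^ k * (u - y) ^ k / (fact k * P)) \<in> borel_measurable borel" by measurable
      fix y assume y: "y \<in> {l..u}"
      show "(F has_real_derivative b i ^ k * (u - y) ^ k / (fact k * P)) (at y)"
      proof -
        have "((\<lambda>y. u - y) has_real_derivative - 1) (at y)" by (auto intro!: derivative_eq_intros)
        from DERIV_cmult[OF DERIV_power[OF this, of "Suc k"], of "- (b i ^ k / (fact (Suc k) * P))"]
        have "((\<lambda>y. - (b i ^ k / (fact (Suc k) * P)) * (u - y) ^ Suc k) has_real_derivative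
            b i ^ k / (fact (Suc k) * P) * (real (Suc k) * (u - y) ^ k)) (at y)" by simp
        also have "(\<lambda>y. - (b i ^ k / (fact (Suc k) * P)) * (u - y) ^ Suc k) = F"
          by (simp add: F_def fun_eq_iff)
        also have "b i ^ k / (fact (Suc k) * P) * (real (Suc k) * (u - y) ^ k) = b i ^ k * (u - y) ^ k / (fact k * P)"
          using P by (simp add: field_simps del: of_nat_Suc)
        finally show ?thesis .
      qed
      show "0 \<le> b i ^ k * (u - y) ^ k / (fact k * P)" using y bi P by auto
    qed (use True in auto)
    also have "F u - F l = (b i * (u - l)) ^ Suc k / (fact (Suc k) * (b i * P))"
      using bi by (simp add: F_def power_mult_distrib mult.assoc mult.left_commute[of _ "b i"] del: fact_Suc)
    also have "b i * (u - l) = c - l * sum b (insert i I)"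
      using insert.hyps bi by (simp add: u_def field_simps)
    finally show ?thesis using True insert.hyps bi u[of l]
      by (simp add: k_def P_def algebra_simps mult_left_mono)
  next
    case False
    then have "c - b i * l - l * sum b I < 0" unfolding u using bi by (simp add: mult_pos_neg)
    then have "\<not> l * sum b (insert i I) \<le> c" using insert.hyps by (simp add: algebra_simps)
    then show ?thesis using False by simp
  qed
  finally show ?case unfolding E_def .
qed

subsection \<open>Hausdorff premeasures\<close>

lemma hausdorff_pre_mono: "A \<subseteq> B \<Longrightarrow> hausdorff_pre s \<delta> A \<le> hausdorff_pre s \<delta> B"
  unfolding hausdorff_pre_def by (rule INF_superset_mono) auto

text \<open>The set serves as its own cover, padded with empty sets of weight 0.\<close>

lemma hausdorff_pre_le_diameter:
  fixes A :: "'a::euclidean_space set"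
  assumes "0 < k" "0 \<le> d" "d \<le> \<delta>" and A: "\<And>x y. x \<in> A \<Longrightarrow> y \<in> A \<Longrightarrow> dist x y \<le> d"
  shows "hausdorff_pre (real k) \<delta> A \<le> ennreal (unit_ball_vol (real k) * (d / 2) ^ k)"
proof -
  define C where "C i = (if i = (0::nat) then A else {})" for i
  have bdd: "bounded A" unfolding bounded_two_points using A by blast
  have dA: "diameter A \<le> d" using A assms(2) by (intro diameter_le) (auto simp: dist_norm)
  have d0: "0 \<le> diameter A" using bdd by (rule diameter_ge_0)
  have "hausdorff_pre (real k) \<delta> A \<le> (\<Sum>i. ennreal (unit_ball_vol (real k) / 2 powr real k * diameter (C i) powr real k))"
    unfolding hausdorff_pre_def
    by (rule INF_lower) (use bdd dA assms in \<open>auto simp: C_def split: if_splits\<close>)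
  also have "\<dots> = (\<Sum>i\<in>{0}. ennreal (unit_ball_vol (real k) / 2 powr real k * diameter (C i) powr real k))"
    by (rule suminf_finite) (use \<open>0 < k\<close> in \<open>auto simp: C_def\<close>)
  \<comment> \<open>At diameter 0 this needs \<open>0 < k\<close>: \<open>0 powr 0\<close> is 0
    while \<open>0 ^ 0\<close> is 1.\<close>
  also have "\<dots> = ennreal (unit_ball_vol (real k) / 2 ^ k * diameter A ^ k)"
    using d0 \<open>0 < k\<close> by (simp add: C_def powr_realpow powr_realpow')
  also have "\<dots> \<le> ennreal (unit_ball_vol (real k) * (d / 2) ^ k)"
    using power_mono[OF dA d0, of k] by (intro ennreal_leI) (simp add: power_divide divide_right_mono mult_left_mono)
  finally show ?thesis .
qed

lemma hausdorff_pre_empty: "0 < k \<Longrightarrow> 0 \<le> \<delta> \<Longrightarrow> hausdorff_pre (real k) \<delta> {} = 0"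
  using hausdorff_pre_le_diameter[of k 0 \<delta> "{}"] by (simp add: power_0_left)

lemma hausdorff_pre_UN_le:
  fixes A :: "nat \<Rightarrow> 'a::euclidean_space set"
  shows "hausdorff_pre s \<delta> (\<Union>i. A i) \<le> (\<Sum>i. hausdorff_pre s \<delta> (A i))"
proof (rule ennreal_le_epsilon)
  fix e :: real assume fin: "(\<Sum>i. hausdorff_pre s \<delta> (A i)) < top" and e: "0 < e"
  let ?w = "\<lambda>C :: 'a set. ennreal (unit_ball_vol s / 2 powr s * diameter C powr s)"
  let ?cov = "\<lambda>A C. A \<subseteq> (\<Union>i. C i) \<and> (\<forall>i::nat. bounded (C i) \<and> diameter (C i) \<le> \<delta>)"
  have "\<exists>C. ?cov (A i) C \<and> (\<Sum>j. ?w (C j)) \<le> hausdorff_pre s \<delta> (A i) + ennreal (e * (1/2) ^ Suc i)" for i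
  proof -
    have "hausdorff_pre s \<delta> (A i) < top" using fin by (auto simp: less_top dest!: ennreal_suminf_lessD)
    then have "hausdorff_pre s \<delta> (A i) < hausdorff_pre s \<delta> (A i) + ennreal (e * (1/2) ^ Suc i)"
      using e by (simp add: less_top)
    then obtain C where "C \<in> {C. ?cov (A i) C}" "(\<Sum>j. ?w (C j)) < hausdorff_pre s \<delta> (A i) + ennreal (e * (1/2) ^ Suc i)"
      unfolding hausdorff_pre_def[of s \<delta> "A i"] INF_less_iff by auto
    then show ?thesis by (auto intro!: exI[of _ C] less_imp_le)
  qed
  then obtain C where C: "\<And>i. ?cov (A i) (C i)"
    and Cle: "\<And>i. (\<Sum>j. ?w (C i j)) \<le> hausdorff_pre s \<delta> (A i) + ennreal (e * (1/2) ^ Suc i)"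
    by metis
  define D where "D n = case_prod C (prod_decode n)" for n
  have "hausdorff_pre s \<delta> (\<Union>i. A i) \<le> (\<Sum>n. ?w (D n))"
    unfolding hausdorff_pre_def
  proof (rule INF_lower, safe)
    fix x i assume "x \<in> A i"
    then obtain j where "x \<in> C i j" using C[of i] by blast
    then have "x \<in> D (prod_encode (i, j))" by (simp add: D_def)
    then show "x \<in> (\<Union>n. D n)" by blast
  next
    fix n show "bounded (D n)" "diameter (D n) \<le> \<delta>"
      using C by (auto simp: D_def split: prod.split)
  qed
  also have "\<dots> = (\<Sum>i. \<Sum>j. ?w (C i j))"
    using suminf_ennreal_2dimen[of "\<lambda>i. \<Sum>j. ?w (C i j)" "\<lambda>p. ?w (case_prod C p)"] by (simp add: D_def)
  also have "\<dots> \<le> (\<Sum>i. hausdorff_pre s \<delta> (A i) + ennreal (e * (1/2) ^ Suc i))"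
    by (intro suminf_le Cle) auto
  also have "\<dots> = (\<Sum>i. hausdorff_pre s \<delta> (A i)) + (\<Sum>i. ennreal (e * (1/2) ^ Suc i))"
    by (intro suminf_add[symmetric]) auto
  also have "(\<Sum>i. ennreal (e * (1/2) ^ Suc i)) = ennreal e"
  proof -
    have "(\<lambda>i. e * (1/2) ^ Suc i) sums (e * 1)" by (intro sums_mult power_half_series)
    then have "(\<lambda>i. ennreal (e * (1/2) ^ Suc i)) sums ennreal (e * 1)"
      using e by (subst sums_ennreal) auto
    then show ?thesis by (simp add: sums_iff)
  qed
  finally show "hausdorff_pre s \<delta> (\<Union>i. A i) \<le> (\<Sum>i. hausdorff_pre s \<delta> (A i)) + ennreal e" .
qed

lemma hausdorff_pre_Un_le:
  fixes A B :: "'a::euclidean_space set"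
  assumes "0 < k" "0 \<le> \<delta>"
  shows "hausdorff_pre (real k) \<delta> (A \<union> B) \<le> hausdorff_pre (real k) \<delta> A + hausdorff_pre (real k) \<delta> B"
proof -
  define C where "C i = (if i = (0::nat) then A else if i = 1 then B else {})" for i
  have "A \<union> B = (\<Union>i. C i)" by (auto simp: C_def split: if_splits)
  then have "hausdorff_pre (real k) \<delta> (A \<union> B) \<le> (\<Sum>i. hausdorff_pre (real k) \<delta> (C i))"
    using hausdorff_pre_UN_le[of "real k" \<delta> C] by simp
  also have "\<dots> = (\<Sum>i\<in>{0,1}. hausdorff_pre (real k) \<delta> (C i))"
    by (rule suminf_finite) (use assms in \<open>auto simp: C_def hausdorff_pre_empty\<close>)
  finally show ?thesis by (simp add: C_def)
qed

lemma hausdorff_pre_finite_UN_le: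
  fixes A :: "'i \<Rightarrow> 'a::euclidean_space set"
  assumes "finite F" "0 < k" "0 \<le> \<delta>"
  shows "hausdorff_pre (real k) \<delta> (\<Union>i\<in>F. A i) \<le> (\<Sum>i\<in>F. hausdorff_pre (real k) \<delta> (A i))"
  using assms(1)
proof induction
  case empty
  then show ?case using assms by (simp add: hausdorff_pre_empty)
next
  case (insert i F)
  have "hausdorff_pre (real k) \<delta> (\<Union>i\<in>insert i F. A i) \<le> hausdorff_pre (real k) \<delta> (A i) + hausdorff_pre (real k) \<delta> (\<Union>i\<in>F. A i)"
    using hausdorff_pre_Un_le[OF assms(2,3)] by simp
  also have "\<dots> \<le> hausdorff_pre (real k) \<delta> (A i) + (\<Sum>i\<in>F. hausdorff_pre (real k) \<delta> (A i))"
    using insert by (intro add_left_mono)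
  finally show ?case using insert by simp
qed

subsection \<open>Hausdorff measure of affine images\<close>

definition dyadic_cube :: "'i set \<Rightarrow> nat \<Rightarrow> ('i \<Rightarrow> real) \<Rightarrow> ('i \<Rightarrow> real) set" where
  "dyadic_cube I N y = {z \<in> extensional I. \<forall>i\<in>I. \<lfloor>2 ^ N * z i\<rfloor> = \<lfloor>2 ^ N * y i\<rfloor>}"

lemma dyadic_cube_self: "y \<in> extensional I \<Longrightarrow> y \<in> dyadic_cube I N y"
  by (simp add: dyadic_cube_def)

lemma dyadic_cube_subset_extensional: "dyadic_cube I N y \<subseteq> extensional I"
  by (auto simp: dyadic_cube_def)

text \<open>The floor at level \<open>M\<close> is the integer quotient of the floor at level
  \<open>N\<close> by a power of two, so a fine cube determines the coarser cubes around it.\<close>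

lemma dyadic_cube_eq:
  assumes "z \<in> dyadic_cube I N y" "M \<le> N"
  shows "dyadic_cube I M z = dyadic_cube I M y"
proof -
  have "\<lfloor>2 ^ M * z i\<rfloor> = \<lfloor>2 ^ M * y i\<rfloor>" if "i \<in> I" for i
  proof -
    have fl: "\<lfloor>2 ^ M * x\<rfloor> = \<lfloor>2 ^ N * x\<rfloor> div 2 ^ (N - M)" for x :: real
    proof -
      have "(2::real) ^ N = 2 ^ M * 2 ^ (N - M)" using assms(2) by (simp flip: power_add)
      then have "2 ^ M * x = (2 ^ N * x) / real_of_int (2 ^ (N - M))" by simp
      then show ?thesis by (simp only: floor_divide_real_eq_div zero_le_power zero_le_numeral)
    qed
    have "\<lfloor>2 ^ N * z i\<rfloor> = \<lfloor>2 ^ N * y i\<rfloor>" using assms(1) that by (simp add: dyadic_cube_def)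
    then show ?thesis by (simp add: fl)
  qed
  then show ?thesis by (simp add: dyadic_cube_def)
qed

lemma dyadic_cube_antimono:
  assumes "M \<le> N" shows "dyadic_cube I N y \<subseteq> dyadic_cube I M y"
proof
  fix z assume z: "z \<in> dyadic_cube I N y"
  then have "z \<in> dyadic_cube I M z" by (intro dyadic_cube_self) (simp add: dyadic_cube_def)
  then show "z \<in> dyadic_cube I M y" using dyadic_cube_eq[OF z assms] by simp
qed

lemma dyadic_cube_diff_le:
  assumes "z \<in> dyadic_cube I N y" "x \<in> dyadic_cube I N y" "i \<in> I"
  shows "\<bar>z i - x i\<bar> \<le> (1 / 2) ^ N"
proof -
  have "\<lfloor>2 ^ N * z i\<rfloor> = \<lfloor>2 ^ N * x i\<rfloor>" using assms by (auto simp: dyadic_cube_def)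
  then have "\<bar>2 ^ N * z i - 2 ^ N * x i\<bar> \<le> 1" by linarith
  then have "2 ^ N * \<bar>z i - x i\<bar> \<le> 1" by (simp add: abs_mult flip: right_diff_distrib)
  then show ?thesis by (simp add: power_divide field_simps)
qed

lemma dyadic_cube_PiE:
  "dyadic_cube I N y = Pi\<^sub>E I (\<lambda>i. {\<lfloor>2 ^ N * y i\<rfloor> / 2 ^ N..<(\<lfloor>2 ^ N * y i\<rfloor> + 1) / 2 ^ N})"
  unfolding dyadic_cube_def PiE_def by (auto simp: floor_eq_iff field_simps Pi_iff)

lemma sets_dyadic_cube: "finite I \<Longrightarrow> dyadic_cube I N y \<in> sets (Pi\<^sub>M I (\<lambda>_. lborel))"
  unfolding dyadic_cube_PiE by (rule sets_PiM_I_finite) auto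

lemma emeasure_dyadic_cube:
  assumes "finite I"
  shows "emeasure (Pi\<^sub>M I (\<lambda>_. lborel)) (dyadic_cube I N y) = ennreal (((1 / 2) ^ N) ^ card I)"
proof -
  interpret product_sigma_finite "\<lambda>_. lborel :: real measure" by standard
  have "emeasure lborel {\<lfloor>2 ^ N * y i\<rfloor> / 2 ^ N..<(\<lfloor>2 ^ N * y i\<rfloor> + 1) / 2 ^ N :: real} = ennreal ((1 / 2) ^ N)" for i
    by (subst emeasure_lborel_Ico) (auto simp: divide_right_mono power_divide diff_divide_distrib[symmetric])
  then show ?thesis unfolding dyadic_cube_PiE using assms
    by (subst emeasure_PiM) (auto simp: ennreal_power)
qed

text \<open>Weaker than openness on purpose: a half-open cube minus a closed ellipsoid is in general
  not open but has this property. The level \<open>N\<^sub>0\<close> admits only cubes so fine that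
  small-scale estimates apply to them.\<close>

definition dyadically_open :: "'i set \<Rightarrow> nat \<Rightarrow> ('i \<Rightarrow> real) set \<Rightarrow> bool" where
  "dyadically_open I N\<^sub>0 U \<longleftrightarrow> U \<subseteq> extensional I \<and> (\<forall>y\<in>U. \<exists>N\<ge>N\<^sub>0. dyadic_cube I N y \<subseteq> U)"

text \<open>The maximal dyadic cubes contained in U partition it.\<close>
lemma dyadic_decomposition:
  assumes I: "finite I" and U: "dyadically_open I N\<^sub>0 U"
  obtains \<Q> where "countable \<Q>" "disjoint \<Q>" "\<Union>\<Q> = U"
    "\<And>Q. Q \<in> \<Q> \<Longrightarrow> \<exists>N\<ge>N\<^sub>0. \<exists>y\<in>extensional I. Q = dyadic_cube I N y"
proof -
  define P where "P y N \<longleftrightarrow> N\<^sub>0 \<le> N \<and> dyadic_cube I N y \<subseteq> U" for y N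
  \<comment> \<open>The coarsest admissible level, so \<open>dyadic_cube I (L y) y\<close> is the
    maximal cube around \<open>y\<close>.\<close>
  define L where "L y = (LEAST N. P y N)" for y
  define \<Q> where "\<Q> = (\<lambda>y. dyadic_cube I (L y) y) ` U"
  have Uext: "y \<in> extensional I" if "y \<in> U" for y using U that by (auto simp: dyadically_open_def)
  have L: "P y (L y)" if "y \<in> U" for y
    unfolding L_def by (rule LeastI_ex) (use U that in \<open>auto simp: dyadically_open_def P_def\<close>)
  \<comment> \<open>All points of a maximal cube have that same maximal cube; hence two maximal
    cubes coincide or are disjoint.\<close>
  have Leq: "L z = L y \<and> dyadic_cube I (L y) y = dyadic_cube I (L z) z" if y: "y \<in> U" and z: "z \<in> dyadic_cube I (L y) y" for y z
  proof -
    have eq: "dyadic_cube I N z = dyadic_cube I N y" if "N \<le> L y" for N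
      using dyadic_cube_eq[OF z that] .
    have "P z (L y)" using L[OF y] eq[of "L y"] by (simp add: P_def)
    then have le: "L z \<le> L y" unfolding L_def by (rule Least_le)
    have "z \<in> U" using L[OF y] z by (auto simp: P_def)
    then have "P y (L z)" using L[of z] eq[OF le] by (simp add: P_def)
    then have "L y \<le> L z" unfolding L_def by (rule Least_le)
    then show ?thesis using le eq by auto
  qed
  have "countable \<Q>"
  proof -
    define cub where "cub = (\<lambda>(N, m). {z :: _ \<Rightarrow> real. z \<in> extensional I \<and> (\<forall>i\<in>I. \<lfloor>2 ^ N * z i\<rfloor> = m i)})"
    have "countable ((UNIV :: nat set) \<times> Pi\<^sub>E I (\<lambda>_. UNIV :: int set))"
      using I by (intro countable_SIGMA countable_PiE) auto
    moreover have "\<Q> \<subseteq> cub ` ((UNIV :: nat set) \<times> Pi\<^sub>E I (\<lambda>_. UNIV :: int set))"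
    proof
      fix Q assume "Q \<in> \<Q>"
      then obtain y where "Q = dyadic_cube I (L y) y" by (auto simp: \<Q>_def)
      then have "Q = cub (L y, \<lambda>i\<in>I. \<lfloor>2 ^ L y * y i\<rfloor>)" by (auto simp: dyadic_cube_def cub_def)
      then show "Q \<in> cub ` ((UNIV :: nat set) \<times> Pi\<^sub>E I (\<lambda>_. UNIV :: int set))" by (rule image_eqI) auto
    qed
    ultimately show ?thesis by (meson countable_image countable_subset)
  qed
  moreover have "disjoint \<Q>"
  proof (rule disjointI)
    fix a b assume ab: "a \<in> \<Q>" "b \<in> \<Q>" "a \<noteq> b"
    obtain x y where xy: "x \<in> U" "y \<in> U" "a = dyadic_cube I (L x) x" "b = dyadic_cube I (L y) y"
      using ab by (auto simp: \<Q>_def)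
    have False if "z \<in> a" "z \<in> b" for z
      using Leq[of x z] Leq[of y z] xy ab(3) that by simp
    then show "a \<inter> b = {}" by auto
  qed
  moreover have "\<Union>\<Q> = U"
  proof
    show "\<Union>\<Q> \<subseteq> U" using L by (auto simp: \<Q>_def P_def)
    show "U \<subseteq> \<Union>\<Q>" using dyadic_cube_self[OF Uext] by (auto simp: \<Q>_def)
  qed
  moreover have "\<exists>N\<ge>N\<^sub>0. \<exists>y\<in>extensional I. Q = dyadic_cube I N y" if "Q \<in> \<Q>" for Q
  proof -
    obtain y where y: "y \<in> U" "Q = dyadic_cube I (L y) y" using \<open>Q \<in> \<Q>\<close> by (auto simp: \<Q>_def)
    then show ?thesis using L[OF y(1)] Uext[OF y(1)] by (auto simp: P_def)
  qed
  ultimately show ?thesis using that by blast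
qed

text \<open>The premeasure is countably subadditive and volume is countably additive on the maximal
  cubes, so the constant \<open>c\<close> passes unchanged from cubes to \<open>U\<close>. It serves
  both the complement of a ball in a cube and genuinely open sets.\<close>

lemma hausdorff_pre_image_le_dyadic:
  fixes \<Phi> :: "('i \<Rightarrow> real) \<Rightarrow> 'a::euclidean_space"
  assumes I: "finite I" and k: "0 < k" "0 \<le> \<delta>" and U: "dyadically_open I N\<^sub>0 U"
    and c: "\<And>N y. N\<^sub>0 \<le> N \<Longrightarrow> y \<in> extensional I \<Longrightarrow>
      hausdorff_pre (real k) \<delta> (\<Phi> ` dyadic_cube I N y) \<le> c * emeasure (Pi\<^sub>M I (\<lambda>_. lborel)) (dyadic_cube I N y)"
  shows "hausdorff_pre (real k) \<delta> (\<Phi> ` U) \<le> c * emeasure (Pi\<^sub>M I (\<lambda>_. lborel)) U"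
proof -
  obtain \<Q> where Q: "countable \<Q>" "disjoint \<Q>" "\<Union>\<Q> = U"
    "\<And>Q. Q \<in> \<Q> \<Longrightarrow> \<exists>N\<ge>N\<^sub>0. \<exists>y\<in>extensional I. Q = dyadic_cube I N y"
    using dyadic_decomposition[OF I U] by blast
  have sets: "Q \<in> sets (Pi\<^sub>M I (\<lambda>_. lborel))" if "Q \<in> \<Q>" for Q
    using Q(4)[OF that] sets_dyadic_cube[OF I] by blast
  \<comment> \<open>Gaps in the numbering are filled with empty sets, which keeps the family
    disjoint.\<close>
  define f where "f n = (if n \<in> to_nat_on \<Q> ` \<Q> then from_nat_into \<Q> n else {})" for n
  have f1: "f n \<in> \<Q> \<or> f n = {}" for n using Q(1) by (auto simp: f_def)
  have f2: "\<exists>n. f n = q" if "q \<in> \<Q>" for q using that Q(1) by (intro exI[of _ "to_nat_on \<Q> q"]) (simp add: f_def)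
  have fU: "(\<Union>n. f n) = U"
  proof
    show "(\<Union>n. f n) \<subseteq> U" using f1 Q(3) by blast
    show "U \<subseteq> (\<Union>n. f n)" using f2 Q(3) by blast
  qed
  have fsets: "range f \<subseteq> sets (Pi\<^sub>M I (\<lambda>_. lborel))" using f1 sets by (metis image_subsetI sets.empty_sets)
  have disj: "disjoint_family f"
    unfolding disjoint_family_on_def
  proof (intro ballI impI)
    fix m n :: nat assume "m \<noteq> n"
    show "f m \<inter> f n = {}"
    proof (cases "m \<in> to_nat_on \<Q> ` \<Q> \<and> n \<in> to_nat_on \<Q> ` \<Q>")
      case True
      then obtain p q where pq: "p \<in> \<Q>" "q \<in> \<Q>" "m = to_nat_on \<Q> p" "n = to_nat_on \<Q> q" by auto
      then have "p \<noteq> q" using \<open>m \<noteq> n\<close> by auto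
      moreover have "f m = p" "f n = q" using pq Q(1) by (auto simp: f_def)
      ultimately show ?thesis using Q(2) pq by (auto dest: disjointD)
    qed (auto simp: f_def)
  qed
  have "\<Phi> ` U = (\<Union>n. \<Phi> ` f n)" using fU by auto
  then have "hausdorff_pre (real k) \<delta> (\<Phi> ` U) \<le> (\<Sum>n. hausdorff_pre (real k) \<delta> (\<Phi> ` f n))"
    using hausdorff_pre_UN_le[of "real k" \<delta> "\<lambda>n. \<Phi> ` f n"] by simp
  also have "\<dots> \<le> (\<Sum>n. c * emeasure (Pi\<^sub>M I (\<lambda>_. lborel)) (f n))"
  proof (intro suminf_le)
    fix n show "hausdorff_pre (real k) \<delta> (\<Phi> ` f n) \<le> c * emeasure (Pi\<^sub>M I (\<lambda>_. lborel)) (f n)"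
    proof (cases "f n = {}")
      case True
      then show ?thesis using k by (simp add: hausdorff_pre_empty)
    next
      case False
      then show ?thesis using f1[of n] Q(4)[of "f n"] c by force
    qed
  qed auto
  also have "\<dots> = c * emeasure (Pi\<^sub>M I (\<lambda>_. lborel)) U"
    using suminf_emeasure[OF fsets disj] fU by simp
  finally show "hausdorff_pre (real k) \<delta> (\<Phi> ` U) \<le> c * emeasure (Pi\<^sub>M I (\<lambda>_. lborel)) U" .
qed

text \<open>An affine map that is isometric to y \<mapsto> (y, \<beta> \<cdot> y, \<gamma> \<cdot> y), hence has volume factor \<open>sqrt (gram2 I \<beta> \<gamma>)\<close>.\<close>
locale affine_chart =
  fixes I :: "'i set" and \<beta> \<gamma> :: "'i \<Rightarrow> real" and \<Phi> :: "('i \<Rightarrow> real) \<Rightarrow> 'a::euclidean_space" and k :: nat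
  assumes finite_I: "finite I" and card_I: "card I = k" and k_pos: "0 < k"
    and dist_chart: "(dist (\<Phi> y) (\<Phi> z))\<^sup>2 =
      (\<Sum>i\<in>I. (y i - z i)\<^sup>2) + (\<Sum>i\<in>I. \<beta> i * (y i - z i))\<^sup>2 + (\<Sum>i\<in>I. \<gamma> i * (y i - z i))\<^sup>2"
begin

abbreviation G :: real where "G \<equiv> gram2 I \<beta> \<gamma>"
abbreviation \<mu> :: "('i \<Rightarrow> real) measure" where "\<mu> \<equiv> Pi\<^sub>M I (\<lambda>_. lborel)"

lemma G_pos: "0 < G" using gram2_ge_1[of I \<beta> \<gamma>] by linarith

lemma coordinate_le_dist: "i \<in> I \<Longrightarrow> \<bar>y i - z i\<bar> \<le> dist (\<Phi> y) (\<Phi> z)"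
proof -
  assume i: "i \<in> I"
  have "(y i - z i)\<^sup>2 \<le> (\<Sum>i\<in>I. (y i - z i)\<^sup>2)"
    using finite_I i by (intro member_le_sum) auto
  also have "\<dots> \<le> (dist (\<Phi> y) (\<Phi> z))\<^sup>2" unfolding dist_chart by simp
  finally show ?thesis by (metis abs_le_square_iff abs_of_nonneg zero_le_dist)
qed

text \<open>Cubes are measured in the sup norm, covers in the chart metric. Having
  \<open>1 \<le> K\<close> lets a single mesh condition on cubes also bound the diameter of the
  balls inside them.\<close>

lemma chart_lipschitz:
  obtains K where "1 \<le> K" "\<And>y z e. (\<And>i. i \<in> I \<Longrightarrow> \<bar>y i - z i\<bar> \<le> e) \<Longrightarrow> dist (\<Phi> y) (\<Phi> z) \<le> K * e"
proof -
  define K where "K = sqrt (real k + (\<Sum>i\<in>I. \<bar>\<beta> i\<bar>)\<^sup>2 + (\<Sum>i\<in>I. \<bar>\<gamma> i\<bar>)\<^sup>2)"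
  have "1 \<le> K" unfolding K_def using k_pos
    by (intro real_le_rsqrt) (auto intro!: add_nonneg_nonneg add_increasing2)
  moreover have "dist (\<Phi> y) (\<Phi> z) \<le> K * e" if e: "\<And>i. i \<in> I \<Longrightarrow> \<bar>y i - z i\<bar> \<le> e" for y z e
  proof -
    have "I \<noteq> {}" using card_I k_pos by auto
    then have e0: "0 \<le> e" using e by (metis abs_ge_zero all_not_in_conv order_trans)
    have "(y i - z i)\<^sup>2 \<le> e\<^sup>2" if "i \<in> I" for i
      using power_mono[OF e[OF that], of 2] by simp
    then have "(\<Sum>i\<in>I. (y i - z i)\<^sup>2) \<le> real k * e\<^sup>2" using sum_bounded_above[of I "\<lambda>i. (y i - z i)\<^sup>2" "e\<^sup>2"] card_I by simp
    moreover have "(\<Sum>i\<in>I. b i * (y i - z i))\<^sup>2 \<le> (\<Sum>i\<in>I. \<bar>b i\<bar>)\<^sup>2 * e\<^sup>2" for b :: "'i \<Rightarrow> real"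
    proof -
      have "\<bar>\<Sum>i\<in>I. b i * (y i - z i)\<bar> \<le> (\<Sum>i\<in>I. \<bar>b i * (y i - z i)\<bar>)" by (rule sum_abs)
      also have "\<dots> \<le> (\<Sum>i\<in>I. \<bar>b i\<bar> * e)" using e by (intro sum_mono) (simp add: abs_mult mult_left_mono)
      finally have "\<bar>\<Sum>i\<in>I. b i * (y i - z i)\<bar> \<le> (\<Sum>i\<in>I. \<bar>b i\<bar>) * e" by (simp add: sum_distrib_right)
      from power_mono[OF this, of 2] show ?thesis by (simp add: power_mult_distrib)
    qed
    ultimately have "(dist (\<Phi> y) (\<Phi> z))\<^sup>2 \<le> (real k + (\<Sum>i\<in>I. \<bar>\<beta> i\<bar>)\<^sup>2 + (\<Sum>i\<in>I. \<bar>\<gamma> i\<bar>)\<^sup>2) * e\<^sup>2"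
      unfolding dist_chart distrib_right by (intro add_mono) auto
    also have "\<dots> = (K * e)\<^sup>2" by (simp add: K_def power_mult_distrib)
    finally show ?thesis by (rule power2_le_imp_le) (use e0 \<open>1 \<le> K\<close> in simp)
  qed
  ultimately show ?thesis using that by blast
qed

lemma emeasure_chart_ball:
  assumes "0 \<le> r"
  shows "emeasure \<mu> {y \<in> extensional I. dist (\<Phi> y) (\<Phi> z) \<le> r} = ennreal (unit_ball_vol (real k) * r ^ k / sqrt G)"
proof -
  have "dist (\<Phi> y) (\<Phi> z) \<le> r \<longleftrightarrow> (dist (\<Phi> y) (\<Phi> z))\<^sup>2 \<le> r\<^sup>2" for y
    using assms by (meson power2_le_imp_le power_mono zero_le_dist)
  then show ?thesis
    using emeasure_ellipsoid[OF finite_I assms, of z \<beta> \<gamma>] by (simp add: dist_chart card_I)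
qed

lemma sets_chart_ball: "{y \<in> extensional I. dist (\<Phi> y) (\<Phi> z) \<le> r} \<in> sets \<mu>"
proof (cases "0 \<le> r")
  case True
  then have "dist (\<Phi> y) (\<Phi> z) \<le> r \<longleftrightarrow> (dist (\<Phi> y) (\<Phi> z))\<^sup>2 \<le> r\<^sup>2" for y
    by (meson power2_le_imp_le power_mono zero_le_dist)
  moreover have "{y \<in> space \<mu>. (\<Sum>i\<in>I. (y i - z i)\<^sup>2) + (\<Sum>i\<in>I. \<beta> i * (y i - z i))\<^sup>2 + (\<Sum>i\<in>I. \<gamma> i * (y i - z i))\<^sup>2 \<le> r\<^sup>2} \<in> sets \<mu>"
    using finite_I by measurable
  ultimately show ?thesis by (simp add: dist_chart space_PiM PiE_def)
next
  case False
  then have "\<not> dist (\<Phi> y) (\<Phi> z) \<le> r" for y by (meson order_trans zero_le_dist)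
  then show ?thesis by simp
qed

text \<open>A ball fills a fixed proportion \<open>\<theta>\<close> of each small cube and is its own optimal cover, while the rest of the
  cube splits into smaller dyadic cubes. So a bound with factor \<open>sqrt G + R\<close> for all small cubes improves
  itself to \<open>sqrt G + (1 - \<theta>) * R\<close>.\<close>
lemma hausdorff_pre_dyadic_cube_le:
  assumes "0 < \<delta>"
  obtains N\<^sub>0 where "\<And>N y. N\<^sub>0 \<le> N \<Longrightarrow> y \<in> extensional I \<Longrightarrow>
    hausdorff_pre (real k) \<delta> (\<Phi> ` dyadic_cube I N y) \<le> ennreal (sqrt G) * emeasure \<mu> (dyadic_cube I N y)"
proof -
  obtain K where K: "1 \<le> K" "\<And>y z e. (\<And>i. i \<in> I \<Longrightarrow> \<bar>y i - z i\<bar> \<le> e) \<Longrightarrow> dist (\<Phi> y) (\<Phi> z) \<le> K * e"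
    using chart_lipschitz by blast
  have small: "\<exists>M\<ge>N. K * (1/2) ^ M < e" if "0 < e" for e N
  proof -
    have "0 < e / K" using that K(1) by simp
    then obtain M where "(1/2) ^ M < e / K" using real_arch_pow_inv[of "e / K" "1/2"] by auto
    moreover have "(1/2) ^ max M N \<le> (1/2 :: real) ^ M" by (rule power_decreasing) auto
    ultimately have "(1/2) ^ max M N < e / K" by linarith
    then show ?thesis using K(1) by (intro exI[of _ "max M N"]) (simp add: field_simps)
  qed
  obtain N\<^sub>0 where N\<^sub>0: "K * (1/2) ^ N\<^sub>0 < \<delta>" using small[OF assms] by blast
  have side: "K * (1/2) ^ N \<le> \<delta>" if "N\<^sub>0 \<le> N" for N
  proof -
    have "K * (1/2) ^ N \<le> K * (1/2) ^ N\<^sub>0" using K(1) that by (intro mult_left_mono power_decreasing) auto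
    then show ?thesis using N\<^sub>0 by linarith
  qed
  define \<omega> where "\<omega> = unit_ball_vol (real k)"
  have \<omega>: "0 < \<omega>" by (simp add: \<omega>_def)
  \<comment> \<open>Volume of a chart ball whose radius is a quarter of the side, relative to the
    cube; the same at every level.\<close>
  define \<theta> where "\<theta> = \<omega> / (4 ^ k * sqrt G)"
  have \<theta>: "0 < \<theta>" using \<omega> G_pos by (simp add: \<theta>_def)
  \<comment> \<open>The factor obtained by covering a cube of side \<open>(1/2) ^ N\<close> by
    itself, its diameter being at most \<open>K * (1/2) ^ N\<close>.\<close>
  define K' where "K' = \<omega> * (K / 2) ^ k"
  have K': "0 \<le> K'" using \<omega> K(1) by (simp add: K'_def)
  define z where "z N y = (\<lambda>i. (real_of_int \<lfloor>2 ^ N * y i\<rfloor> + 1/2) / 2 ^ N)" for N and y :: "'i \<Rightarrow> real"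
  \<comment> \<open>\<open>z N y\<close> is the centre of the cube. By
    \<open>coordinate_le_dist\<close>, a radius of a quarter of the side keeps the ball away from
    the faces of the half-open cube.\<close>
  define E where "E N y = {x \<in> extensional I. dist (\<Phi> x) (\<Phi> (z N y)) \<le> (1/2) ^ N / 4}" for N y
  have E_sub: "E N y \<subseteq> dyadic_cube I N y" for N y
  proof
    fix x assume x: "x \<in> E N y"
    have "\<lfloor>2 ^ N * x i\<rfloor> = \<lfloor>2 ^ N * y i\<rfloor>" if "i \<in> I" for i
    proof -
      have "\<bar>x i - z N y i\<bar> \<le> (1/2) ^ N / 4"
        using coordinate_le_dist[OF that, of x "z N y"] x by (simp add: E_def)
      then have "2 ^ N * \<bar>x i - z N y i\<bar> \<le> 2 ^ N * ((1/2) ^ N / 4)" by (intro mult_left_mono) auto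
      then have "\<bar>2 ^ N * x i - 2 ^ N * z N y i\<bar> \<le> 1/4"
        by (simp add: abs_mult power_divide flip: right_diff_distrib)
      moreover have "2 ^ N * z N y i = real_of_int \<lfloor>2 ^ N * y i\<rfloor> + 1/2" by (simp add: z_def)
      ultimately show ?thesis by linarith
    qed
    then show "x \<in> dyadic_cube I N y" using x by (simp add: dyadic_cube_def E_def)
  qed
  have E_meas: "E N y \<in> sets \<mu>" for N y unfolding E_def by (rule sets_chart_ball)
  have E_vol: "emeasure \<mu> (E N y) = ennreal (\<theta> * ((1/2) ^ N) ^ k)" for N y
    unfolding E_def by (subst emeasure_chart_ball) (auto simp: \<theta>_def \<omega>_def power_divide mult_ac)
  \<comment> \<open>Read off from the inclusion in a cube, without any estimate of
    \<open>unit_ball_vol\<close>.\<close>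
  have \<theta>1: "\<theta> \<le> 1"
  proof -
    have "emeasure \<mu> (E 0 (\<lambda>i\<in>I. 0)) \<le> emeasure \<mu> (dyadic_cube I 0 (\<lambda>i\<in>I. 0))"
      by (intro emeasure_mono E_sub sets_dyadic_cube finite_I)
    then show ?thesis unfolding E_vol emeasure_dyadic_cube[OF finite_I] by simp
  qed
  have diff_open: "dyadically_open I N (dyadic_cube I N y - E N y)" for N y
    unfolding dyadically_open_def
  proof (intro conjI ballI)
    show "dyadic_cube I N y - E N y \<subseteq> extensional I" using dyadic_cube_subset_extensional by blast
    fix x assume x: "x \<in> dyadic_cube I N y - E N y"
    then have xe: "x \<in> extensional I" using dyadic_cube_subset_extensional by blast
    define e where "e = dist (\<Phi> x) (\<Phi> (z N y)) - (1/2) ^ N / 4"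
    have "0 < e" using x xe by (auto simp: E_def e_def)
    then obtain M where M: "N \<le> M" "K * (1/2) ^ M < e" using small by blast
    have "w \<in> dyadic_cube I N y - E N y" if w: "w \<in> dyadic_cube I M x" for w
    proof -
      have "w \<in> dyadic_cube I N x" using w dyadic_cube_antimono[OF M(1)] by blast
      also have "dyadic_cube I N x = dyadic_cube I N y" using x dyadic_cube_eq[of x I N y N] by simp
      finally have 1: "w \<in> dyadic_cube I N y" .
      have "dist (\<Phi> x) (\<Phi> w) \<le> K * (1/2) ^ M"
        by (rule K(2)) (rule dyadic_cube_diff_le[OF dyadic_cube_self[OF xe] w])
      then have "(1/2) ^ N / 4 < dist (\<Phi> w) (\<Phi> (z N y))"
        using M(2) dist_triangle[of "\<Phi> x" "\<Phi> (z N y)" "\<Phi> w"] by (simp add: e_def)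
      then show ?thesis using 1 by (simp add: E_def)
    qed
    then show "\<exists>M\<ge>N. dyadic_cube I M x \<subseteq> dyadic_cube I N y - E N y" using M(1) by blast
  qed
  \<comment> \<open>All levels are treated at once: step \<open>Suc j\<close> on one cube uses step
    \<open>j\<close> on the finer cubes that make up the complement of its ball.\<close>
  have bound: "\<forall>N y. N\<^sub>0 \<le> N \<longrightarrow> y \<in> extensional I \<longrightarrow> hausdorff_pre (real k) \<delta> (\<Phi> ` dyadic_cube I N y)
      \<le> ennreal (sqrt G + K' * (1 - \<theta>) ^ j) * emeasure \<mu> (dyadic_cube I N y)" for j
  proof (induction j)
    case 0
    show ?case
    proof (intro allI impI)
      fix N y assume N: "N\<^sub>0 \<le> N"
      have "hausdorff_pre (real k) \<delta> (\<Phi> ` dyadic_cube I N y) \<le> ennreal (unit_ball_vol (real k) * (K * (1/2) ^ N / 2) ^ k)"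
      proof (rule hausdorff_pre_le_diameter[OF k_pos])
        show "0 \<le> K * (1/2) ^ N" using K(1) by simp
        fix a b assume "a \<in> \<Phi> ` dyadic_cube I N y" "b \<in> \<Phi> ` dyadic_cube I N y"
        then obtain u v where uv: "u \<in> dyadic_cube I N y" "v \<in> dyadic_cube I N y" "a = \<Phi> u" "b = \<Phi> v" by auto
        show "dist a b \<le> K * (1/2) ^ N" unfolding uv(3,4)
          by (rule K(2)) (rule dyadic_cube_diff_le[OF uv(1,2)])
      qed (rule side[OF N])
      also have "\<dots> = ennreal (K' * ((1/2) ^ N) ^ k)"
        by (simp add: K'_def \<omega>_def power_mult_distrib power_divide mult.commute)
      also have "\<dots> \<le> ennreal ((sqrt G + K' * (1 - \<theta>) ^ 0) * ((1/2) ^ N) ^ k)"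
        using G_pos by (intro ennreal_leI mult_right_mono) auto
      also have "\<dots> = ennreal (sqrt G + K' * (1 - \<theta>) ^ 0) * emeasure \<mu> (dyadic_cube I N y)"
        using G_pos K' by (simp add: emeasure_dyadic_cube[OF finite_I] card_I ennreal_mult)
      finally show "hausdorff_pre (real k) \<delta> (\<Phi> ` dyadic_cube I N y) \<le> ennreal (sqrt G + K' * (1 - \<theta>) ^ 0) * emeasure \<mu> (dyadic_cube I N y)" .
    qed
  next
    case (Suc j)
    define c where "c = sqrt G + K' * (1 - \<theta>) ^ j"
    have c: "0 \<le> c" using G_pos K' \<theta>1 by (simp add: c_def)
    show ?case
    proof (intro allI impI)
      fix N and y :: "'i \<Rightarrow> real" assume N: "N\<^sub>0 \<le> N" "y \<in> extensional I"
      define s where "s = ((1/2::real) ^ N) ^ k"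
      have s: "0 \<le> s" by (simp add: s_def)
      let ?Q = "dyadic_cube I N y"
      have "\<Phi> ` ?Q = \<Phi> ` E N y \<union> \<Phi> ` (?Q - E N y)" using E_sub[of N y] by blast
      then have "hausdorff_pre (real k) \<delta> (\<Phi> ` ?Q) \<le> hausdorff_pre (real k) \<delta> (\<Phi> ` E N y) + hausdorff_pre (real k) \<delta> (\<Phi> ` (?Q - E N y))"
        using hausdorff_pre_Un_le[OF k_pos, of \<delta>] assms by simp
      \<comment> \<open>Nothing is lost on the ball: covering it by itself costs exactly
        \<open>sqrt G\<close> times its volume.\<close>
      also have "hausdorff_pre (real k) \<delta> (\<Phi> ` E N y) \<le> ennreal (sqrt G * (\<theta> * s))"
      proof -
        have "hausdorff_pre (real k) \<delta> (\<Phi> ` E N y) \<le> ennreal (unit_ball_vol (real k) * ((1/2) ^ N / 2 / 2) ^ k)"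
        proof (rule hausdorff_pre_le_diameter[OF k_pos])
          have "(1/2) ^ N \<le> K * (1/2) ^ N" using K(1) mult_right_mono[of 1 K "(1/2) ^ N"] by simp
          then show "(1/2) ^ N / 2 \<le> \<delta>" using side[OF N(1)] by (smt (verit) field_sum_of_halves zero_le_power zero_le_divide_1_iff zero_le_numeral)
          fix a b assume ab: "a \<in> \<Phi> ` E N y" "b \<in> \<Phi> ` E N y"
          have "dist a (\<Phi> (z N y)) \<le> (1/2) ^ N / 4" "dist b (\<Phi> (z N y)) \<le> (1/2) ^ N / 4"
            using ab by (auto simp: E_def)
          then show "dist a b \<le> (1/2) ^ N / 2" using dist_triangle2[of a b "\<Phi> (z N y)"] by simp
        qed simp
        also have "unit_ball_vol (real k) * ((1/2) ^ N / 2 / 2) ^ k = sqrt G * (\<theta> * s)"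
          using G_pos by (simp add: \<theta>_def \<omega>_def s_def power_divide)
        finally show ?thesis .
      qed
      also have "hausdorff_pre (real k) \<delta> (\<Phi> ` (?Q - E N y)) \<le> ennreal (c * ((1 - \<theta>) * s))"
      proof -
        have "hausdorff_pre (real k) \<delta> (\<Phi> ` (?Q - E N y)) \<le> ennreal c * emeasure \<mu> (?Q - E N y)"
          by (rule hausdorff_pre_image_le_dyadic[OF finite_I k_pos _ diff_open])
            (use assms Suc.IH N c_def in auto)
        also have "emeasure \<mu> (?Q - E N y) = emeasure \<mu> ?Q - emeasure \<mu> (E N y)"
          by (rule emeasure_Diff) (use E_vol E_meas E_sub sets_dyadic_cube[OF finite_I] in auto)
        also have "\<dots> = ennreal ((1 - \<theta>) * s)"
          using \<theta> s by (simp add: E_vol emeasure_dyadic_cube[OF finite_I] card_I s_def ennreal_minus left_diff_distrib)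
        finally show ?thesis using c by (simp add: ennreal_mult')
      qed
      also have "ennreal (sqrt G * (\<theta> * s)) + ennreal (c * ((1 - \<theta>) * s)) = ennreal ((sqrt G + K' * (1 - \<theta>) ^ Suc j) * s)"
      proof -
        have "0 \<le> sqrt G * (\<theta> * s)" "0 \<le> c * ((1 - \<theta>) * s)" using G_pos \<theta> \<theta>1 s c by simp_all
        then have "ennreal (sqrt G * (\<theta> * s)) + ennreal (c * ((1 - \<theta>) * s)) = ennreal (sqrt G * (\<theta> * s) + c * ((1 - \<theta>) * s))"
          by (rule ennreal_plus[symmetric])
        also have "sqrt G * (\<theta> * s) + c * ((1 - \<theta>) * s) = (sqrt G + K' * (1 - \<theta>) ^ Suc j) * s"
          by (simp add: c_def algebra_simps)
        finally show ?thesis .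
      qed
      also have "\<dots> = ennreal (sqrt G + K' * (1 - \<theta>) ^ Suc j) * emeasure \<mu> ?Q"
        using G_pos K' \<theta>1 by (simp add: emeasure_dyadic_cube[OF finite_I] card_I s_def ennreal_mult)
      finally show "hausdorff_pre (real k) \<delta> (\<Phi> ` ?Q) \<le> ennreal (sqrt G + K' * (1 - \<theta>) ^ Suc j) * emeasure \<mu> ?Q"
        by (simp add: add_mono)
    qed
  qed
  have "hausdorff_pre (real k) \<delta> (\<Phi> ` dyadic_cube I N y) \<le> ennreal (sqrt G) * emeasure \<mu> (dyadic_cube I N y)"
    if N: "N\<^sub>0 \<le> N" "y \<in> extensional I" for N y
  proof -
    define s where "s = ((1/2::real) ^ N) ^ k"
    have s: "0 \<le> s" by (simp add: s_def)
    have "(\<lambda>j. (sqrt G + K' * (1 - \<theta>) ^ j) * s) \<longlonglongrightarrow> (sqrt G + K' * 0) * s"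
      using \<theta> \<theta>1 by (intro tendsto_intros LIMSEQ_power_zero) auto
    then have "(\<lambda>j. ennreal ((sqrt G + K' * (1 - \<theta>) ^ j) * s)) \<longlonglongrightarrow> ennreal (sqrt G * s)"
      by (intro tendsto_ennrealI) simp
    moreover have "hausdorff_pre (real k) \<delta> (\<Phi> ` dyadic_cube I N y) \<le> ennreal ((sqrt G + K' * (1 - \<theta>) ^ j) * s)" for j
      using bound[of j] N s by (simp add: emeasure_dyadic_cube[OF finite_I] card_I s_def ennreal_mult'')
    ultimately have "hausdorff_pre (real k) \<delta> (\<Phi> ` dyadic_cube I N y) \<le> ennreal (sqrt G * s)"
      by (intro LIMSEQ_le_const) auto
    then show ?thesis using s by (simp add: emeasure_dyadic_cube[OF finite_I] card_I s_def ennreal_mult'')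
  qed
  then show ?thesis using that by blast
qed

text \<open>Sup-norm openness gives dyadic openness from every starting level, in particular from
  the level that the cube estimate requires for this \<delta>.\<close>

lemma hausdorff_pre_open_le:
  assumes "0 < \<delta>" and ext: "U \<subseteq> extensional I"
    and U: "\<And>y. y \<in> U \<Longrightarrow> \<exists>e>0. \<forall>z\<in>extensional I. (\<forall>i\<in>I. \<bar>z i - y i\<bar> < e) \<longrightarrow> z \<in> U"
  shows "hausdorff_pre (real k) \<delta> (\<Phi> ` U) \<le> ennreal (sqrt G) * emeasure \<mu> U"
proof -
  obtain N\<^sub>0 where N\<^sub>0: "\<And>N y. N\<^sub>0 \<le> N \<Longrightarrow> y \<in> extensional I \<Longrightarrow>
      hausdorff_pre (real k) \<delta> (\<Phi> ` dyadic_cube I N y) \<le> ennreal (sqrt G) * emeasure \<mu> (dyadic_cube I N y)"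
    using hausdorff_pre_dyadic_cube_le[OF assms(1)] by blast
  have op: "dyadically_open I N\<^sub>0 U"
    unfolding dyadically_open_def
  proof (intro conjI ballI ext)
    fix y assume y: "y \<in> U"
    then have ye: "y \<in> extensional I" using ext by blast
    obtain e where e: "0 < e" "\<And>z. z \<in> extensional I \<Longrightarrow> (\<And>i. i \<in> I \<Longrightarrow> \<bar>z i - y i\<bar> < e) \<Longrightarrow> z \<in> U"
      using U[OF y] by blast
    obtain M where M: "(1/2) ^ M < e" using real_arch_pow_inv[of e "1/2"] e(1) by auto
    have "(1/2) ^ max M N\<^sub>0 \<le> (1/2 :: real) ^ M" by (rule power_decreasing) auto
    then have small: "(1/2) ^ max M N\<^sub>0 < e" using M by linarith
    have "z \<in> U" if z: "z \<in> dyadic_cube I (max M N\<^sub>0) y" for z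
    proof (rule e(2))
      show "z \<in> extensional I" using z by (simp add: dyadic_cube_def)
      fix i assume "i \<in> I"
      from dyadic_cube_diff_le[OF z dyadic_cube_self[OF ye] this] small show "\<bar>z i - y i\<bar> < e" by linarith
    qed
    then show "\<exists>N\<ge>N\<^sub>0. dyadic_cube I N y \<subseteq> U" by (intro exI[of _ "max M N\<^sub>0"]) auto
  qed
  show ?thesis
    by (rule hausdorff_pre_image_le_dyadic[OF finite_I k_pos _ op]) (use assms N\<^sub>0 in auto)
qed

text \<open>A closed simplex is not open, so every inequality is relaxed by \<eta>; the volume of
  the enlarged simplex tends to that of the original one as \<eta> tends to 0.\<close>

lemma hausdorff_pre_simplex_le:
  assumes \<delta>: "0 < \<delta>" and b: "\<And>i. i \<in> I \<Longrightarrow> 0 < b i" and c: "0 \<le> c"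
  shows "hausdorff_pre (real k) \<delta> (\<Phi> ` {y \<in> extensional I. (\<forall>i\<in>I. 0 \<le> y i) \<and> (\<Sum>i\<in>I. b i * y i) \<le> c})
    \<le> ennreal (sqrt G * (c ^ k / (fact k * prod b I)))"
proof -
  define S where "S = sum b I"
  have S: "0 \<le> S" unfolding S_def using b by (intro sum_nonneg) (auto intro: less_imp_le)
  have P: "0 < prod b I" using b by (rule prod_pos)
  let ?A = "{y \<in> extensional I. (\<forall>i\<in>I. 0 \<le> y i) \<and> (\<Sum>i\<in>I. b i * y i) \<le> c}"
  have *: "hausdorff_pre (real k) \<delta> (\<Phi> ` ?A) \<le> ennreal (sqrt G * ((c + \<eta> + \<eta> * S) ^ k / (fact k * prod b I)))"
    if \<eta>: "0 < \<eta>" for \<eta>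
  proof -
    define U where "U = {y \<in> extensional I. (\<forall>i\<in>I. - \<eta> < y i) \<and> (\<Sum>i\<in>I. b i * y i) < c + \<eta>}"
    have "hausdorff_pre (real k) \<delta> (\<Phi> ` ?A) \<le> hausdorff_pre (real k) \<delta> (\<Phi> ` U)"
      using \<eta> by (intro hausdorff_pre_mono image_mono) (force simp: U_def)
    also have "\<dots> \<le> ennreal (sqrt G) * emeasure \<mu> U"
    proof (rule hausdorff_pre_open_le[OF \<delta>])
      show "U \<subseteq> extensional I" by (auto simp: U_def)
      fix y assume y: "y \<in> U"
      \<comment> \<open>Changing every coordinate by less than \<open>e\<close> moves the weighted
        sum by at most \<open>e * S\<close>; dividing the slack by \<open>S + 1\<close> keeps the
        final inequality strict.\<close>
      define e where "e = Min (insert ((c + \<eta> - (\<Sum>i\<in>I. b i * y i)) / (S + 1)) ((\<lambda>i. y i + \<eta>) ` I))"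
      have "0 < e" unfolding e_def using finite_I y S by (subst Min_gr_iff) (auto simp: U_def)
      have e1: "e \<le> (c + \<eta> - (\<Sum>i\<in>I. b i * y i)) / (S + 1)" unfolding e_def using finite_I by (intro Min_le) auto
      have e2: "e \<le> y i + \<eta>" if "i \<in> I" for i unfolding e_def using finite_I that by (intro Min_le) auto
      have "z \<in> U" if z: "z \<in> extensional I" "\<forall>i\<in>I. \<bar>z i - y i\<bar> < e" for z
      proof -
        have "- \<eta> < z i" if "i \<in> I" for i using e2[OF that] z(2) that by (smt (verit))
        moreover have "(\<Sum>i\<in>I. b i * z i) < c + \<eta>"
        proof -
          have "(\<Sum>i\<in>I. b i * z i) \<le> (\<Sum>i\<in>I. b i * (y i + e))"
            using z(2) b by (intro sum_mono mult_left_mono) (auto intro: less_imp_le simp: abs_less_iff algebra_simps)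
          also have "\<dots> = (\<Sum>i\<in>I. b i * y i) + e * S"
            by (simp add: S_def distrib_left sum.distrib sum_distrib_left mult.commute)
          also have "\<dots> < (\<Sum>i\<in>I. b i * y i) + e * (S + 1)" using \<open>0 < e\<close> by simp
          also have "\<dots> \<le> c + \<eta>" using e1 S by (simp add: field_simps)
          finally show ?thesis .
        qed
        ultimately show ?thesis using z(1) by (simp add: U_def)
      qed
      then show "\<exists>e>0. \<forall>z\<in>extensional I. (\<forall>i\<in>I. \<bar>z i - y i\<bar> < e) \<longrightarrow> z \<in> U" using \<open>0 < e\<close> by blast
    qed
    also have "emeasure \<mu> U \<le> emeasure \<mu> {y \<in> extensional I. (\<forall>i\<in>I. - \<eta> \<le> y i) \<and> (\<Sum>i\<in>I. b i * y i) \<le> c + \<eta>}"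
      using sets_PiM_simplex[OF finite_I] by (intro emeasure_mono) (auto simp: U_def intro: less_imp_le)
    also have "\<dots> = ennreal ((c + \<eta> + \<eta> * S) ^ k / (fact k * prod b I))"
    proof -
      have "- \<eta> * sum b I \<le> c + \<eta>" using c \<eta> mult_nonneg_nonneg[OF less_imp_le[OF \<eta>] S] unfolding S_def by linarith
      then show ?thesis
        using emeasure_weighted_simplex[where I = I and b = b and l = "- \<eta>" and c = "c + \<eta>"] finite_I b
        by (simp add: card_I S_def)
    qed
    finally show ?thesis using G_pos by (subst ennreal_mult') (auto simp: mult_left_mono)
  qed
  have "(\<lambda>n. sqrt G * ((c + inverse (real (Suc n)) + inverse (real (Suc n)) * S) ^ k / (fact k * prod b I)))
      \<longlonglongrightarrow> sqrt G * ((c + 0 + 0 * S) ^ k / (fact k * prod b I))"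
    using P by (intro tendsto_intros LIMSEQ_inverse_real_of_nat) auto
  then have "(\<lambda>n. ennreal (sqrt G * ((c + inverse (real (Suc n)) + inverse (real (Suc n)) * S) ^ k / (fact k * prod b I))))
      \<longlonglongrightarrow> ennreal (sqrt G * (c ^ k / (fact k * prod b I)))"
    by (intro tendsto_ennrealI) simp
  then show ?thesis by (rule LIMSEQ_le_const) (use * in auto)
qed

text \<open>The chart metric comes from a norm on the coordinates, so half differences of points of
  \<open>S\<close> lie in the ball of radius \<open>d / 2\<close> about the origin. Thus no covering
  set pays less than the area it covers.\<close>

lemma emeasure_le_isodiametric:
  assumes S: "S \<in> sets \<mu>" and d: "0 \<le> d" "\<And>x y. x \<in> S \<Longrightarrow> y \<in> S \<Longrightarrow> dist (\<Phi> x) (\<Phi> y) \<le> d"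
  shows "ennreal (sqrt G) * emeasure \<mu> S \<le> ennreal (unit_ball_vol (real k) * (d / 2) ^ k)"
proof -
  let ?D = "{y \<in> extensional I. dist (\<Phi> y) (\<Phi> (\<lambda>_. 0)) \<le> d / 2}"
  have "emeasure \<mu> S \<le> emeasure \<mu> ?D"
  proof (rule emeasure_le_half_differences[OF finite_I S sets_chart_ball])
    fix x y assume xy: "x \<in> S" "y \<in> S"
    let ?w = "\<lambda>i\<in>I. (x i - y i) / 2"
    have sums: "(\<Sum>i\<in>I. b i * (?w i - 0)) = (\<Sum>i\<in>I. b i * (x i - y i)) / 2" for b :: "'i \<Rightarrow> real"
      by (simp add: sum_divide_distrib)
    have sq: "(\<Sum>i\<in>I. (?w i - 0)\<^sup>2) = (\<Sum>i\<in>I. (x i - y i)\<^sup>2) / 4"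
      by (simp add: sum_divide_distrib power_divide)
    have "(dist (\<Phi> ?w) (\<Phi> (\<lambda>_. 0)))\<^sup>2 = (dist (\<Phi> x) (\<Phi> y))\<^sup>2 / 4"
      unfolding dist_chart sums sq by (simp add: power_divide add_divide_distrib)
    also have "\<dots> = (dist (\<Phi> x) (\<Phi> y) / 2)\<^sup>2" by (simp add: power_divide)
    finally have "dist (\<Phi> ?w) (\<Phi> (\<lambda>_. 0)) = dist (\<Phi> x) (\<Phi> y) / 2"
      by (rule power2_eq_imp_eq) auto
    then show "?w \<in> ?D" using d(2)[OF xy] by simp
  qed
  also have "\<dots> = ennreal (unit_ball_vol (real k) * (d / 2) ^ k / sqrt G)"
    using d(1) by (intro emeasure_chart_ball) simp
  finally have "ennreal (sqrt G) * emeasure \<mu> S \<le> ennreal (sqrt G) * ennreal (unit_ball_vol (real k) * (d / 2) ^ k / sqrt G)"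
    by (rule mult_left_mono) simp
  also have "\<dots> = ennreal (unit_ball_vol (real k) * (d / 2) ^ k)"
    using G_pos by (simp add: ennreal_mult'[symmetric])
  finally show ?thesis .
qed

end

subsection \<open>Sections of the cross-polytope\<close>

lemma frontier_cross_polytope: "frontier (cross_polytope :: (real^'n) set) = {x. l1_norm x = 1}"
proof -
  have cont: "continuous_on UNIV (l1_norm :: real^'n \<Rightarrow> real)"
    unfolding l1_norm_def by (intro continuous_intros)
  have "closed {x :: real^'n. l1_norm x \<le> 1}"
    using closed_Collect_le[OF cont continuous_on_const[of _ 1]] by simp
  then have cl: "closure cross_polytope = {x :: real^'n. l1_norm x \<le> 1}"
    by (simp add: cross_polytope_def closure_closed)
  have "open {x :: real^'n. l1_norm x < 1}"
    using open_Collect_less[OF cont continuous_on_const[of _ 1]] by simp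
  then have "{x :: real^'n. l1_norm x < 1} \<subseteq> interior cross_polytope"
    by (intro interior_maximal) (auto simp: cross_polytope_def)
  moreover have "x \<notin> interior cross_polytope" if x: "l1_norm x = 1" for x :: "real^'n"
  proof
    assume "x \<in> interior cross_polytope"
    then obtain e where e: "0 < e" "ball x e \<subseteq> cross_polytope" by (meson mem_interior)
    have "x \<noteq> 0" using x by (auto simp: l1_norm_def)
    \<comment> \<open>Places \<open>r *\<^sub>R x\<close> at distance \<open>e / 2\<close> from
      \<open>x\<close>.\<close>
    define r where "r = 1 + e / (2 * norm x)"
    have "1 < r" using e \<open>x \<noteq> 0\<close> by (simp add: r_def)
    have "dist x (r *\<^sub>R x) = norm ((r - 1) *\<^sub>R x)" by (simp add: dist_norm norm_minus_commute scaleR_diff_left)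
    also have "\<dots> < e" using \<open>x \<noteq> 0\<close> e by (simp add: r_def)
    finally have "l1_norm (r *\<^sub>R x) \<le> 1" using e(2) by (auto simp: cross_polytope_def)
    moreover have "l1_norm (r *\<^sub>R x) = r * l1_norm x"
      using \<open>1 < r\<close> by (simp add: l1_norm_def abs_mult sum_distrib_left)
    ultimately show False using x \<open>1 < r\<close> by simp
  qed
  moreover have "interior cross_polytope \<subseteq> {x :: real^'n. l1_norm x \<le> 1}"
    using interior_subset by (auto simp: cross_polytope_def)
  ultimately show ?thesis unfolding frontier_def cl by force
qed

text \<open>The part of the facet with sign pattern \<open>\<epsilon>\<close> off the coordinate p and sign s at p that lies in
  the hyperplane with \<open>\<Sum>j\<noteq>p. b j * \<bar>x j\<bar> = c\<close>, parametrised by the moduli of all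
  coordinates other than p and m.\<close>
definition facet_chart ::
  "('n \<Rightarrow> real) \<Rightarrow> real \<Rightarrow> ('n \<Rightarrow> real) \<Rightarrow> real \<Rightarrow> 'n \<Rightarrow> 'n::finite \<Rightarrow> ('n \<Rightarrow> real) \<Rightarrow> real^'n" where
  "facet_chart \<epsilon> s b c p m y =
    (let h = (c - (\<Sum>i\<in>UNIV - {p, m}. b i * y i)) / b m in
     \<chi> i. if i = p then s * (1 - (\<Sum>i\<in>UNIV - {p, m}. y i) - h) else if i = m then \<epsilon> m * h else \<epsilon> i * y i)"

text \<open>Coordinate \<open>m\<close> is eliminated by the hyperplane equation and changes by
  minus \<open>b i / b m\<close> per unit of \<open>y i\<close>; coordinate \<open>p\<close> is
  eliminated by the norm equation and absorbs the remaining \<open>1 - b i / b m\<close>. The signs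
  disappear on squaring.\<close>

lemma affine_chart_facet:
  fixes p m :: "'n::finite"
  assumes "p \<noteq> m" "b m \<noteq> 0" "s\<^sup>2 = 1" and \<epsilon>: "\<And>i. i \<noteq> p \<Longrightarrow> (\<epsilon> i)\<^sup>2 = 1" and "3 \<le> CARD('n)"
  shows "affine_chart (UNIV - {p, m}) (\<lambda>i. b i / b m) (\<lambda>i. 1 - b i / b m) (facet_chart \<epsilon> s b c p m) (CARD('n) - 2)"
proof
  let ?I = "UNIV - {p, m}"
  show "finite ?I" by simp
  show "card ?I = CARD('n) - 2" using assms(1) by (simp add: card_Diff_subset)
  show "0 < CARD('n) - 2" using assms by simp
  fix y z :: "'n \<Rightarrow> real"
  let ?F = "facet_chart \<epsilon> s b c p m"
  have U: "UNIV = insert p (insert m ?I)" by auto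
  have "(dist (?F y) (?F z))\<^sup>2 = (\<Sum>i\<in>UNIV. (?F y $ i - ?F z $ i)\<^sup>2)"
    by (simp add: dist_vec_def L2_set_def sum_nonneg dist_real_def)
  also have "\<dots> = (?F y $ p - ?F z $ p)\<^sup>2 + ((?F y $ m - ?F z $ m)\<^sup>2 + (\<Sum>i\<in>?I. (?F y $ i - ?F z $ i)\<^sup>2))"
    using assms(1) by (subst U, subst sum.insert, simp, simp, subst sum.insert) auto
  also have "(\<Sum>i\<in>?I. (?F y $ i - ?F z $ i)\<^sup>2) = (\<Sum>i\<in>?I. (y i - z i)\<^sup>2)"
    by (intro sum.cong) (auto simp: facet_chart_def Let_def right_diff_distrib[symmetric] power_mult_distrib \<epsilon>)
  also have "(?F y $ m - ?F z $ m)\<^sup>2 = (\<Sum>i\<in>?I. b i / b m * (y i - z i))\<^sup>2"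
  proof -
    have "?F y $ m - ?F z $ m = - (\<epsilon> m * (\<Sum>i\<in>?I. b i / b m * (y i - z i)))"
    proof -
      have "(\<Sum>i\<in>?I. b i / b m * (y i - z i)) = ((\<Sum>i\<in>?I. b i * y i) - (\<Sum>i\<in>?I. b i * z i)) / b m"
        by (simp add: right_diff_distrib sum_subtractf sum_divide_distrib diff_divide_distrib)
      note eq = this
      show ?thesis using assms(1) unfolding eq
        by (simp add: facet_chart_def Let_def algebra_simps diff_divide_distrib)
    qed
    then show ?thesis using \<epsilon>[of m] assms(1) by (simp add: power_mult_distrib)
  qed
  also have "(?F y $ p - ?F z $ p)\<^sup>2 = (\<Sum>i\<in>?I. (1 - b i / b m) * (y i - z i))\<^sup>2"
  proof -
    have "(\<Sum>i\<in>?I. (1 - b i / b m) * (y i - z i)) = (\<Sum>i\<in>?I. y i) - (\<Sum>i\<in>?I. z i) - ((\<Sum>i\<in>?I. b i * y i) - (\<Sum>i\<in>?I. b i * z i)) / b m"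
      by (simp add: left_diff_distrib right_diff_distrib sum_subtractf sum_divide_distrib diff_divide_distrib)
    note eq = this
    have "?F y $ p - ?F z $ p = - (s * (\<Sum>i\<in>?I. (1 - b i / b m) * (y i - z i)))"
      unfolding eq by (simp add: facet_chart_def Let_def algebra_simps diff_divide_distrib)
    then show ?thesis using assms(3) by (simp add: power_mult_distrib)
  qed
  finally show "(dist (?F y) (?F z))\<^sup>2 = (\<Sum>i\<in>?I. (y i - z i)\<^sup>2) + (\<Sum>i\<in>?I. b i / b m * (y i - z i))\<^sup>2
      + (\<Sum>i\<in>?I. (1 - b i / b m) * (y i - z i))\<^sup>2" by simp
qed

text \<open>The right side is the Gram determinant, in all n coordinates, of the all-ones vector and
  of \<open>b\<close> extended by 0 at \<open>p\<close>. It no longer depends on the eliminated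
  index \<open>m\<close>.\<close>

lemma gram2_facet:
  fixes p m :: "'n::finite"
  assumes "p \<noteq> m" "b m \<noteq> 0"
  shows "(b m)\<^sup>2 * gram2 (UNIV - {p, m}) (\<lambda>i. b i / b m) (\<lambda>i. 1 - b i / b m)
    = real CARD('n) * (\<Sum>j\<in>UNIV - {p}. (b j)\<^sup>2) - (\<Sum>j\<in>UNIV - {p}. b j)\<^sup>2"
proof -
  let ?I = "UNIV - {p, m}"
  define B1 B2 q where "B1 = (\<Sum>i\<in>?I. b i)" "B2 = (\<Sum>i\<in>?I. (b i)\<^sup>2)" "q = b m"
  define n where "n = real CARD('n)"
  have "2 \<le> CARD('n)"
  proof -
    have "card {p, m} \<le> CARD('n)" by (rule card_mono) auto
    then show ?thesis using assms by simp
  qed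
  then have cI: "real (card ?I) = n - 2" using assms by (simp add: card_Diff_subset n_def of_nat_diff)
  have U: "UNIV - {p} = insert m ?I" using assms by auto
  have q: "q \<noteq> 0" using assms by (simp add: B1_B2_q_def)
  have s1: "(\<Sum>i\<in>?I. (b i / b m)\<^sup>2) = B2 / q\<^sup>2" by (simp add: B1_B2_q_def power_divide sum_divide_distrib)
  have s2: "(\<Sum>i\<in>?I. (1 - b i / b m)\<^sup>2) = n - 2 - 2 * B1 / q + B2 / q\<^sup>2"
  proof -
    have "(\<Sum>i\<in>?I. (1 - b i / b m)\<^sup>2) = (\<Sum>i\<in>?I. 1 - 2 / q * b i + (b i)\<^sup>2 / q\<^sup>2)"
      by (intro sum.cong) (auto simp: power2_diff power_divide B1_B2_q_def)
    also have "\<dots> = real (card ?I) - 2 / q * B1 + B2 / q\<^sup>2"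
      by (simp add: sum.distrib sum_subtractf sum_divide_distrib sum_distrib_left B1_B2_q_def del: card_Diff_insert)
    finally show ?thesis by (simp add: cI)
  qed
  have s3: "(\<Sum>i\<in>?I. b i / b m * (1 - b i / b m)) = B1 / q - B2 / q\<^sup>2"
    by (simp add: right_diff_distrib sum_subtractf sum_divide_distrib B1_B2_q_def power2_eq_square)
  have r1: "(\<Sum>j\<in>UNIV - {p}. (b j)\<^sup>2) = q\<^sup>2 + B2" "(\<Sum>j\<in>UNIV - {p}. b j) = q + B1"
    unfolding U by (simp_all add: B1_B2_q_def)
  show ?thesis
    unfolding gram2_def s1 s2 s3 r1 unfolding n_def[symmetric] B1_B2_q_def(3)[symmetric] using q
    by (simp add: field_simps power2_eq_square)
qed

text \<open>Extended by 0 at \<open>p\<close>, the vector of weights is \<alpha> times the all-ones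
  vector minus the sign-changed \<open>a\<close>, which has entry \<alpha> at \<open>p\<close>.
  Adding multiples of the all-ones vector leaves the Gram determinant unchanged, so it is that of
  the all-ones vector and a unit vector.\<close>

lemma gram2_section:
  fixes a :: "real^'n" and \<epsilon> :: "'n \<Rightarrow> real"
  assumes a: "norm a = 1" and \<epsilon>: "\<And>i. i \<noteq> p \<Longrightarrow> (\<epsilon> i)\<^sup>2 = 1" and \<alpha>: "\<alpha>\<^sup>2 = (a $ p)\<^sup>2"
  shows "real CARD('n) * (\<Sum>j\<in>UNIV - {p}. (\<alpha> - \<epsilon> j * a $ j)\<^sup>2) - (\<Sum>j\<in>UNIV - {p}. \<alpha> - \<epsilon> j * a $ j)\<^sup>2
    = real CARD('n) - (\<alpha> + (\<Sum>j\<in>UNIV - {p}. \<epsilon> j * a $ j))\<^sup>2"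
proof -
  define n where "n = real CARD('n)"
  define T where "T = (\<Sum>j\<in>UNIV - {p}. \<epsilon> j * a $ j)"
  have cU: "real (card (UNIV - {p})) = n - 1"
    by (simp add: n_def of_nat_diff Suc_leI card_Diff_singleton)
  have "(\<Sum>j\<in>UNIV. (a $ j)\<^sup>2) = 1" using a by (simp add: norm_vec_def L2_set_def sum_nonneg)
  then have a2: "(\<Sum>j\<in>UNIV - {p}. (a $ j)\<^sup>2) = 1 - \<alpha>\<^sup>2" by (simp add: sum_diff1 \<alpha>)
  have "(\<Sum>j\<in>UNIV - {p}. (\<alpha> - \<epsilon> j * a $ j)\<^sup>2) = (\<Sum>j\<in>UNIV - {p}. \<alpha>\<^sup>2 - 2 * \<alpha> * (\<epsilon> j * a $ j) + (a $ j)\<^sup>2)"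
    by (intro sum.cong) (auto simp: power2_diff power_mult_distrib \<epsilon>)
  also have "\<dots> = real (card (UNIV - {p})) * \<alpha>\<^sup>2 - 2 * \<alpha> * T + (1 - \<alpha>\<^sup>2)"
    by (simp add: sum.distrib sum_subtractf sum_distrib_left T_def a2 del: card_Diff_insert)
  finally have s2: "(\<Sum>j\<in>UNIV - {p}. (\<alpha> - \<epsilon> j * a $ j)\<^sup>2) = (n - 1) * \<alpha>\<^sup>2 - 2 * \<alpha> * T + (1 - \<alpha>\<^sup>2)" by (simp only: cU)
  have s1: "(\<Sum>j\<in>UNIV - {p}. \<alpha> - \<epsilon> j * a $ j) = (n - 1) * \<alpha> - T"
    unfolding sum_subtractf T_def sum_constant cU ..
  show ?thesis unfolding s1 s2 n_def[symmetric] T_def[symmetric]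
    by (simp add: power2_eq_square algebra_simps)
qed

section \<open>The dominant coordinate and the facets that meet the hyperplane\<close>

lemma component_square_le:
  fixes a :: "real^'n"
  assumes "norm a = 1" "i \<noteq> p"
  shows "(a $ i)\<^sup>2 \<le> 1 - (a $ p)\<^sup>2"
proof -
  have "(\<Sum>j\<in>UNIV. (a $ j)\<^sup>2) = 1" using assms by (simp add: norm_vec_def L2_set_def sum_nonneg)
  moreover have "(\<Sum>j\<in>{i, p}. (a $ j)\<^sup>2) \<le> (\<Sum>j\<in>UNIV. (a $ j)\<^sup>2)" by (intro sum_mono2) auto
  ultimately show ?thesis using assms by simp
qed

lemma abs_component_less:
  fixes a :: "real^'n"
  assumes "norm a = 1" "1 / sqrt 2 < t" "t \<le> \<bar>a $ p\<bar>" "i \<noteq> p"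
  shows "\<bar>a $ i\<bar> < t"
proof -
  have t: "0 < t" "1 / 2 < t\<^sup>2"
  proof -
    show "0 < t" using assms(2) by (rule less_trans[rotated]) simp
    have "(1 / sqrt 2)\<^sup>2 < t\<^sup>2" using assms(2) by (intro power_strict_mono) auto
    then show "1 / 2 < t\<^sup>2" by (simp add: power_divide)
  qed
  have "t\<^sup>2 \<le> \<bar>a $ p\<bar>\<^sup>2" using assms(3) t(1) by (intro power_mono) auto
  then have "\<bar>a $ i\<bar>\<^sup>2 < t\<^sup>2" using component_square_le[OF assms(1,4)] t by simp
  then show ?thesis using t(1) by (intro power_less_imp_less_base[of _ 2 t]) auto
qed

text \<open>For an upper bound this inclusion suffices. The vector \<epsilon> records the signs of
  \<open>x\<close>, with 1 for a vanishing coordinate, and \<open>y\<close> its moduli.\<close>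

lemma section_covered_by_charts:
  fixes a x :: "real^'n" and p m :: 'n
  assumes a: "norm a = 1" and t: "1 / sqrt 2 < t" "t \<le> \<bar>a $ p\<bar>" and pm: "p \<noteq> m"
    and x: "a \<bullet> x = t" "l1_norm x = 1"
  shows "\<exists>\<epsilon>\<in>Pi\<^sub>E (UNIV - {p}) (\<lambda>_. {-1, 1}).
    x \<in> facet_chart \<epsilon> (sgn (a $ p)) (\<lambda>j. \<bar>a $ p\<bar> - \<epsilon> j * a $ j) (\<bar>a $ p\<bar> - t) p m `
      {y \<in> extensional (UNIV - {p, m}). (\<forall>i\<in>UNIV - {p, m}. 0 \<le> y i)
        \<and> (\<Sum>i\<in>UNIV - {p, m}. (\<bar>a $ p\<bar> - \<epsilon> i * a $ i) * y i) \<le> \<bar>a $ p\<bar> - t}"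
proof -
  define \<alpha> where "\<alpha> = \<bar>a $ p\<bar>"
  define s where "s = sgn (a $ p)"
  let ?I = "UNIV - {p, m}"
  define \<epsilon> where "\<epsilon> = (\<lambda>j\<in>UNIV - {p}. if x $ j < 0 then -1 else 1 :: real)"
  define b where "b j = \<alpha> - \<epsilon> j * a $ j" for j
  define y where "y = (\<lambda>i\<in>?I. \<bar>x $ i\<bar>)"
  have t0: "0 < t" using t(1) by (rule less_trans[rotated]) simp
  have \<alpha>: "t \<le> \<alpha>" "0 < \<alpha>" using t t0 by (auto simp: \<alpha>_def)
  have s: "s * a $ p = \<alpha>" "s * s = 1" "\<bar>s\<bar> = 1" using \<alpha>(2) by (auto simp: s_def \<alpha>_def sgn_if abs_if)
  have \<epsilon>: "\<epsilon> j * \<bar>x $ j\<bar> = x $ j" "\<bar>\<epsilon> j\<bar> = 1" if "j \<noteq> p" for j using that by (auto simp: \<epsilon>_def)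
  have lt: "\<bar>a $ j\<bar> < t" if "j \<noteq> p" for j using abs_component_less[OF a t that] .
  have bpos: "0 < b j" if "j \<noteq> p" for j
  proof -
    have "\<epsilon> j * a $ j \<le> \<bar>\<epsilon> j * a $ j\<bar>" by simp
    also have "\<dots> = \<bar>a $ j\<bar>" using \<epsilon>(2)[OF that] by (simp add: abs_mult)
    finally show ?thesis using lt[OF that] \<alpha> by (simp add: b_def)
  qed
  have Up: "(\<Sum>j\<in>UNIV. f j) = f p + (\<Sum>j\<in>UNIV - {p}. f j)" for f :: "'n \<Rightarrow> real"
    by (simp add: sum.remove)
  have inner: "a \<bullet> x = a $ p * x $ p + (\<Sum>j\<in>UNIV - {p}. a $ j * x $ j)"
    unfolding inner_vec_def by (simp add: Up)
  have l1: "\<bar>x $ p\<bar> + (\<Sum>j\<in>UNIV - {p}. \<bar>x $ j\<bar>) = 1" using x(2) unfolding l1_norm_def by (simp add: Up)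
  \<comment> \<open>If \<open>x $ p\<close> had the wrong sign, its term would be negative, while
    the other terms sum to at most \<open>t\<close>: their coefficients are below \<open>t\<close>
    in modulus and the moduli of \<open>x\<close> sum to 1. The inner product could not reach
    \<open>t\<close>.\<close>
  have sx: "0 \<le> s * x $ p"
  proof (rule ccontr)
    assume neg: "\<not> 0 \<le> s * x $ p"
    have "a $ p * x $ p = \<alpha> * (s * x $ p)"
      using s by (metis mult.assoc mult.commute mult_1)
    then have "a $ p * x $ p < 0" using neg \<alpha>(2) by (metis mult_pos_neg not_le)
    moreover have "(\<Sum>j\<in>UNIV - {p}. a $ j * x $ j) \<le> (\<Sum>j\<in>UNIV - {p}. t * \<bar>x $ j\<bar>)"
    proof (rule sum_mono)
      fix j assume "j \<in> UNIV - {p}"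
      then have "\<bar>a $ j\<bar> \<le> t" using lt[of j] by simp
      have "a $ j * x $ j \<le> \<bar>a $ j\<bar> * \<bar>x $ j\<bar>" by (metis abs_ge_self abs_mult)
      also have "\<dots> \<le> t * \<bar>x $ j\<bar>" using \<open>\<bar>a $ j\<bar> \<le> t\<close> by (intro mult_right_mono) auto
      finally show "a $ j * x $ j \<le> t * \<bar>x $ j\<bar>" .
    qed
    moreover have "(\<Sum>j\<in>UNIV - {p}. t * \<bar>x $ j\<bar>) \<le> t * 1"
      unfolding sum_distrib_left[symmetric] using l1 t0 by (intro mult_left_mono) auto
    ultimately show False using inner x(1) by linarith
  qed
  have xp: "s * x $ p = 1 - (\<Sum>j\<in>UNIV - {p}. \<bar>x $ j\<bar>)"
  proof -
    have "\<bar>x $ p\<bar> = \<bar>s * x $ p\<bar>" using s(3) by (simp add: abs_mult)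
    then show ?thesis using l1 sx by simp
  qed
  \<comment> \<open>Subtracting the hyperplane equation from \<alpha> times the norm equation
    cancels \<open>x $ p\<close>, because \<open>a $ p * x $ p\<close> equals \<alpha> times its
    modulus.\<close>
  have hyper: "(\<Sum>j\<in>UNIV - {p}. b j * \<bar>x $ j\<bar>) = \<alpha> - t"
  proof -
    have "(\<Sum>j\<in>UNIV - {p}. b j * \<bar>x $ j\<bar>) = (\<Sum>j\<in>UNIV - {p}. \<alpha> * \<bar>x $ j\<bar> - a $ j * x $ j)"
    proof (rule sum.cong)
      fix j assume "j \<in> UNIV - {p}"
      then have "\<epsilon> j * \<bar>x $ j\<bar> = x $ j" using \<epsilon>(1) by simp
      then show "b j * \<bar>x $ j\<bar> = \<alpha> * \<bar>x $ j\<bar> - a $ j * x $ j"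
        using arg_cong[of "\<epsilon> j * \<bar>x $ j\<bar>" "x $ j" "\<lambda>u. a $ j * u"] by (simp add: b_def algebra_simps)
    qed simp
    also have "\<dots> = \<alpha> * (1 - s * x $ p) - (t - a $ p * x $ p)"
      using xp inner x(1) by (simp add: sum_subtractf sum_distrib_left[symmetric])
    also have "\<dots> = \<alpha> - t - (\<alpha> * s - a $ p) * x $ p" by (simp add: algebra_simps)
    also have "\<alpha> * s = a $ p" unfolding s(1)[symmetric] using s(2) by (simp add: algebra_simps)
    finally show ?thesis by simp
  qed
  have Um: "(\<Sum>j\<in>UNIV - {p}. f j) = f m + (\<Sum>j\<in>?I. f j)" for f :: "'n \<Rightarrow> real"
  proof -
    have "UNIV - {p} = insert m ?I" using pm by auto
    then show ?thesis by simp
  qed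
  have yI: "(\<Sum>i\<in>?I. b i * y i) = (\<Sum>i\<in>?I. b i * \<bar>x $ i\<bar>)" "(\<Sum>i\<in>?I. y i) = (\<Sum>i\<in>?I. \<bar>x $ i\<bar>)"
    by (simp_all add: y_def)
  have h: "(\<alpha> - t - (\<Sum>i\<in>?I. b i * y i)) / b m = \<bar>x $ m\<bar>"
    using hyper bpos[of m] pm unfolding yI Um by (simp add: field_simps)
  have "x = facet_chart \<epsilon> s b (\<alpha> - t) p m y"
  proof (rule vec_eq_iff[THEN iffD2], rule allI)
    fix i
    show "x $ i = facet_chart \<epsilon> s b (\<alpha> - t) p m y $ i"
    proof (cases "i = p")
      case True
      have "x $ p = s * (s * x $ p)" using s(2) by (simp add: mult.assoc[symmetric])
      then show ?thesis using True xp unfolding facet_chart_def Let_def h unfolding yI Um by (simp add: algebra_simps)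
    next
      case False
      then show ?thesis using \<epsilon>(1)[of i] unfolding facet_chart_def Let_def h by (auto simp: y_def)
    qed
  qed
  moreover have "y \<in> {y \<in> extensional ?I. (\<forall>i\<in>?I. 0 \<le> y i) \<and> (\<Sum>i\<in>?I. b i * y i) \<le> \<alpha> - t}"
  proof -
    have "0 \<le> b m * \<bar>x $ m\<bar>" using bpos[of m] pm by simp
    then have "(\<Sum>i\<in>?I. b i * y i) \<le> \<alpha> - t" using hyper unfolding yI Um by linarith
    then show ?thesis by (auto simp: y_def)
  qed
  moreover have "\<epsilon> \<in> Pi\<^sub>E (UNIV - {p}) (\<lambda>_. {-1, 1})" by (auto simp: \<epsilon>_def)
  ultimately show ?thesis unfolding b_def \<alpha>_def s_def by blast
qed

lemma exists_other_index:
  fixes p :: "'n::finite"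
  assumes "3 \<le> CARD('n)"
  obtains m where "p \<noteq> m"
proof -
  have "UNIV \<noteq> {p}"
  proof
    assume "UNIV = {p}"
    then have "CARD('n) = card {p}" by (rule arg_cong)
    also have "\<dots> = 1" by simp
    finally show False using assms by linarith
  qed
  then show ?thesis using that by (metis UNIV_eq_I singleton_iff)
qed

lemma hausdorff_pre_section_le:
  fixes a :: "real^'n" and p :: 'n
  assumes a: "norm a = 1" and t: "1 / sqrt 2 < t" "t \<le> \<bar>a $ p\<bar>" and n: "3 \<le> CARD('n)" and \<delta>: "0 < \<delta>"
  shows "hausdorff_pre (real (CARD('n) - 2)) \<delta> ({x. a \<bullet> x = t} \<inter> frontier cross_polytope)
    \<le> ennreal ((\<bar>a $ p\<bar> - t) ^ (CARD('n) - 2) / fact (CARD('n) - 2) *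
       (\<Sum>\<epsilon>\<in>Pi\<^sub>E (UNIV - {p}) (\<lambda>_. {-1, 1}).
          sqrt (real CARD('n) - (\<bar>a $ p\<bar> + (\<Sum>j\<in>UNIV - {p}. \<epsilon> j * a $ j))\<^sup>2)
            / (\<Prod>j\<in>UNIV - {p}. \<bar>a $ p\<bar> - \<epsilon> j * a $ j)))"
proof -
  define k where "k = CARD('n) - 2"
  define \<alpha> where "\<alpha> = \<bar>a $ p\<bar>"
  have k: "0 < k" using n by (simp add: k_def)
  obtain m where pm: "p \<noteq> m" using exists_other_index[OF n] .
  let ?I = "UNIV - {p, m}"
  let ?E = "Pi\<^sub>E (UNIV - {p}) (\<lambda>_. {-1, 1 :: real})"
  define T where "T \<epsilon> = facet_chart \<epsilon> (sgn (a $ p)) (\<lambda>j. \<alpha> - \<epsilon> j * a $ j) (\<alpha> - t) p m `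
      {y \<in> extensional ?I. (\<forall>i\<in>?I. 0 \<le> y i) \<and> (\<Sum>i\<in>?I. (\<alpha> - \<epsilon> i * a $ i) * y i) \<le> \<alpha> - t}" for \<epsilon>
  define v where "v \<epsilon> = sqrt (real CARD('n) - (\<alpha> + (\<Sum>j\<in>UNIV - {p}. \<epsilon> j * a $ j))\<^sup>2)
            / (\<Prod>j\<in>UNIV - {p}. \<alpha> - \<epsilon> j * a $ j)" for \<epsilon>
  have t0: "0 < t" using t(1) by (rule less_trans[rotated]) simp
  have one: "hausdorff_pre (real k) \<delta> (T \<epsilon>) \<le> ennreal ((\<alpha> - t) ^ k / fact k * v \<epsilon>) \<and> 0 \<le> v \<epsilon>" if \<epsilon>: "\<epsilon> \<in> ?E" for \<epsilon>
  proof -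
    define b where "b j = \<alpha> - \<epsilon> j * a $ j" for j
    have \<epsilon>1: "\<epsilon> j = -1 \<or> \<epsilon> j = 1" if "j \<noteq> p" for j using PiE_mem[OF \<epsilon>, of j] that by simp
    have bpos: "0 < b j" if "j \<noteq> p" for j
      using abs_component_less[OF a t that] \<epsilon>1[OF that] t(2) by (auto simp: b_def \<alpha>_def)
    have \<epsilon>2: "(\<epsilon> j)\<^sup>2 = 1" if "j \<noteq> p" for j using \<epsilon>1[OF that] by auto
    have sgn2: "(sgn (a $ p))\<^sup>2 = 1" using t(2) t0 by (auto simp: sgn_if)
    interpret affine_chart ?I "\<lambda>i. b i / b m" "\<lambda>i. 1 - b i / b m" "facet_chart \<epsilon> (sgn (a $ p)) b (\<alpha> - t) p m" k
      unfolding k_def using affine_chart_facet[OF pm _ sgn2 \<epsilon>2 n, where b = b] bpos[of m] pm by auto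
    have bm: "0 < b m" using bpos pm by auto
    have Gb: "(b m)\<^sup>2 * G = real CARD('n) - (\<alpha> + (\<Sum>j\<in>UNIV - {p}. \<epsilon> j * a $ j))\<^sup>2"
      using gram2_facet[of p m b] gram2_section[OF a \<epsilon>2, where p = p and \<alpha> = \<alpha>] bm pm
      by (simp add: \<alpha>_def b_def)
    have "hausdorff_pre (real k) \<delta> (T \<epsilon>) \<le> ennreal (sqrt G * ((\<alpha> - t) ^ k / (fact k * prod b ?I)))"
      unfolding T_def b_def[symmetric]
      by (rule hausdorff_pre_simplex_le[OF \<delta>]) (use bpos t in \<open>auto simp: \<alpha>_def\<close>)
    also have "sqrt G * ((\<alpha> - t) ^ k / (fact k * prod b ?I)) = (\<alpha> - t) ^ k / fact k * v \<epsilon>"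
    proof -
      \<comment> \<open>Multiplying numerator and denominator by \<open>b m\<close> makes the facet
        volume symmetric in the indices other than \<open>p\<close>.\<close>
      have "sqrt (real CARD('n) - (\<alpha> + (\<Sum>j\<in>UNIV - {p}. \<epsilon> j * a $ j))\<^sup>2) = b m * sqrt G"
        unfolding Gb[symmetric] using bm by (simp add: real_sqrt_mult)
      moreover have "(\<Prod>j\<in>UNIV - {p}. b j) = b m * prod b ?I"
      proof -
        have "UNIV - {p} = insert m ?I" using pm by auto
        then show ?thesis by simp
      qed
      ultimately have "v \<epsilon> = sqrt G / prod b ?I" using bm unfolding v_def b_def[symmetric] by simp
      then show ?thesis by simp
    qed
    finally have "hausdorff_pre (real k) \<delta> (T \<epsilon>) \<le> ennreal ((\<alpha> - t) ^ k / fact k * v \<epsilon>)" .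
    moreover have "0 \<le> v \<epsilon>"
    proof -
      have "0 < (\<Prod>j\<in>UNIV - {p}. b j)" using bpos by (intro prod_pos) auto
      moreover have "0 \<le> real CARD('n) - (\<alpha> + (\<Sum>j\<in>UNIV - {p}. \<epsilon> j * a $ j))\<^sup>2"
        unfolding Gb[symmetric] using G_pos by simp
      ultimately show ?thesis unfolding v_def b_def[symmetric] by simp
    qed
    ultimately show ?thesis by simp
  qed
  have "{x. a \<bullet> x = t} \<inter> frontier cross_polytope \<subseteq> (\<Union>\<epsilon>\<in>?E. T \<epsilon>)"
    unfolding frontier_cross_polytope T_def \<alpha>_def using section_covered_by_charts[OF a t pm] by blast
  then have "hausdorff_pre (real k) \<delta> ({x. a \<bullet> x = t} \<inter> frontier cross_polytope) \<le> hausdorff_pre (real k) \<delta> (\<Union>\<epsilon>\<in>?E. T \<epsilon>)"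
    by (rule hausdorff_pre_mono)
  also have "\<dots> \<le> (\<Sum>\<epsilon>\<in>?E. hausdorff_pre (real k) \<delta> (T \<epsilon>))"
    using k \<delta> by (intro hausdorff_pre_finite_UN_le finite_PiE) auto
  also have "\<dots> \<le> (\<Sum>\<epsilon>\<in>?E. ennreal ((\<alpha> - t) ^ k / fact k * v \<epsilon>))"
    using one by (intro sum_mono) auto
  also have "\<dots> = ennreal (\<Sum>\<epsilon>\<in>?E. (\<alpha> - t) ^ k / fact k * v \<epsilon>)"
    using one t by (intro sum_ennreal) (auto simp: \<alpha>_def)
  also have "(\<Sum>\<epsilon>\<in>?E. (\<alpha> - t) ^ k / fact k * v \<epsilon>) = (\<alpha> - t) ^ k / fact k * (\<Sum>\<epsilon>\<in>?E. v \<epsilon>)"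
    by (simp add: sum_distrib_left)
  finally show ?thesis unfolding v_def \<alpha>_def k_def .
qed

subsection \<open>Optimality of the coordinate directions\<close>

lemma sum_signs_prod:
  fixes g :: "'j \<Rightarrow> real \<Rightarrow> real"
  assumes "finite J"
  shows "(\<Sum>\<epsilon>\<in>Pi\<^sub>E J (\<lambda>_. {-1, 1}). \<Prod>j\<in>J. g j (\<epsilon> j)) = (\<Prod>j\<in>J. g j (-1) + g j 1)"
proof -
  have "(\<Prod>j\<in>J. \<Sum>y\<in>{-1, 1}. g j y) = (\<Sum>\<epsilon>\<in>Pi\<^sub>E J (\<lambda>_. {-1, 1}). \<Prod>j\<in>J. g j (\<epsilon> j))"
    using assms by (intro prod_sum_PiE) auto
  then show ?thesis by simp
qed

text \<open>Weighting each sign vector by \<open>1 / (\<Prod>j\<in>J. \<alpha> - \<epsilon> j * u j)\<close> makes the signs independent with mean \<open>u j / \<alpha>\<close>.\<close>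
lemma sum_signs_weight:
  fixes u :: "'j \<Rightarrow> real"
  assumes J: "finite J" and u: "\<And>j. j \<in> J \<Longrightarrow> \<bar>u j\<bar> < \<alpha>"
  defines "W \<equiv> \<Prod>j\<in>J. 2 * \<alpha> / (\<alpha>\<^sup>2 - (u j)\<^sup>2)"
  shows "(\<Sum>\<epsilon>\<in>Pi\<^sub>E J (\<lambda>_. {-1, 1}). 1 / (\<Prod>j\<in>J. \<alpha> - \<epsilon> j * u j)) = W"
    and "i \<in> J \<Longrightarrow> (\<Sum>\<epsilon>\<in>Pi\<^sub>E J (\<lambda>_. {-1, 1}). \<epsilon> i * u i / (\<Prod>j\<in>J. \<alpha> - \<epsilon> j * u j)) = W * ((u i)\<^sup>2 / \<alpha>)"
proof -
  have pos: "0 < \<alpha> - u j" "0 < \<alpha> + u j" if "j \<in> J" for j using u[OF that] by auto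
  have fac: "\<alpha>\<^sup>2 - (u j)\<^sup>2 = (\<alpha> - u j) * (\<alpha> + u j)" for j by (simp add: power2_eq_square algebra_simps)
  have "(\<Sum>\<epsilon>\<in>Pi\<^sub>E J (\<lambda>_. {-1, 1}). \<Prod>j\<in>J. 1 / (\<alpha> - \<epsilon> j * u j)) = (\<Prod>j\<in>J. 1 / (\<alpha> - (-1) * u j) + 1 / (\<alpha> - 1 * u j))"
    by (rule sum_signs_prod[OF J])
  also have "\<dots> = W" unfolding W_def
  proof (intro prod.cong refl)
    fix j assume "j \<in> J"
    then show "1 / (\<alpha> - (-1) * u j) + 1 / (\<alpha> - 1 * u j) = 2 * \<alpha> / (\<alpha>\<^sup>2 - (u j)\<^sup>2)"
      unfolding fac using pos[of j] by (simp add: divide_simps)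
  qed
  finally show "(\<Sum>\<epsilon>\<in>Pi\<^sub>E J (\<lambda>_. {-1, 1}). 1 / (\<Prod>j\<in>J. \<alpha> - \<epsilon> j * u j)) = W"
    by (simp add: prod_dividef)
  assume i: "i \<in> J"
  have "\<alpha> > 0" using u[OF i] by linarith
  \<comment> \<open>The numerator is moved into factor \<open>i\<close> of the product, so that the
    sum over signs still factorises.\<close>
  have "(\<Sum>\<epsilon>\<in>Pi\<^sub>E J (\<lambda>_. {-1, 1}). \<epsilon> i * u i / (\<Prod>j\<in>J. \<alpha> - \<epsilon> j * u j))
      = (\<Sum>\<epsilon>\<in>Pi\<^sub>E J (\<lambda>_. {-1, 1}). \<Prod>j\<in>J. (if j = i then \<epsilon> j * u j else 1) / (\<alpha> - \<epsilon> j * u j))"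
    using i J by (simp add: prod_dividef prod.delta)
  also have "\<dots> = (\<Prod>j\<in>J. (if j = i then (-1) * u j else 1) / (\<alpha> - (-1) * u j) + (if j = i then 1 * u j else 1) / (\<alpha> - 1 * u j))"
    by (rule sum_signs_prod[OF J])
  also have "\<dots> = (\<Prod>j\<in>J. 2 * \<alpha> / (\<alpha>\<^sup>2 - (u j)\<^sup>2) * (if j = i then (u j)\<^sup>2 / \<alpha> else 1))"
  proof (intro prod.cong refl)
    fix j assume "j \<in> J"
    then show "(if j = i then (-1) * u j else 1) / (\<alpha> - (-1) * u j) + (if j = i then 1 * u j else 1) / (\<alpha> - 1 * u j)
      = 2 * \<alpha> / (\<alpha>\<^sup>2 - (u j)\<^sup>2) * (if j = i then (u j)\<^sup>2 / \<alpha> else 1)"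
      unfolding fac using pos[of j] \<open>\<alpha> > 0\<close> by (cases "j = i") (simp_all add: field_simps power2_eq_square)
  qed
  also have "\<dots> = W * ((u i)\<^sup>2 / \<alpha>)" unfolding prod.distrib W_def using i J by (simp add: prod.delta)
  finally show "(\<Sum>\<epsilon>\<in>Pi\<^sub>E J (\<lambda>_. {-1, 1}). \<epsilon> i * u i / (\<Prod>j\<in>J. \<alpha> - \<epsilon> j * u j)) = W * ((u i)\<^sup>2 / \<alpha>)" .
qed

lemma one_minus_sum_le_prod:
  fixes x :: "'j \<Rightarrow> real"
  assumes "finite J" "\<And>j. j \<in> J \<Longrightarrow> 0 \<le> x j" "\<And>j. j \<in> J \<Longrightarrow> x j \<le> 1"
  shows "1 - sum x J \<le> (\<Prod>j\<in>J. 1 - x j)"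
  using assms
proof (induction J rule: finite_induct)
  case (insert i J)
  have IH: "1 - sum x J \<le> (\<Prod>j\<in>J. 1 - x j)" using insert by auto
  have le1: "(\<Prod>j\<in>J. 1 - x j) \<le> 1" using insert.prems by (intro prod_le_1) auto
  have "x i * (\<Prod>j\<in>J. 1 - x j) \<le> x i * 1" using insert.prems le1 by (intro mult_left_mono) auto
  then show ?case using IH insert.hyps by (simp add: left_diff_distrib)
qed simp

text \<open>The bound is the tangent at X = 1 of the concave function \<open>sqrt (n - X\<^sup>2)\<close>.\<close>
lemma sqrt_le_tangent:
  fixes n X :: real
  assumes "1 < n" "X\<^sup>2 \<le> n"
  shows "sqrt (n - X\<^sup>2) \<le> (n - X) / sqrt (n - 1)"
proof -
  have "X \<le> n"
  proof (rule power2_le_imp_le)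
    show "X\<^sup>2 \<le> n\<^sup>2" using assms by (simp add: power2_eq_square) (smt (verit) mult_le_cancel_left1)
  qed (use assms in simp)
  \<comment> \<open>This is the difference
    \<open>(n - X)\<^sup>2 - (n - 1) * (n - X\<^sup>2)\<close>.\<close>
  have "0 \<le> n * (X - 1)\<^sup>2" using assms by simp
  then have "(n - 1) * (n - X\<^sup>2) \<le> (n - X)\<^sup>2" by (simp add: power2_eq_square algebra_simps)
  then have "sqrt ((n - 1) * (n - X\<^sup>2)) \<le> sqrt ((n - X)\<^sup>2)" by (rule real_sqrt_le_mono)
  then have "sqrt (n - 1) * sqrt (n - X\<^sup>2) \<le> n - X" using \<open>X \<le> n\<close> by (simp add: real_sqrt_mult)
  then show ?thesis using assms by (simp add: field_simps)
qed

text \<open>What remains once the total weight is bounded by \<open>2 ^ (k + 1) * \<alpha> /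
  (\<alpha> ^ k * (2 * \<alpha>\<^sup>2 - 1))\<close>; both sides agree at \<alpha> = 1. For
  \<open>2 \<le> k\<close> everything reduces to exponent 2, because
  \<open>\<alpha> - t \<le> (1 - t) * \<alpha>\<close>. For \<open>k = 1\<close> a factor \<alpha>
  cancels and a quadratic in 1 - \<alpha> is left.\<close>

lemma power_section_bound:
  fixes \<alpha> t :: real
  assumes \<alpha>: "t \<le> \<alpha>" "\<alpha> \<le> 1"
    and t: "(2 \<le> k \<and> 1 / sqrt 2 < t) \<or> (k = 1 \<and> 4 / 5 < t)"
  shows "(\<alpha> - t) ^ k * \<alpha> \<le> (1 - t) ^ k * (\<alpha> ^ k * (2 * \<alpha>\<^sup>2 - 1))"
proof (cases "2 \<le> k")
  case False
  then have k: "k = 1" and t: "4 / 5 < t" using t by auto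
  define h where "h = 1 - \<alpha>"
  have "0 \<le> h" using \<alpha> by (simp add: h_def)
  \<comment> \<open>The factor \<open>h\<close> reflects equality at \<alpha> = 1. The second factor
    is positive since \<open>4 / 5 < t\<close> makes \<open>4 * (1 - t)\<close> less than 1.\<close>
  then have "0 \<le> h * (1 - 4 * (1 - t) + 2 * h * (1 - t))" using t \<alpha> by (intro mult_nonneg_nonneg) (auto intro!: add_nonneg_nonneg)
  also have "\<dots> = (1 - t) * (2 * \<alpha>\<^sup>2 - 1) - (\<alpha> - t)" by (simp add: h_def power2_eq_square algebra_simps)
  finally have "(\<alpha> - t) * \<alpha> \<le> ((1 - t) * (2 * \<alpha>\<^sup>2 - 1)) * \<alpha>" using t \<alpha> by (intro mult_right_mono) auto
  then show ?thesis by (simp add: k mult_ac)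
next
  case True
  define c where "c = 1 / sqrt (2::real)"
  have c: "2 * c\<^sup>2 = 1" "0 < c" "c < t" "1/4 < c" "c < 1"
  proof -
    show "2 * c\<^sup>2 = 1" by (simp add: c_def power_divide)
    show "0 < c" by (simp add: c_def)
    show "c < t" using t True by (simp add: c_def)
    \<comment> \<open>Needed below to keep \<open>3 - 4 * c\<close> under 2.\<close>
    show "1/4 < c"
    proof (rule ccontr)
      assume "\<not> 1/4 < c"
      then have "c\<^sup>2 \<le> (1/4)\<^sup>2" using \<open>0 < c\<close> by (intro power_mono) auto
      then show False using \<open>2 * c\<^sup>2 = 1\<close> by (simp add: power_divide)
    qed
    show "c < 1" by (simp add: c_def)
  qed
  have key: "(\<alpha> - t)\<^sup>2 \<le> (1 - t)\<^sup>2 * (\<alpha> * (2 * \<alpha>\<^sup>2 - 1))"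
  proof (cases "t = 1")
    case True
    then show ?thesis using \<alpha> by simp
  next
    case False
    then have t1: "t < 1" using \<alpha> by simp
    define r where "r = (\<alpha> - t) / (1 - t)"
    have r: "0 \<le> r" "r \<le> 1" "\<alpha> - t = r * (1 - t)" using \<alpha> t1 by (auto simp: r_def)
    \<comment> \<open>For fixed \<open>r\<close> the point \<open>t + r * (1 - t)\<close> grows with
      \<open>t\<close>, and so does \<open>\<alpha> * (2 * \<alpha>\<^sup>2 - 1)\<close> with
      \<alpha> beyond \<open>c\<close>. The extreme case is therefore \<open>t = c\<close>, where
      \<alpha> becomes \<open>A\<close> and only \<open>r\<close> varies.\<close>
    define A where "A = c + r * (1 - c)"
    have "\<alpha> = t + r * (1 - t)" using r(3) by simp
    then have "\<alpha> - A = (1 - r) * (t - c)" by (simp add: A_def algebra_simps)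
    then have "A \<le> \<alpha>" using r c by (smt (verit) mult_nonneg_nonneg)
    have "c \<le> A" using r c by (simp add: A_def)
    \<comment> \<open>At \<open>r = 0\<close> the left side is \<open>2 * c\<^sup>2 - 1 = 0\<close>;
      the resulting factor \<open>r\<close> is cancelled in the next inequality.\<close>
    have A2: "2 * A\<^sup>2 - 1 = r * (4 * c - 2 + r * (3 - 4 * c))"
    proof -
      have "2 * A\<^sup>2 - 1 = (2 * c\<^sup>2 - 1) + 4 * r * c - 2 * r * (2 * c\<^sup>2) + r\<^sup>2 * (2 - 4 * c + 2 * c\<^sup>2)"
        by (simp add: A_def power2_eq_square algebra_simps)
      then show ?thesis unfolding c(1) by (simp add: power2_eq_square algebra_simps)
    qed
    have "r \<le> A * (4 * c - 2 + r * (3 - 4 * c))"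
    proof -
      \<comment> \<open>The difference vanishes at \<open>r = 1\<close>, where \<open>A = 1\<close>.
        The identity holds for every \<open>c\<close> once a multiple of
        \<open>2 * c\<^sup>2 - 1\<close> is added, and that multiple is 0.\<close>
      have "A * (4 * c - 2 + r * (3 - 4 * c)) - r = (1 - r) * ((1 - c) * (2 - (3 - 4 * c) * r))
          + (2 * c\<^sup>2 - 1) * (2 - 2 * r)"
        by (simp add: A_def power2_eq_square algebra_simps)
      also have "\<dots> = (1 - r) * ((1 - c) * (2 - (3 - 4 * c) * r))" by (simp add: c(1))
      also have "0 \<le> \<dots>"
      proof -
        have "(3 - 4 * c) * r \<le> 2 * 1" using r c by (intro mult_mono) auto
        then show ?thesis using r c by (intro mult_nonneg_nonneg) auto
      qed
      finally show ?thesis by simp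
    qed
    then have "r * r \<le> A * (2 * A\<^sup>2 - 1)" unfolding A2 using r(1) by (metis mult_left_mono mult.left_commute)
    also have "\<dots> \<le> \<alpha> * (2 * \<alpha>\<^sup>2 - 1)"
    proof (rule mult_mono)
      show "A \<le> \<alpha>" "0 \<le> \<alpha>" using \<open>A \<le> \<alpha>\<close> \<open>c \<le> A\<close> c by auto
      have "c\<^sup>2 \<le> A\<^sup>2" "A\<^sup>2 \<le> \<alpha>\<^sup>2" using \<open>A \<le> \<alpha>\<close> \<open>c \<le> A\<close> c by (auto intro: power_mono)
      then show "2 * A\<^sup>2 - 1 \<le> 2 * \<alpha>\<^sup>2 - 1" "0 \<le> 2 * A\<^sup>2 - 1" using c(1) by auto
    qed
    finally have "(1 - t)\<^sup>2 * (r * r) \<le> (1 - t)\<^sup>2 * (\<alpha> * (2 * \<alpha>\<^sup>2 - 1))" by (intro mult_left_mono) auto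
    then show ?thesis unfolding r(3) by (simp add: power2_eq_square mult_ac)
  qed
  have \<alpha>0: "0 < \<alpha>" using c \<alpha> by linarith
  define x y where "x = \<alpha> - t" "y = (1 - t) * \<alpha>"
  have xy: "0 \<le> x" "x \<le> y" "0 \<le> y"
  proof -
    show "0 \<le> x" using \<alpha> by (simp add: x_y_def)
    have "t * \<alpha> \<le> t * 1" using \<alpha> c by (intro mult_left_mono) auto
    then show "x \<le> y" by (simp add: x_y_def algebra_simps)
    then show "0 \<le> y" using \<open>0 \<le> x\<close> by linarith
  qed
  obtain l where l: "k = l + 2" using True by (metis add.commute le_Suc_ex)
  have "x\<^sup>2 * \<alpha> \<le> ((1 - t)\<^sup>2 * (\<alpha> * (2 * \<alpha>\<^sup>2 - 1))) * \<alpha>" using key \<alpha>0 by (intro mult_right_mono) (auto simp: x_y_def)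
  also have "\<dots> = y\<^sup>2 * (2 * \<alpha>\<^sup>2 - 1)" by (simp add: x_y_def power2_eq_square mult_ac)
  finally have 1: "x\<^sup>2 * \<alpha> \<le> y\<^sup>2 * (2 * \<alpha>\<^sup>2 - 1)" .
  have "x ^ k * \<alpha> = x ^ l * (x\<^sup>2 * \<alpha>)" by (simp add: l power_add power2_eq_square)
  also have "\<dots> \<le> y ^ l * (y\<^sup>2 * (2 * \<alpha>\<^sup>2 - 1))"
    by (rule mult_mono) (use 1 xy \<alpha>0 in \<open>auto intro: power_mono\<close>)
  also have "\<dots> = (1 - t) ^ k * (\<alpha> ^ k * (2 * \<alpha>\<^sup>2 - 1))"
    by (simp add: x_y_def l power_add power_mult_distrib power2_eq_square mult_ac)
  finally show ?thesis by (simp add: x_y_def)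
qed

lemma section_sum_le:
  fixes a :: "real^'n" and p :: 'n
  assumes a: "norm a = 1" and t: "t \<le> \<bar>a $ p\<bar>"
    and u: "\<And>j. j \<noteq> p \<Longrightarrow> \<bar>a $ j\<bar> < \<bar>a $ p\<bar>"
    and nt: "(CARD('n) \<ge> 4 \<and> 1 / sqrt 2 < t) \<or> (CARD('n) = 3 \<and> 4 / 5 < t)"
  shows "(\<bar>a $ p\<bar> - t) ^ (CARD('n) - 2) / fact (CARD('n) - 2) *
       (\<Sum>\<epsilon>\<in>Pi\<^sub>E (UNIV - {p}) (\<lambda>_. {-1, 1}).
          sqrt (real CARD('n) - (\<bar>a $ p\<bar> + (\<Sum>j\<in>UNIV - {p}. \<epsilon> j * a $ j))\<^sup>2)
            / (\<Prod>j\<in>UNIV - {p}. \<bar>a $ p\<bar> - \<epsilon> j * a $ j))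
    \<le> sqrt (real CARD('n) - 1) / fact (CARD('n) - 2) * 2 ^ (CARD('n) - 1) * (1 - t) ^ (CARD('n) - 2)"
proof -
  define k where "k = CARD('n) - 2"
  define n where "n = real CARD('n)"
  define \<alpha> where "\<alpha> = \<bar>a $ p\<bar>"
  define J where "J = UNIV - {p}"
  define E where "E = Pi\<^sub>E J (\<lambda>_. {-1, 1 :: real})"
  define X where "X \<epsilon> = \<alpha> + (\<Sum>j\<in>J. \<epsilon> j * a $ j)" for \<epsilon>
  define w where "w \<epsilon> = 1 / (\<Prod>j\<in>J. \<alpha> - \<epsilon> j * a $ j)" for \<epsilon>
  define W where "W = (\<Prod>j\<in>J. 2 * \<alpha> / (\<alpha>\<^sup>2 - (a $ j)\<^sup>2))"
  have J: "finite J" "card J = k + 1" "CARD('n) - 1 = k + 1" using nt by (auto simp: J_def k_def card_Diff_singleton)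
  have n1: "1 < n" using nt by (auto simp: n_def)
  have uJ: "\<bar>a $ j\<bar> < \<alpha>" if "j \<in> J" for j using u[of j] that by (simp add: J_def \<alpha>_def)
  have norm2: "(\<Sum>j\<in>UNIV. (a $ j)\<^sup>2) = 1" using a by (simp add: norm_vec_def L2_set_def sum_nonneg)
  then have sumJ: "(\<Sum>j\<in>J. (a $ j)\<^sup>2) = 1 - \<alpha>\<^sup>2" by (simp add: J_def sum_diff1 \<alpha>_def)
  have t2: "1 / 2 < t\<^sup>2 \<and> 0 < t"
  proof -
    have "(1 / sqrt 2)\<^sup>2 < t\<^sup>2" if "1 / sqrt 2 < t" using that by (intro power_strict_mono) auto
    moreover have "0 < t" if "1 / sqrt 2 < t" using that by (rule less_trans[rotated]) simp
    moreover have "(4 / 5)\<^sup>2 < t\<^sup>2" if "4 / 5 < t" using that by (intro power_strict_mono) auto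
    ultimately show ?thesis using nt by (auto simp: power_divide)
  qed
  have \<alpha>: "t \<le> \<alpha>" "0 < \<alpha>" "\<alpha> \<le> 1"
  proof -
    show "t \<le> \<alpha>" "0 < \<alpha>" using t t2 by (auto simp: \<alpha>_def)
    show "\<alpha> \<le> 1" using component_le_norm_cart[of a p] a by (simp add: \<alpha>_def)
  qed
  have \<alpha>2: "1 < 2 * \<alpha>\<^sup>2" using t2 power_mono[OF \<alpha>(1), of 2] by simp
  have sgn: "\<epsilon> j = -1 \<or> \<epsilon> j = 1" if "\<epsilon> \<in> E" "j \<in> J" for \<epsilon> j using that by (auto simp: E_def dest!: PiE_mem)
  have w0: "0 \<le> w \<epsilon>" if "\<epsilon> \<in> E" for \<epsilon>
  proof -
    have "0 < (\<Prod>j\<in>J. \<alpha> - \<epsilon> j * a $ j)"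
    proof (rule prod_pos)
      fix j assume j: "j \<in> J"
      show "0 < \<alpha> - \<epsilon> j * a $ j" using sgn[OF that j] uJ[OF j] by auto
    qed
    then show ?thesis by (simp add: w_def)
  qed
  have W: "(\<Sum>\<epsilon>\<in>E. w \<epsilon>) = W"
    unfolding E_def w_def W_def by (rule sum_signs_weight(1)[OF J(1) uJ])
  \<comment> \<open>The weighted mean of \<open>\<epsilon> j * a $ j\<close> is
    \<open>(a $ j)\<^sup>2 / \<alpha>\<close>, and the squares sum to
    \<open>1 - \<alpha>\<^sup>2\<close>; so \<open>X\<close> has mean
    \<open>\<alpha> + (1 - \<alpha>\<^sup>2) / \<alpha> = 1 / \<alpha>\<close>.\<close>
  have WX: "(\<Sum>\<epsilon>\<in>E. X \<epsilon> * w \<epsilon>) = W / \<alpha>"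
  proof -
    have "(\<Sum>\<epsilon>\<in>E. X \<epsilon> * w \<epsilon>) = \<alpha> * (\<Sum>\<epsilon>\<in>E. w \<epsilon>) + (\<Sum>\<epsilon>\<in>E. \<Sum>j\<in>J. \<epsilon> j * a $ j * w \<epsilon>)"
      by (simp add: X_def distrib_right sum.distrib sum_distrib_left sum_distrib_right)
    also have "(\<Sum>\<epsilon>\<in>E. \<Sum>j\<in>J. \<epsilon> j * a $ j * w \<epsilon>) = (\<Sum>j\<in>J. \<Sum>\<epsilon>\<in>E. \<epsilon> j * a $ j * w \<epsilon>)"
      by (rule sum.swap)
    also have "\<dots> = (\<Sum>j\<in>J. W * ((a $ j)\<^sup>2 / \<alpha>))"
    proof (rule sum.cong[OF refl])
      fix j assume j: "j \<in> J"
      show "(\<Sum>\<epsilon>\<in>E. \<epsilon> j * a $ j * w \<epsilon>) = W * ((a $ j)\<^sup>2 / \<alpha>)"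
        using sum_signs_weight(2)[OF J(1) uJ j] by (simp add: E_def w_def W_def)
    qed
    also have "\<dots> = W * ((1 - \<alpha>\<^sup>2) / \<alpha>)"
      by (simp add: sumJ[symmetric] sum_distrib_left sum_divide_distrib)
    also have "\<alpha> * (\<Sum>\<epsilon>\<in>E. w \<epsilon>) + W * ((1 - \<alpha>\<^sup>2) / \<alpha>) = W / \<alpha>"
      unfolding W using \<alpha>(2) by (simp add: field_simps power2_eq_square)
    finally show ?thesis .
  qed
  have W0: "0 \<le> W" unfolding W[symmetric] using w0 by (rule sum_nonneg)
  \<comment> \<open>\<open>X\<close> is the inner product of the all-ones vector with a sign-changed
    copy of \<open>a\<close>, still a unit vector. This makes the tangent bound applicable.\<close>
  have X2: "(X \<epsilon>)\<^sup>2 \<le> n" if \<epsilon>: "\<epsilon> \<in> E" for \<epsilon>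
  proof -
    define v where "v j = (if j = p then \<alpha> else \<epsilon> j * a $ j)" for j
    have "X \<epsilon> = (\<Sum>j\<in>UNIV. 1 * v j)"
      by (simp add: X_def J_def v_def sum.remove[of UNIV p])
    then have "(X \<epsilon>)\<^sup>2 \<le> (\<Sum>j\<in>(UNIV::'n set). 1\<^sup>2) * (\<Sum>j\<in>UNIV. (v j)\<^sup>2)"
      using Cauchy_Schwarz_ineq_sum[of "\<lambda>_. 1" v UNIV] by simp
    also have "(\<Sum>j\<in>UNIV. (v j)\<^sup>2) = (\<Sum>j\<in>UNIV. (a $ j)\<^sup>2)"
    proof (rule sum.cong[OF refl])
      fix j
      show "(v j)\<^sup>2 = (a $ j)\<^sup>2" using sgn[OF \<epsilon>, of j] by (auto simp: v_def \<alpha>_def J_def)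
    qed
    finally show ?thesis by (simp add: norm2 n_def)
  qed
  have "(\<Sum>\<epsilon>\<in>E. sqrt (n - (X \<epsilon>)\<^sup>2) * w \<epsilon>) \<le> (\<Sum>\<epsilon>\<in>E. (n - X \<epsilon>) / sqrt (n - 1) * w \<epsilon>)"
    using w0 X2 n1 by (intro sum_mono mult_right_mono sqrt_le_tangent) auto
  also have "\<dots> = (n * (\<Sum>\<epsilon>\<in>E. w \<epsilon>) - (\<Sum>\<epsilon>\<in>E. X \<epsilon> * w \<epsilon>)) / sqrt (n - 1)"
    by (simp add: sum_subtractf sum_distrib_left sum_divide_distrib diff_divide_distrib left_diff_distrib)
  also have "\<dots> = (n * W - W / \<alpha>) / sqrt (n - 1)" unfolding W WX ..
  also have "\<dots> \<le> (n * W - W) / sqrt (n - 1)"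
  proof -
    have "W * 1 \<le> W * (1 / \<alpha>)" using W0 \<alpha> by (intro mult_left_mono) auto
    then show ?thesis using n1 by (intro divide_right_mono) auto
  qed
  also have "\<dots> = sqrt (n - 1) * W"
  proof -
    have "(n * W - W) / sqrt (n - 1) = (n - 1) / sqrt (n - 1) * W" by (simp add: left_diff_distrib)
    then show ?thesis using n1 by (simp add: real_div_sqrt)
  qed
  finally have 1: "(\<Sum>\<epsilon>\<in>E. sqrt (n - (X \<epsilon>)\<^sup>2) * w \<epsilon>) \<le> sqrt (n - 1) * W" .
  have "W * (\<alpha> ^ k * (2 * \<alpha>\<^sup>2 - 1)) \<le> 2 ^ (k + 1) * \<alpha>"
  proof -
    \<comment> \<open>The product inequality is applied to
      \<open>(a $ j)\<^sup>2 / \<alpha>\<^sup>2\<close>, whose sum is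
      \<open>(1 - \<alpha>\<^sup>2) / \<alpha>\<^sup>2\<close>. One minus this is
      \<open>(2 * \<alpha>\<^sup>2 - 1) / \<alpha>\<^sup>2\<close>, positive because
      \<open>1 < 2 * \<alpha>\<^sup>2\<close>.\<close>
    have "(2 * \<alpha>\<^sup>2 - 1) * \<alpha> ^ (2 * k) = (\<alpha>\<^sup>2) ^ (k + 1) * (1 - (\<Sum>j\<in>J. (a $ j)\<^sup>2 / \<alpha>\<^sup>2))"
    proof -
      define Y where "Y = (\<alpha>\<^sup>2) ^ k"
      have "\<alpha> ^ (2 * k) = Y" "(\<alpha>\<^sup>2) ^ (k + 1) = \<alpha>\<^sup>2 * Y" by (simp_all add: Y_def power_mult)
      moreover have "\<alpha>\<^sup>2 * (1 - (1 - \<alpha>\<^sup>2) / \<alpha>\<^sup>2) = 2 * \<alpha>\<^sup>2 - 1" using \<alpha>(2) by (simp add: field_simps)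
      ultimately show ?thesis
        unfolding sum_divide_distrib[symmetric] sumJ by (metis mult.assoc mult.commute)
    qed
    also have "\<dots> \<le> (\<alpha>\<^sup>2) ^ (k + 1) * (\<Prod>j\<in>J. 1 - (a $ j)\<^sup>2 / \<alpha>\<^sup>2)"
    proof (intro mult_left_mono one_minus_sum_le_prod J)
      fix j assume j: "j \<in> J"
      have "\<bar>a $ j\<bar>\<^sup>2 \<le> \<alpha>\<^sup>2" using uJ[OF j] by (intro power_mono) auto
      then show "(a $ j)\<^sup>2 / \<alpha>\<^sup>2 \<le> 1" using \<alpha>(2) by simp
    qed auto
    also have "\<dots> = (\<Prod>j\<in>J. \<alpha>\<^sup>2 * (1 - (a $ j)\<^sup>2 / \<alpha>\<^sup>2))" by (simp add: prod.distrib J(2))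
    also have "\<dots> = (\<Prod>j\<in>J. \<alpha>\<^sup>2 - (a $ j)\<^sup>2)" using \<alpha>(2) by (intro prod.cong) (auto simp: algebra_simps)
    finally have P: "(2 * \<alpha>\<^sup>2 - 1) * \<alpha> ^ (2 * k) \<le> (\<Prod>j\<in>J. \<alpha>\<^sup>2 - (a $ j)\<^sup>2)" .
    have Ppos: "0 < (\<Prod>j\<in>J. \<alpha>\<^sup>2 - (a $ j)\<^sup>2)"
      using P \<alpha>2 \<alpha>(2) by (smt (verit) zero_less_mult_iff zero_less_power)
    have "W * (\<Prod>j\<in>J. \<alpha>\<^sup>2 - (a $ j)\<^sup>2) = (2 * \<alpha>) ^ (k + 1)"
    proof -
      have "W = (2 * \<alpha>) ^ (k + 1) / (\<Prod>j\<in>J. \<alpha>\<^sup>2 - (a $ j)\<^sup>2)"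
        unfolding W_def prod_dividef by (simp add: J(2))
      then show ?thesis using Ppos by (metis less_irrefl nonzero_eq_divide_eq)
    qed
    moreover have "W * ((2 * \<alpha>\<^sup>2 - 1) * \<alpha> ^ (2 * k)) \<le> W * (\<Prod>j\<in>J. \<alpha>\<^sup>2 - (a $ j)\<^sup>2)"
      using P W0 by (rule mult_left_mono)
    moreover have "(W * (\<alpha> ^ k * (2 * \<alpha>\<^sup>2 - 1))) * \<alpha> ^ k = W * ((2 * \<alpha>\<^sup>2 - 1) * \<alpha> ^ (2 * k))"
    proof -
      have "\<alpha> ^ (2 * k) = \<alpha> ^ k * \<alpha> ^ k" unfolding mult_2 by (rule power_add)
      then show ?thesis by (simp only: mult_ac)
    qed
    moreover have "(2 * \<alpha>) ^ (k + 1) = (2 ^ (k + 1) * \<alpha>) * \<alpha> ^ k"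
      by (simp add: power_mult_distrib)
    ultimately have "(W * (\<alpha> ^ k * (2 * \<alpha>\<^sup>2 - 1))) * \<alpha> ^ k \<le> (2 ^ (k + 1) * \<alpha>) * \<alpha> ^ k"
      by linarith
    then show ?thesis by (rule mult_right_le_imp_le) (use \<alpha>(2) in simp)
  qed
  note Wb = this
  have kt: "(2 \<le> k \<and> 1 / sqrt 2 < t) \<or> (k = 1 \<and> 4 / 5 < t)" using nt by (auto simp: k_def)
  have 2: "(\<alpha> - t) ^ k * W \<le> 2 ^ (k + 1) * (1 - t) ^ k"
  proof -
    have "((\<alpha> - t) ^ k * W) * \<alpha> = W * ((\<alpha> - t) ^ k * \<alpha>)" by simp
    also have "\<dots> \<le> W * ((1 - t) ^ k * (\<alpha> ^ k * (2 * \<alpha>\<^sup>2 - 1)))"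
      using power_section_bound[OF \<alpha>(1,3) kt] W0 by (rule mult_left_mono)
    also have "\<dots> = (1 - t) ^ k * (W * (\<alpha> ^ k * (2 * \<alpha>\<^sup>2 - 1)))" by simp
    also have "\<dots> \<le> (1 - t) ^ k * (2 ^ (k + 1) * \<alpha>)" using Wb \<alpha> by (intro mult_left_mono) auto
    finally have "((\<alpha> - t) ^ k * W) * \<alpha> \<le> (2 ^ (k + 1) * (1 - t) ^ k) * \<alpha>" by (simp add: mult_ac)
    then show ?thesis by (rule mult_right_le_imp_le) (rule \<alpha>(2))
  qed
  have "(\<alpha> - t) ^ k / fact k * (\<Sum>\<epsilon>\<in>E. sqrt (n - (X \<epsilon>)\<^sup>2) * w \<epsilon>) \<le> (\<alpha> - t) ^ k / fact k * (sqrt (n - 1) * W)"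
    using 1 \<alpha> by (intro mult_left_mono) auto
  also have "\<dots> = sqrt (n - 1) / fact k * ((\<alpha> - t) ^ k * W)" by simp
  also have "\<dots> \<le> sqrt (n - 1) / fact k * (2 ^ (k + 1) * (1 - t) ^ k)"
    using 2 n1 by (intro mult_left_mono) auto
  finally show ?thesis
    unfolding J(3) unfolding k_def[symmetric] n_def[symmetric] \<alpha>_def[symmetric] J_def[symmetric] E_def[symmetric] X_def[symmetric]
    by (simp add: w_def mult.assoc)
qed

subsection \<open>The section orthogonal to a coordinate axis\<close>

lemma borel_measurable_facet_chart:
  "facet_chart \<epsilon> s b c p m \<in> borel_measurable (Pi\<^sub>M (UNIV - {p, m}) (\<lambda>_. lborel))"
proof -
  have "(\<lambda>y. facet_chart \<epsilon> s b c p m y $ j) \<in> borel_measurable (Pi\<^sub>M (UNIV - {p, m}) (\<lambda>_. lborel))" for j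
  proof -
    consider "j = p" | "j = m" "j \<noteq> p" | "j \<in> UNIV - {p, m}" by auto
    then show ?thesis
    proof cases
      case 1
      then show ?thesis unfolding facet_chart_def Let_def by simp
    next
      case 2
      then show ?thesis unfolding facet_chart_def Let_def by simp
    next
      case 3
      then have "(\<lambda>y. facet_chart \<epsilon> s b c p m y $ j) = (\<lambda>y. \<epsilon> j * y j)"
        by (auto simp: facet_chart_def Let_def)
      moreover have "(\<lambda>y. y j) \<in> borel_measurable (Pi\<^sub>M (UNIV - {p, m}) (\<lambda>_. lborel :: real measure))"
        using measurable_component_singleton[OF 3, of "\<lambda>_. lborel :: real measure"] by simp
      ultimately show ?thesis by simp
    qed
  qed
  then show ?thesis
    by (subst borel_measurable_euclidean_space) (auto simp: Basis_vec_def inner_axis)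
qed

text \<open>The shrunken simplices \<open>A\<close> in different facets are at distance at least \<open>2 * \<eta>\<close>, so a covering set
  of diameter at most \<open>\<eta>\<close> meets only one of them and the isodiametric inequality applies to it.\<close>
lemma hausdorff_pre_axis_section_ge:
  fixes p m :: "'n::finite"
  defines "k \<equiv> CARD('n) - 2"
  assumes n: "3 \<le> CARD('n)" and pm: "p \<noteq> m" and t: "0 < t"
    and \<eta>: "0 < \<eta>" "real (k + 1) * \<eta> \<le> 1 - t"
  shows "ennreal (sqrt (real CARD('n) - 1) / fact k * 2 ^ (CARD('n) - 1) * (1 - t - real (k + 1) * \<eta>) ^ k)
    \<le> hausdorff_pre (real k) \<eta> ({x. axis p 1 \<bullet> x = t} \<inter> frontier (cross_polytope :: (real^'n) set))"
  unfolding hausdorff_pre_def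
proof (rule INF_greatest)
  define c where "c = 1 - t"
  let ?I = "UNIV - {p, m}"
  let ?E = "Pi\<^sub>E (UNIV - {p}) (\<lambda>_. {-1, 1 :: real})"
  let ?X = "{x. axis p 1 \<bullet> x = t} \<inter> frontier (cross_polytope :: (real^'n) set)"
  fix C :: "nat \<Rightarrow> (real^'n) set"
  assume "C \<in> {C. ?X \<subseteq> (\<Union>i. C i) \<and> (\<forall>i. bounded (C i) \<and> diameter (C i) \<le> \<eta>)}"
  then have C: "?X \<subseteq> (\<Union>i. C i)" "\<And>i. bounded (C i)" "\<And>i. diameter (C i) \<le> \<eta>" by auto
  have k: "0 < k" using n by (simp add: k_def)
  have cI: "card ?I = k" using pm by (simp add: card_Diff_subset k_def)
  \<comment> \<open>The upper limit \<open>c - \<eta>\<close> keeps the eliminated coordinate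
    \<open>m\<close> at least \<eta> as well.\<close>
  define A where "A = {y \<in> extensional ?I. (\<forall>i\<in>?I. \<eta> \<le> y i) \<and> (\<Sum>i\<in>?I. 1 * y i) \<le> c - \<eta>}"
  define \<Phi> where "\<Phi> \<epsilon> = facet_chart \<epsilon> 1 (\<lambda>_. 1) c p m" for \<epsilon>
  define \<mu> where "\<mu> = Pi\<^sub>M ?I (\<lambda>_. lborel :: real measure)"
  \<comment> \<open>Covering sets may be arbitrary; their closures have the same diameter and
    measurable preimages.\<close>
  define S where "S \<epsilon> i = {y \<in> A. \<Phi> \<epsilon> y \<in> closure (C i)}" for \<epsilon> i
  have sgn: "\<epsilon> j = -1 \<or> \<epsilon> j = 1" if "\<epsilon> \<in> ?E" "j \<noteq> p" for \<epsilon> j using PiE_mem[OF that(1), of j] that by simp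
  \<comment> \<open>For an axis all weights are 1, so \<gamma> vanishes, in accordance with
    coordinate \<open>p\<close> being constant on the section.\<close>
  have chart: "affine_chart ?I (\<lambda>_. 1) (\<lambda>_. 0) (\<Phi> \<epsilon>) k" if \<epsilon>: "\<epsilon> \<in> ?E" for \<epsilon>
  proof -
    have "(\<epsilon> j)\<^sup>2 = 1" if "j \<noteq> p" for j using sgn[OF \<epsilon> that] by auto
    then show ?thesis
      unfolding k_def \<Phi>_def using affine_chart_facet[OF pm, of "\<lambda>_. 1" 1 \<epsilon> c] n by simp
  qed
  have gram: "gram2 ?I (\<lambda>_. 1) (\<lambda>_. 0) = real CARD('n) - 1"
    using n cI by (simp add: gram2_def k_def del: card_Diff_insert)
  have A_meas: "A \<in> sets \<mu>" unfolding A_def \<mu>_def by (rule sets_PiM_simplex) simp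
  \<comment> \<open>One margin \<eta> is lost for each of the \<open>k\<close> free coordinates and
    one more for \<open>m\<close>.\<close>
  have A_vol: "emeasure \<mu> A = ennreal ((c - real (k + 1) * \<eta>) ^ k / fact k)"
  proof -
    have "\<eta> * sum (\<lambda>_. 1) ?I \<le> c - \<eta>" using \<eta> cI by (simp add: c_def algebra_simps del: card_Diff_insert)
    moreover have "c - \<eta> - \<eta> * sum (\<lambda>_. 1) ?I = c - real (k + 1) * \<eta>" using cI by (simp add: algebra_simps del: card_Diff_insert)
    ultimately show ?thesis
      unfolding A_def \<mu>_def by (subst emeasure_weighted_simplex) (auto simp: cI algebra_simps simp del: card_Diff_insert)
  qed
  have coord: "\<Phi> \<epsilon> y $ p = t" "\<And>j. j \<noteq> p \<Longrightarrow> \<exists>v\<ge>\<eta>. \<Phi> \<epsilon> y $ j = \<epsilon> j * v" "l1_norm (\<Phi> \<epsilon> y) = 1"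
    if \<epsilon>: "\<epsilon> \<in> ?E" and y: "y \<in> A" for \<epsilon> y
  proof -
    show p: "\<Phi> \<epsilon> y $ p = t" by (simp add: \<Phi>_def facet_chart_def Let_def c_def)
    show "\<exists>v\<ge>\<eta>. \<Phi> \<epsilon> y $ j = \<epsilon> j * v" if j: "j \<noteq> p" for j
    proof (cases "j = m")
      case True
      then show ?thesis using j y by (intro exI[of _ "c - (\<Sum>i\<in>?I. y i)"]) (auto simp: \<Phi>_def facet_chart_def Let_def A_def)
    next
      case False
      then show ?thesis using j y by (intro exI[of _ "y j"]) (auto simp: \<Phi>_def facet_chart_def Let_def A_def)
    qed
    have U: "UNIV = insert p (insert m ?I)" by auto
    have "l1_norm (\<Phi> \<epsilon> y) = \<bar>\<Phi> \<epsilon> y $ p\<bar> + (\<bar>\<Phi> \<epsilon> y $ m\<bar> + (\<Sum>i\<in>?I. \<bar>\<Phi> \<epsilon> y $ i\<bar>))"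
      unfolding l1_norm_def using pm by (subst U, subst sum.insert, simp, simp, subst sum.insert) auto
    also have "\<bar>\<Phi> \<epsilon> y $ p\<bar> = t" using p t by simp
    also have "\<bar>\<Phi> \<epsilon> y $ m\<bar> = c - (\<Sum>i\<in>?I. y i)"
      using pm y \<eta> sgn[OF \<epsilon>, of m] by (auto simp: \<Phi>_def facet_chart_def Let_def A_def)
    also have "(\<Sum>i\<in>?I. \<bar>\<Phi> \<epsilon> y $ i\<bar>) = (\<Sum>i\<in>?I. y i)"
    proof (rule sum.cong[OF refl])
      fix i assume i: "i \<in> ?I"
      then have "0 \<le> y i" using y \<eta>(1) by (auto simp: A_def intro: order_trans[of 0 \<eta>])
      then show "\<bar>\<Phi> \<epsilon> y $ i\<bar> = y i" using i sgn[OF \<epsilon>, of i] by (auto simp: \<Phi>_def facet_chart_def Let_def)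
    qed
    finally show "l1_norm (\<Phi> \<epsilon> y) = 1" by (simp add: c_def)
  qed
  have S_meas: "S \<epsilon> i \<in> sets \<mu>" for \<epsilon> i
  proof -
    have "\<Phi> \<epsilon> -` closure (C i) \<inter> space \<mu> \<in> sets \<mu>"
      using borel_measurable_facet_chart unfolding \<Phi>_def \<mu>_def by (rule measurable_sets) auto
    then have "A \<inter> (\<Phi> \<epsilon> -` closure (C i) \<inter> space \<mu>) \<in> sets \<mu>" using A_meas by auto
    moreover have "S \<epsilon> i = A \<inter> (\<Phi> \<epsilon> -` closure (C i) \<inter> space \<mu>)"
      unfolding S_def \<mu>_def by (auto simp: space_PiM PiE_def A_def)
    ultimately show ?thesis by simp
  qed
  define G where "G = real CARD('n) - 1"
  have G: "0 < G" using n by (simp add: G_def)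
  have diam: "dist x y \<le> diameter (C i)" if "x \<in> closure (C i)" "y \<in> closure (C i)" for x y i
    using diameter_bounded_bound[OF bounded_closure[OF C(2)] that] diameter_closure[OF C(2)] by simp
  have one: "(\<Sum>\<epsilon>\<in>?E. ennreal (sqrt G) * emeasure \<mu> (S \<epsilon> i))
      \<le> ennreal (unit_ball_vol (real k) / 2 powr real k * diameter (C i) powr real k)" for i
  proof (cases "\<exists>\<epsilon>\<in>?E. S \<epsilon> i \<noteq> {}")
    case False
    then have "(\<Sum>\<epsilon>\<in>?E. ennreal (sqrt G) * emeasure \<mu> (S \<epsilon> i)) = 0" by (intro sum.neutral) auto
    then show ?thesis by simp
  next
    case True
    then obtain \<epsilon> y where \<epsilon>: "\<epsilon> \<in> ?E" and y: "y \<in> S \<epsilon> i" by blast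
    have "S \<epsilon>' i = {}" if \<epsilon>': "\<epsilon>' \<in> ?E" "\<epsilon>' \<noteq> \<epsilon>" for \<epsilon>'
    proof (rule ccontr)
      assume "S \<epsilon>' i \<noteq> {}"
      then obtain z where z: "z \<in> S \<epsilon>' i" by blast
      obtain j where j: "j \<noteq> p" "\<epsilon>' j \<noteq> \<epsilon> j"
        using \<epsilon>' PiE_ext[OF \<epsilon>'(1) \<epsilon>] by auto
      obtain u where u: "\<eta> \<le> u" "\<Phi> \<epsilon> y $ j = \<epsilon> j * u" using coord(2)[OF \<epsilon> _ j(1)] y by (auto simp: S_def)
      obtain v where v: "\<eta> \<le> v" "\<Phi> \<epsilon>' z $ j = \<epsilon>' j * v" using coord(2)[OF \<epsilon>'(1) _ j(1)] z by (auto simp: S_def)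
      have "\<epsilon>' j = - \<epsilon> j" using sgn[OF \<epsilon> j(1)] sgn[OF \<epsilon>'(1) j(1)] j(2) by auto
      then have "2 * \<eta> \<le> \<bar>(\<Phi> \<epsilon> y - \<Phi> \<epsilon>' z) $ j\<bar>" using u v \<eta> sgn[OF \<epsilon> j(1)] by auto
      also have "\<dots> \<le> dist (\<Phi> \<epsilon> y) (\<Phi> \<epsilon>' z)" unfolding dist_norm by (rule component_le_norm_cart)
      also have "\<dots> \<le> \<eta>" using diam[of "\<Phi> \<epsilon> y" i "\<Phi> \<epsilon>' z"] y z C(3)[of i] by (simp add: S_def)
      finally show False using \<eta> by simp
    qed
    then have "(\<Sum>\<epsilon>\<in>?E. ennreal (sqrt G) * emeasure \<mu> (S \<epsilon> i)) = (\<Sum>\<epsilon>\<in>{\<epsilon>}. ennreal (sqrt G) * emeasure \<mu> (S \<epsilon> i))"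
      using \<epsilon> by (intro sum.mono_neutral_right finite_PiE) auto
    also have "\<dots> = ennreal (sqrt G) * emeasure \<mu> (S \<epsilon> i)" by simp
    also have "\<dots> \<le> ennreal (unit_ball_vol (real k) * (diameter (C i) / 2) ^ k)"
    proof -
      interpret affine_chart ?I "\<lambda>_. 1" "\<lambda>_. 0" "\<Phi> \<epsilon>" k by (rule chart[OF \<epsilon>])
      show ?thesis
        using emeasure_le_isodiametric[of "S \<epsilon> i" "diameter (C i)"] S_meas diam diameter_ge_0[OF C(2)]
        unfolding gram G_def \<mu>_def by (auto simp: S_def)
    qed
    also have "unit_ball_vol (real k) * (diameter (C i) / 2) ^ k = unit_ball_vol (real k) / 2 powr real k * diameter (C i) powr real k"
      using k diameter_ge_0[OF C(2), of i] by (simp add: power_divide powr_realpow powr_realpow')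
    finally show ?thesis .
  qed
  have sub: "A \<subseteq> (\<Union>i. S \<epsilon> i)" if \<epsilon>: "\<epsilon> \<in> ?E" for \<epsilon>
  proof
    fix y assume y: "y \<in> A"
    have "\<Phi> \<epsilon> y \<in> ?X"
      using coord[OF \<epsilon> y] unfolding frontier_cross_polytope by (simp add: inner_axis' )
    then obtain i where "\<Phi> \<epsilon> y \<in> C i" using C(1) by blast
    then have "y \<in> S \<epsilon> i" using y closure_subset by (auto simp: S_def)
    then show "y \<in> (\<Union>i. S \<epsilon> i)" by blast
  qed
  have cE: "card ?E = 2 ^ (CARD('n) - 1)" by (simp add: card_PiE card_Diff_singleton numeral_2_eq_2)
  have "ennreal (sqrt (real CARD('n) - 1) / fact k * 2 ^ (CARD('n) - 1) * (1 - t - real (k + 1) * \<eta>) ^ k)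
      = (\<Sum>\<epsilon>\<in>?E. ennreal (sqrt G) * emeasure \<mu> A)"
  proof -
    have "(\<Sum>\<epsilon>\<in>?E. ennreal (sqrt G) * emeasure \<mu> A) = of_nat (card ?E) * ennreal (sqrt G * ((c - real (k + 1) * \<eta>) ^ k / fact k))"
      unfolding A_vol sum_constant using G by (subst ennreal_mult') auto
    also have "\<dots> = ennreal (real (card ?E) * (sqrt G * ((c - real (k + 1) * \<eta>) ^ k / fact k)))"
      unfolding ennreal_of_nat_eq_real_of_nat by (rule ennreal_mult'[symmetric]) simp
    finally show ?thesis unfolding cE G_def c_def by (simp add: mult_ac)
  qed
  \<comment> \<open>Every facet is covered separately. Exchanging the sums then charges each
    covering set with the facets it meets, of which there is at most one.\<close>
  also have "\<dots> \<le> (\<Sum>\<epsilon>\<in>?E. \<Sum>i. ennreal (sqrt G) * emeasure \<mu> (S \<epsilon> i))"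
  proof (rule sum_mono)
    fix \<epsilon> assume \<epsilon>: "\<epsilon> \<in> ?E"
    have "emeasure \<mu> A \<le> emeasure \<mu> (\<Union>i. S \<epsilon> i)" using sub[OF \<epsilon>] S_meas by (intro emeasure_mono) auto
    also have "\<dots> \<le> (\<Sum>i. emeasure \<mu> (S \<epsilon> i))" using S_meas by (intro emeasure_subadditive_countably) auto
    finally show "ennreal (sqrt G) * emeasure \<mu> A \<le> (\<Sum>i. ennreal (sqrt G) * emeasure \<mu> (S \<epsilon> i))"
      unfolding ennreal_suminf_cmult by (rule mult_left_mono) simp
  qed
  also have "\<dots> = (\<Sum>i. \<Sum>\<epsilon>\<in>?E. ennreal (sqrt G) * emeasure \<mu> (S \<epsilon> i))"
    by (rule suminf_sum[symmetric]) auto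
  also have "\<dots> \<le> (\<Sum>i. ennreal (unit_ball_vol (real k) / 2 powr real k * diameter (C i) powr real k))"
    by (intro suminf_le one) auto
  finally show "ennreal (sqrt (real CARD('n) - 1) / fact k * 2 ^ (CARD('n) - 1) * (1 - t - real (k + 1) * \<eta>) ^ k)
      \<le> (\<Sum>i. ennreal (unit_ball_vol (real k) / 2 powr real k * diameter (C i) powr real k))" .
qed

text \<open>The margin is chosen so that all \<open>k + 1\<close> losses together amount to a
  fraction \<open>1 / (j + 1)\<close> of \<open>1 - t\<close>, which tends to 0. At
  \<open>t = 1\<close> no positive margin fits, but the bound is 0.\<close>

lemma hausdorff_measure_axis_section_ge:
  fixes p :: "'n::finite"
  assumes n: "3 \<le> CARD('n)" and t: "0 < t" "t \<le> 1"
  shows "ennreal (sqrt (real CARD('n) - 1) / fact (CARD('n) - 2) * 2 ^ (CARD('n) - 1) * (1 - t) ^ (CARD('n) - 2))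
    \<le> hausdorff_measure (real (CARD('n) - 2)) ({x. axis p 1 \<bullet> x = t} \<inter> frontier (cross_polytope :: (real^'n) set))"
    (is "_ \<le> hausdorff_measure _ ?X")
proof (cases "t = 1")
  case True
  then show ?thesis using n by (simp add: power_0_left)
next
  case False
  define k where "k = CARD('n) - 2"
  define c where "c = 1 - t"
  have c: "0 < c" using False t by (simp add: c_def)
  obtain m where pm: "p \<noteq> m" using exists_other_index[OF n] .
  let ?r = "\<lambda>j. inverse (real (Suc j))"
  have le: "ennreal (sqrt (real CARD('n) - 1) / fact k * 2 ^ (CARD('n) - 1) * (c - c * ?r j) ^ k)
      \<le> hausdorff_measure (real k) ?X" for j
  proof -
    define \<eta> where "\<eta> = c * ?r j / real (k + 1)"
    have \<eta>: "0 < \<eta>" "real (k + 1) * \<eta> = c * ?r j" using c by (simp_all add: \<eta>_def)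
    have "c * ?r j \<le> c * 1" using c by (intro mult_left_mono) (auto simp: inverse_le_1_iff)
    then have "ennreal (sqrt (real CARD('n) - 1) / fact k * 2 ^ (CARD('n) - 1) * (c - c * ?r j) ^ k) \<le> hausdorff_pre (real k) \<eta> ?X"
      using hausdorff_pre_axis_section_ge[OF n pm t(1) \<eta>(1)] \<eta>(2) unfolding k_def c_def by simp
    also have "\<dots> \<le> hausdorff_measure (real k) ?X"
      unfolding hausdorff_measure_def using \<eta> by (intro SUP_upper) auto
    finally show ?thesis .
  qed
  have "(\<lambda>j. sqrt (real CARD('n) - 1) / fact k * 2 ^ (CARD('n) - 1) * (c - c * ?r j) ^ k)
      \<longlonglongrightarrow> sqrt (real CARD('n) - 1) / fact k * 2 ^ (CARD('n) - 1) * (c - c * 0) ^ k"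
    by (intro tendsto_intros LIMSEQ_inverse_real_of_nat)
  then have "(\<lambda>j. ennreal (sqrt (real CARD('n) - 1) / fact k * 2 ^ (CARD('n) - 1) * (c - c * ?r j) ^ k))
      \<longlonglongrightarrow> ennreal (sqrt (real CARD('n) - 1) / fact k * 2 ^ (CARD('n) - 1) * c ^ k)"
    by (intro tendsto_ennrealI) simp
  then have "ennreal (sqrt (real CARD('n) - 1) / fact k * 2 ^ (CARD('n) - 1) * c ^ k) \<le> hausdorff_measure (real k) ?X"
    by (rule LIMSEQ_le_const2) (use le in auto)
  then show ?thesis unfolding k_def c_def .
qed

section \<open>Assembling the two bounds\<close>

lemma section_empty:
  fixes a :: "real^'n"
  assumes "\<And>i. \<bar>a $ i\<bar> < t"
  shows "{x. a \<bullet> x = t} \<inter> frontier cross_polytope = {}"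
proof -
  \<comment> \<open>The maximum gives a uniform gap below \<open>t\<close>; termwise strictness
    would fail where \<open>x\<close> has zero coordinates.\<close>
  define M where "M = Max (range (\<lambda>i. \<bar>a $ i\<bar>))"
  have M: "\<bar>a $ i\<bar> \<le> M" for i unfolding M_def by (intro Max_ge) auto
  have "M \<in> range (\<lambda>i. \<bar>a $ i\<bar>)" unfolding M_def by (intro Max_in) auto
  then have "M < t" using assms by auto
  have "a \<bullet> x < t" if "l1_norm x = 1" for x
  proof -
    have "a \<bullet> x = (\<Sum>i\<in>UNIV. a $ i * x $ i)" by (simp add: inner_vec_def)
    also have "\<dots> \<le> (\<Sum>i\<in>UNIV. M * \<bar>x $ i\<bar>)"
    proof (rule sum_mono)
      fix i
      have "a $ i * x $ i \<le> \<bar>a $ i\<bar> * \<bar>x $ i\<bar>" by (metis abs_ge_self abs_mult)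
      also have "\<dots> \<le> M * \<bar>x $ i\<bar>" using M by (intro mult_right_mono) auto
      finally show "a $ i * x $ i \<le> M * \<bar>x $ i\<bar>" .
    qed
    also have "\<dots> = M" using that by (simp add: l1_norm_def sum_distrib_left[symmetric])
    finally show ?thesis using \<open>M < t\<close> by simp
  qed
  then show ?thesis unfolding frontier_cross_polytope by fastforce
qed

lemma hausdorff_measure_section_le:
  fixes a :: "real^'n"
  assumes a: "norm a = 1"
    and nt: "(CARD('n) \<ge> 4 \<and> 1 / sqrt 2 < t \<and> t \<le> 1) \<or> (CARD('n) = 3 \<and> 4 / 5 < t \<and> t \<le> 1)"
  shows "hausdorff_measure (real (CARD('n) - 2)) ({x. a \<bullet> x = t} \<inter> frontier cross_polytope)
    \<le> ennreal (sqrt (real CARD('n) - 1) / fact (CARD('n) - 2) * 2 ^ (CARD('n) - 1) * (1 - t) ^ (CARD('n) - 2))"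
  unfolding hausdorff_measure_def
proof (rule SUP_least)
  fix \<delta> :: real assume "\<delta> \<in> {0<..}"
  then have \<delta>: "0 < \<delta>" by simp
  have n: "3 \<le> CARD('n)" using nt by auto
  have "1 / sqrt 2 < (4 / 5 :: real)" by (rule power2_less_imp_less) (auto simp: power_divide)
  then have t: "1 / sqrt 2 < t" using nt by auto
  show "hausdorff_pre (real (CARD('n) - 2)) \<delta> ({x. a \<bullet> x = t} \<inter> frontier cross_polytope)
    \<le> ennreal (sqrt (real CARD('n) - 1) / fact (CARD('n) - 2) * 2 ^ (CARD('n) - 1) * (1 - t) ^ (CARD('n) - 2))"
  proof (cases "\<exists>p. t \<le> \<bar>a $ p\<bar>")
    case True
    then obtain p where p: "t \<le> \<bar>a $ p\<bar>" by blast
    have "\<bar>a $ j\<bar> < \<bar>a $ p\<bar>" if "j \<noteq> p" for j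
      using abs_component_less[OF a t p that] p by linarith
    then show ?thesis
      using hausdorff_pre_section_le[OF a t p n \<delta>] section_sum_le[OF a p] nt
      by (meson ennreal_leI order_trans)
  next
    case False
    then have empty: "{x. a \<bullet> x = t} \<inter> frontier cross_polytope = {}" by (intro section_empty) (auto simp: not_le)
    show ?thesis unfolding empty by (subst hausdorff_pre_empty) (use n \<delta> in auto)
  qed
qed

theorem theorem3:
  fixes a :: "real^'n" and t :: real and k :: 'n
  assumes "norm a = 1"
    and "(CARD('n) \<ge> 4 \<and> 1 / sqrt 2 < t \<and> t \<le> 1) \<or> (CARD('n) = 3 \<and> 4 / 5 < t \<and> t \<le> 1)"
  shows "perimeter a t \<le> perimeter (axis k 1) t \<and>
         perimeter (axis k (1::real) :: real^'n) t =
           ennreal (sqrt (real CARD('n) - 1) / fact (CARD('n) - 2)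
                    * 2 ^ (CARD('n) - 1) * (1 - t) ^ (CARD('n) - 2))"
proof -
  have n: "3 \<le> CARD('n)" using assms(2) by auto
  then have dim: "real CARD('n) - 2 = real (CARD('n) - 2)" by (simp add: of_nat_diff)
  have "0 < 1 / sqrt (2::real)" by simp
  then have t: "0 < t" "t \<le> 1" using assms(2) by linarith+
  \<comment> \<open>Stated for every unit vector, since it also supplies the upper half of the
    formula for the axis.\<close>
  have upper: "perimeter b t \<le> ennreal (sqrt (real CARD('n) - 1) / fact (CARD('n) - 2)
      * 2 ^ (CARD('n) - 1) * (1 - t) ^ (CARD('n) - 2))" if "norm b = 1" for b :: "real^'n"
    unfolding perimeter_def dim by (rule hausdorff_measure_section_le[OF that assms(2)])
  have "perimeter (axis k (1::real) :: real^'n) t = ennreal (sqrt (real CARD('n) - 1) / fact (CARD('n) - 2)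
      * 2 ^ (CARD('n) - 1) * (1 - t) ^ (CARD('n) - 2))"
  proof (rule antisym)
    show "ennreal (sqrt (real CARD('n) - 1) / fact (CARD('n) - 2) * 2 ^ (CARD('n) - 1) * (1 - t) ^ (CARD('n) - 2))
        \<le> perimeter (axis k (1::real) :: real^'n) t"
      unfolding perimeter_def dim by (rule hausdorff_measure_axis_section_ge[OF n t])
  qed (rule upper, simp)
  then show ?thesis using upper[OF assms(1)] by simp
qed

end
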